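(* Let $F/\mathbf{Q}$ be a totally real number field of degree $k$ with ring of integers $\mathcal{O}$, $p$ a rational prime, and $\mathcal{N}\ne\mathcal{O}$ a nonzero ideal prime to $p$ with $\mathcal{O}/\mathcal{N}\simeq\mathbf{Z}/N$, $N=\mathrm{Nm}(\mathcal{N})$. Let $x\in F$ be integral at all primes dividing $\mathcal{N}p$, and let $V=\{v_1,\dots,v_k\}$ be a $\mathbf{Q}$-basis of $F$ consisting of totally positive elements of $\mathcal{O}$ that are prime to $\mathcal{N}$. Then the attached $p$-adic measure $\mu_{V,x,\mathcal{N}}$ on $\mathcal{O}_{V^\dagger,p}$ (see context) is valued in $\mathbf{Z}[1/N]$, and $$\mu_{V,x,\mathcal{N}}(x+l\cdot v+p^n\mathcal{O}_{V,p})=(-1)^k\left[\frac{1}{N^{k-1}}H_V\left(\frac{x+l\cdot v}{p^n}\right)-\left(\frac{N-1}{2}\right)^k\right]$$ for all $n\in\mathbf{Z}_{\ge0}$ and all $l=(l_1,\dots,l_k)\in\mathbf{Z}^k$ with $0\le l_1,\dots,l_k<p^n$, where for $y\in F$ integral at the primes dividing $\mathcal{N}$ $$H_V(y)=\sum_{\substack{1\le d_1,\dots,d_k<N\\ d_1v_1+\cdots+d_kv_k\equiv -y\bmod\mathcal{N}}}d_1d_2\cdots d_k.$$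
   Context: Notation: $l\cdot v=\sum_i l_iv_i$; $F_p=F\otimes_{\mathbf{Q}}\mathbf{Q}_p$, which has $V$ as a $\mathbf{Q}_p$-basis; $\mathcal{O}_{V,p}=\mathbf{Z}_pv_1+\cdots+\mathbf{Z}_pv_k\subset F_p$. Choose $r\in\mathbf{Z}_{\ge0}$ with $x\in p^{-r}\mathcal{O}_{V,p}$, put $v_i'=p^{-r}v_i$, $V^\dagger=\{v_1',\dots,v_k'\}$ and $\mathcal{O}_{V^\dagger,p}=p^{-r}\mathcal{O}_{V,p}=\bigoplus_i\mathbf{Z}_pv_i'$. An element of $F$ integral at the primes dividing $\mathcal{N}$ has a well-defined residue in $\mathcal{O}/\mathcal{N}$, and congruences mod $\mathcal{N}$ are between such residues. Let $R$ be a sufficiently large finite flat extension of $\mathbf{Z}_p$ (ring of integers of a finite extension of $\mathbf{Q}_p$ containing the $N$-th roots of unity). $R$-valued measures $\mu$ on $\mathcal{O}_{V^\dagger,p}$ correspond bijectively to power series in $\mathcal{A}_{V^\dagger}=R[[t_1-1,\dots,t_k-1]]$ via the Amice transform $\mu\mapsto\int_{\mathcal{O}_{V^\dagger,p}}t^\alpha\,\mu(\alpha)$, where $t^\alpha=t_1^{\alpha_1'}\cdots t_k^{\alpha_k'}$ for $\alpha=\sum_i\alpha_i'v_i'$, $\alpha_i'\in\mathbf{Z}_p$ (so $t^{v_i}=t_i^{p^r}$). The measure $\mu_{V,x,\mathcal{N}}$ is the one corresponding to $$f_{V,x,\mathcal{N}}(t)=\sum_{1\neq\xi}\frac{\xi(x)t^x}{\prod_{1\le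 i\le k}(1-\xi(v_i)t^{v_i})}\in\mathcal{A}_{V^\dagger},$$ where $\xi$ runs over the nontrivial characters of the additive group $\mathcal{O}/\mathcal{N}$ (with values in $\bar{\mathbf{Q}}^\times$, $\bar{\mathbf Q}$ being embedded in $\mathbf{C}_p$). *)

theory Defs
  imports
    "HOL-Algebra.Algebraic_Closure_Type"
    "HOL-Algebra.QuotRing"
    "HOL-Algebra.IntRing"
    "HOL-Analysis.Abstract_Topology"
    "HOL-Library.Poly_Mapping"
    "HOL-Computational_Algebra.Formal_Power_Series"
    "HOL-Library.Cardinality"
begin

section \<open>The \<open>p\<close>-adic integers and numbers\<close>

class prime_type =
  assumes prime_CARD: "prime CARD('a)"

instance bool :: prime_type
  by standard simp

text \<open>
  The prime is \<open>p = CARD('p)\<close>. An element of \<open>\<int>\<^sub>p\<close> is a sequence of residues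
  \<open>a n \<in> {0..<p ^ n}\<close> with \<open>a (n + 1) \<equiv> a n\<close> modulo \<open>p ^ n\<close>; both conditions are
  contained in the single equation below.
\<close>

typedef ('p :: prime_type) padic_int =
  "{a :: nat \<Rightarrow> int. \<forall>n. a n = a (Suc n) mod int CARD('p) ^ n}"
  by (rule exI[of _ "\<lambda>_. 0"]) simp

setup_lifting type_definition_padic_int

lemma mod_power_Suc_mod: "(a :: int) mod q ^ Suc n mod q ^ n = a mod q ^ n"
  by (simp add: mod_mod_cancel)

lemma padic_int_coherent_arith:
  fixes q :: int
  assumes "\<forall>n. a n = a (Suc n) mod q ^ n" "\<forall>n. b n = b (Suc n) mod q ^ n"
  shows "(a n + b n) mod q ^ n = (a (Suc n) + b (Suc n)) mod q ^ Suc n mod q ^ n"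
    and "(a n - b n) mod q ^ n = (a (Suc n) - b (Suc n)) mod q ^ Suc n mod q ^ n"
    and "(a n * b n) mod q ^ n = (a (Suc n) * b (Suc n)) mod q ^ Suc n mod q ^ n"
    and "(- a n) mod q ^ n = (- a (Suc n)) mod q ^ Suc n mod q ^ n"
proof -
  have a: "a n = a (Suc n) mod q ^ n" and b: "b n = b (Suc n) mod q ^ n"
    using assms by blast+
  show "(a n + b n) mod q ^ n = (a (Suc n) + b (Suc n)) mod q ^ Suc n mod q ^ n"
    unfolding mod_power_Suc_mod by (subst a, subst b) (rule mod_add_eq)
  show "(a n - b n) mod q ^ n = (a (Suc n) - b (Suc n)) mod q ^ Suc n mod q ^ n"
    unfolding mod_power_Suc_mod by (subst a, subst b) (rule mod_diff_eq)
  show "(a n * b n) mod q ^ n = (a (Suc n) * b (Suc n)) mod q ^ Suc n mod q ^ n"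
    unfolding mod_power_Suc_mod by (subst a, subst b) (rule mod_mult_eq)
  show "(- a n) mod q ^ n = (- a (Suc n)) mod q ^ Suc n mod q ^ n"
    unfolding mod_power_Suc_mod by (subst a) (rule mod_minus_eq)
qed

instantiation padic_int :: (prime_type) comm_ring_1
begin

lift_definition zero_padic_int :: "'a padic_int" is "\<lambda>_. 0" by simp

lift_definition one_padic_int :: "'a padic_int" is "\<lambda>n. 1 mod int CARD('a) ^ n"
  by (simp only: mod_power_Suc_mod simp_thms)

lift_definition plus_padic_int :: "'a padic_int \<Rightarrow> 'a padic_int \<Rightarrow> 'a padic_int"
  is "\<lambda>a b n. (a n + b n) mod int CARD('a) ^ n"
  using padic_int_coherent_arith(1) by blast

lift_definition minus_padic_int :: "'a padic_int \<Rightarrow> 'a padic_int \<Rightarrow> 'a padic_int"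
  is "\<lambda>a b n. (a n - b n) mod int CARD('a) ^ n"
  using padic_int_coherent_arith(2) by blast

lift_definition times_padic_int :: "'a padic_int \<Rightarrow> 'a padic_int \<Rightarrow> 'a padic_int"
  is "\<lambda>a b n. (a n * b n) mod int CARD('a) ^ n"
  using padic_int_coherent_arith(3) by blast

lift_definition uminus_padic_int :: "'a padic_int \<Rightarrow> 'a padic_int"
  is "\<lambda>a n. (- a n) mod int CARD('a) ^ n"
  using padic_int_coherent_arith(4) by blast

instance
proof
  have red: "Rep_padic_int a n mod int CARD('a) ^ n = Rep_padic_int a n" for a :: "'a padic_int" and n
    using Rep_padic_int[of a] by (metis (mono_tags, lifting) mem_Collect_eq mod_mod_trivial)
  note rep = Rep_padic_int_inject[symmetric] fun_eq_iff zero_padic_int.rep_eq one_padic_int.rep_eq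
    plus_padic_int.rep_eq minus_padic_int.rep_eq times_padic_int.rep_eq uminus_padic_int.rep_eq
  fix a b c :: "'a padic_int"
  show "a * b * c = a * (b * c)" by (simp add: rep mod_simps mult.assoc)
  show "a * b = b * a" by (simp add: rep mult.commute)
  show "1 * a = a" by (simp add: rep mod_simps red)
  show "a + b + c = a + (b + c)" by (simp add: rep mod_simps add.assoc)
  show "a + b = b + a" by (simp add: rep add.commute)
  show "0 + a = a" by (simp add: rep red)
  show "- a + a = 0" by (simp add: rep mod_simps)
  show "a - b = a + - b" by (simp add: rep mod_simps)
  show "(a + b) * c = a * c + b * c" by (simp add: rep mod_simps distrib_right)
  show "(0 :: 'a padic_int) \<noteq> 1"
  proof
    assume "(0 :: 'a padic_int) = 1"
    hence "Rep_padic_int (0 :: 'a padic_int) 1 = Rep_padic_int (1 :: 'a padic_int) 1" by simp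
    thus False
      using prime_gt_1_nat[OF prime_CARD[where ?'a = 'a]]
      by (simp add: zero_padic_int.rep_eq one_padic_int.rep_eq)
  qed
qed

end

lemma padic_int_mod_le:
  fixes q :: int
  assumes "\<forall>n. a n = a (Suc n) mod q ^ n"
  shows "a m = a (m + j) mod q ^ m"
proof (induction j)
  case 0
  have "a m = a (Suc m) mod q ^ m" using assms by blast
  thus ?case by (metis add_0_right mod_mod_trivial)
next
  case (Suc j)
  have "a (m + j) = a (m + Suc j) mod q ^ (m + j)"
    unfolding add_Suc_right using assms by blast
  with Suc have "a m = a (m + Suc j) mod q ^ (m + j) mod q ^ m" by (rule trans[OF _ arg_cong])
  also have "\<dots> = a (m + Suc j) mod q ^ m" by (rule mod_mod_cancel) (simp add: power_add)
  finally show ?case .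
qed

instance padic_int :: (prime_type) idom
proof
  fix x y :: "'a padic_int"
  let ?q = "int CARD('a)"
  have q: "prime ?q" using prime_CARD by simp
  show "x \<noteq> 0 \<Longrightarrow> y \<noteq> 0 \<Longrightarrow> x * y \<noteq> 0"
  proof transfer
    fix a b :: "nat \<Rightarrow> int"
    assume a: "\<forall>n. a n = a (Suc n) mod int CARD('a) ^ n"
      and b: "\<forall>n. b n = b (Suc n) mod int CARD('a) ^ n"
    assume "a \<noteq> (\<lambda>_. 0)" "b \<noteq> (\<lambda>_. 0)"
    then obtain m n where m: "a m \<noteq> 0" and n: "b n \<noteq> 0" by (auto simp: fun_eq_iff)
    have A: "\<not> ?q ^ m dvd a (m + n)"
      by (metis padic_int_mod_le[OF a, of m n] m dvd_imp_mod_0)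
    have B: "\<not> ?q ^ n dvd b (m + n)"
      by (metis padic_int_mod_le[OF b, of n m] n dvd_imp_mod_0 add.commute)
    have "\<not> ?q ^ (m + n) dvd a (m + n) * b (m + n)"
    proof
      assume "?q ^ (m + n) dvd a (m + n) * b (m + n)"
      then obtain r s where rs: "r + s = m + n" and "?q ^ r dvd a (m + n)" "?q ^ s dvd b (m + n)"
        using prime_elem_power_dvd_prod[OF _ prime_imp_prime_elem[OF q]] by blast
      moreover have "m \<le> r \<or> n \<le> s" using rs by arith
      ultimately show False using A B by (blast intro: power_le_dvd)
    qed
    hence "a (m + n) * b (m + n) mod ?q ^ (m + n) \<noteq> 0" by (metis dvd_eq_mod_eq_0)
    thus "(\<lambda>n. a n * b n mod int CARD('a) ^ n) \<noteq> (\<lambda>_. 0)" by (auto dest: fun_cong)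
  qed
qed

lemma of_nat_padic_int: "Rep_padic_int (of_nat k :: 'p :: prime_type padic_int) n = int k mod int CARD('p) ^ n"
proof (induction k)
  case 0
  show ?case by (simp add: zero_padic_int.rep_eq)
next
  case (Suc k)
  thus ?case by (simp add: plus_padic_int.rep_eq one_padic_int.rep_eq mod_simps)
qed

instance padic_int :: (prime_type) ring_char_0
proof
  show "inj (of_nat :: nat \<Rightarrow> 'a padic_int)"
  proof (rule injI)
    fix k l :: nat
    assume eq: "(of_nat k :: 'a padic_int) = of_nat l"
    let ?q = "int CARD('a)"
    have 2: "2 \<le> CARD('a)" using prime_CARD by (rule prime_ge_2_nat)
    define n where "n = k + l"
    have "n < 2 ^ n" by simp
    also have "(2 :: nat) ^ n \<le> CARD('a) ^ n" using 2 by (rule power_mono) simp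
    finally have lt: "int n < ?q ^ n" by (metis of_nat_less_iff of_nat_power)
    have "int k mod ?q ^ n = int l mod ?q ^ n"
      using eq by (metis of_nat_padic_int)
    moreover have "int k \<le> int n" "int l \<le> int n" by (simp_all add: n_def)
    hence "int k < ?q ^ n" "int l < ?q ^ n" using lt by linarith+
    ultimately show "k = l" by (metis mod_pos_pos_trivial of_nat_0_le_iff of_nat_eq_iff)
  qed
qed

instance fract :: ("{idom, ring_char_0}") field_char_0
proof
  have "of_nat n = to_fract (of_nat n :: 'a)" for n
    by (induction n) auto
  thus "inj (of_nat :: nat \<Rightarrow> 'a fract)"
    by (auto intro!: injI)
qed

type_synonym 'p padic = "'p padic_int fract"


section \<open>The tensor product over \<open>\<rat>\<close>\<close>

inductive_set tensor_null :: "('a :: field_char_0 \<times> 'b :: field_char_0 \<Rightarrow>\<^sub>0 int) set" where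
  tensor_null_0: "0 \<in> tensor_null"
| tensor_null_diff: "u \<in> tensor_null \<Longrightarrow> w \<in> tensor_null \<Longrightarrow> u - w \<in> tensor_null"
| tensor_null_left: "frag_of (a + a', b) - frag_of (a, b) - frag_of (a', b) \<in> tensor_null"
| tensor_null_right: "frag_of (a, b + b') - frag_of (a, b) - frag_of (a, b') \<in> tensor_null"
| tensor_null_balanced: "frag_of (of_rat q * a, b) - frag_of (a, of_rat q * b) \<in> tensor_null"

lemma tensor_null_uminus: "u \<in> tensor_null \<Longrightarrow> - u \<in> tensor_null"
  using tensor_null_diff[OF tensor_null_0] by fastforce

lemma tensor_null_add: "u \<in> tensor_null \<Longrightarrow> w \<in> tensor_null \<Longrightarrow> u + w \<in> tensor_null"
  using tensor_null_diff[OF _ tensor_null_uminus] by fastforce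

text \<open>Only the additive group of \<open>F \<otimes>\<^sub>\<rat> \<rat>\<^sub>p\<close> is needed, not its multiplication.\<close>

quotient_type (overloaded) ('a, 'b) rat_tensor =
  "('a :: field_char_0 \<times> 'b :: field_char_0) \<Rightarrow>\<^sub>0 int" / "\<lambda>u w. u - w \<in> tensor_null"
proof (rule equivpI)
  show "reflp (\<lambda>u w :: ('a \<times> 'b) \<Rightarrow>\<^sub>0 int. u - w \<in> tensor_null)"
    by (rule reflpI) (simp add: tensor_null_0)
  show "symp (\<lambda>u w :: ('a \<times> 'b) \<Rightarrow>\<^sub>0 int. u - w \<in> tensor_null)"
    by (rule sympI) (use tensor_null_uminus in fastforce)
  show "transp (\<lambda>u w :: ('a \<times> 'b) \<Rightarrow>\<^sub>0 int. u - w \<in> tensor_null)"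
    by (rule transpI) (use tensor_null_add in fastforce)
qed

instantiation rat_tensor :: (field_char_0, field_char_0) ab_group_add
begin

lift_definition zero_rat_tensor :: "('a, 'b) rat_tensor" is 0 .

lift_definition plus_rat_tensor ::
  "('a, 'b) rat_tensor \<Rightarrow> ('a, 'b) rat_tensor \<Rightarrow> ('a, 'b) rat_tensor" is "(+)"
  by (metis add_diff_add tensor_null_add)

lift_definition minus_rat_tensor ::
  "('a, 'b) rat_tensor \<Rightarrow> ('a, 'b) rat_tensor \<Rightarrow> ('a, 'b) rat_tensor" is "(-)"
proof -
  fix u u' w w' :: "('a \<times> 'b) \<Rightarrow>\<^sub>0 int"
  assume "u - u' \<in> tensor_null" "w - w' \<in> tensor_null"
  hence "(u - u') - (w - w') \<in> tensor_null" by (rule tensor_null_diff)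
  thus "u - w - (u' - w') \<in> tensor_null" by (simp add: algebra_simps)
qed

lift_definition uminus_rat_tensor :: "('a, 'b) rat_tensor \<Rightarrow> ('a, 'b) rat_tensor" is uminus
  using tensor_null_uminus by fastforce

instance
  by standard (transfer; simp add: tensor_null_0 algebra_simps)+

end

lift_definition tensor :: "'a :: field_char_0 \<Rightarrow> 'b :: field_char_0 \<Rightarrow> ('a, 'b) rat_tensor"
  is "\<lambda>a b. frag_of (a, b)" .

lemma tensor_add_right: "tensor a (b + b') = tensor a b + tensor a b'"
  by transfer (simp add: diff_diff_eq[symmetric] tensor_null_right)

lemma tensor_balanced: "tensor (of_rat q * a) b = tensor a (of_rat q * b)"
  by transfer (rule tensor_null_balanced)


section \<open>Number fields\<close>

text \<open>
  A number field is (the universe of) a field type of characteristic zero that is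
  finite-dimensional over \<open>\<rat>\<close>; its dimension is \<open>rat_degree\<close>, which is \<open>0\<close> for
  infinite extensions.
\<close>

abbreviation rat_scale :: "rat \<Rightarrow> 'f :: field_char_0 \<Rightarrow> 'f" where
  "rat_scale q y \<equiv> of_rat q * y"

definition rat_degree :: "'f :: field_char_0 itself \<Rightarrow> nat" where
  "rat_degree _ = vector_space.dim rat_scale (UNIV :: 'f set)"

definition rat_basis :: "('n \<Rightarrow> 'f :: field_char_0) \<Rightarrow> bool" where
  "rat_basis v \<longleftrightarrow> inj v \<and> \<not> module.dependent rat_scale (range v)
     \<and> module.span rat_scale (range v) = UNIV"

definition totally_real :: "'f :: field_char_0 itself \<Rightarrow> bool" where
  "totally_real _ \<longleftrightarrow>
     (\<forall>\<sigma> \<in> ring_hom (ring_of_type_algebra :: 'f ring) (ring_of_type_algebra :: complex ring).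
        range \<sigma> \<subseteq> \<real>)"

definition totally_positive :: "'f :: field_char_0 \<Rightarrow> bool" where
  "totally_positive y \<longleftrightarrow>
     (\<forall>\<sigma> \<in> ring_hom (ring_of_type_algebra :: 'f ring) (ring_of_type_algebra :: real ring).
        \<sigma> y > 0)"

definition ring_of_integers :: "'f :: field_char_0 ring" (\<open>\<O>\<close>) where
  "\<O> = ring_of_type_algebra \<lparr>carrier := {y. algebraic_int y}\<rparr>"

text \<open>\<open>y\<close> lies in the localization of \<open>\<O>\<close> at the prime ideal \<open>P\<close>.\<close>

definition integral_at :: "'f :: field_char_0 set \<Rightarrow> 'f \<Rightarrow> bool" where
  "integral_at P y \<longleftrightarrow> (\<exists>a \<in> carrier \<O>. \<exists>b \<in> carrier \<O> - P. y = a / b)"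

text \<open>For ideals, to divide means to contain.\<close>

definition prime_to :: "'f :: field_char_0 set \<Rightarrow> 'f \<Rightarrow> bool" where
  "prime_to I b \<longleftrightarrow> (\<forall>P. primeideal P \<O> \<and> I \<subseteq> P \<longrightarrow> b \<notin> P)"

text \<open>
  For \<open>y\<close> integral at the primes dividing \<open>I\<close>, the element of \<open>\<O> Quot I\<close> (a coset of \<open>I\<close>)
  corresponding to the class of \<open>y\<close> under the isomorphism of \<open>\<O> Quot I\<close> with the quotient
  of the semi-localization of \<open>\<O>\<close> at \<open>I\<close> by the ideal generated by \<open>I\<close>.
\<close>

definition residue_mod :: "'f :: field_char_0 set \<Rightarrow> 'f \<Rightarrow> 'f set" where
  "residue_mod I y =
     {c \<in> carrier \<O>. \<exists>a \<in> I. \<exists>b \<in> carrier \<O>. prime_to I b \<and> y - c = a / b}"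

definition H_sum :: "'f :: field_char_0 set \<Rightarrow> ('n :: finite \<Rightarrow> 'f) \<Rightarrow> 'f \<Rightarrow> nat" where
  "H_sum I v y =
     (\<Sum>d | (\<forall>i. 1 \<le> d i \<and> d i < card (carrier (\<O> Quot I)))
           \<and> residue_mod I (\<Sum>i\<in>UNIV. of_nat (d i) * v i) = residue_mod I (- y).
        \<Prod>i\<in>UNIV. d i)"


section \<open>Characters of \<open>\<O>/I\<close>\<close>

definition Qbar :: "complex ring" where
  "Qbar = ring_of_type_algebra \<lparr>carrier := {z. algebraic z}\<rparr>"

definition quot_characters :: "'f :: field_char_0 set \<Rightarrow> ('f set \<Rightarrow> complex) set" where
  "quot_characters I =
     hom (add_monoid (\<O> Quot I)) (units_of Qbar) \<inter> extensional (carrier (\<O> Quot I))"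

definition trivial_character :: "'f :: field_char_0 set \<Rightarrow> 'f set \<Rightarrow> complex" where
  "trivial_character I = (\<lambda>c \<in> carrier (\<O> Quot I). 1)"


section \<open>Finite extensions of \<open>\<rat>\<^sub>p\<close>\<close>

definition finite_padic_extension :: "'p :: prime_type padic alg_closure set \<Rightarrow> bool" where
  "finite_padic_extension K \<longleftrightarrow> subfield K ring_of_type_algebra \<and> range to_ac \<subseteq> K
     \<and> (\<exists>B. finite B \<and> K = module.span (\<lambda>(a :: 'p padic) z. to_ac a * z) B)"

text \<open>The integral closure of \<open>\<int>\<^sub>p\<close> in \<open>K\<close>.\<close>

definition padic_integers_of ::
  "'p :: prime_type padic alg_closure set \<Rightarrow> 'p padic alg_closure set" where
  "padic_integers_of K = {z \<in> K. \<exists>q :: 'p padic_int poly.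
     lead_coeff q = 1 \<and> poly (map_poly (\<lambda>a. to_ac (to_fract a)) q) z = 0}"


section \<open>Lattices in \<open>F \<otimes> \<rat>\<^sub>p\<close>\<close>

text \<open>
  \<open>padic_lattice w\<close> is \<open>\<int>\<^sub>p w\<^sub>1 + \<dots> + \<int>\<^sub>p w\<^sub>k\<close> with \<open>w\<^sub>i \<in> F\<close>. In particular
  \<open>p\<^sup>n\<O>\<^bsub>V,p\<^esub>\<close> is \<open>padic_lattice (\<lambda>i. p ^ n * v i)\<close>, since \<open>v \<otimes> p\<^sup>n a = p\<^sup>n v \<otimes> a\<close>.
\<close>

definition padic_lattice ::
  "('n :: finite \<Rightarrow> 'f :: field_char_0) \<Rightarrow> ('f, 'p :: prime_type padic) rat_tensor set" where
  "padic_lattice w = range (\<lambda>a :: 'n \<Rightarrow> 'p padic_int. \<Sum>i\<in>UNIV. tensor (w i) (to_fract (a i)))"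

definition padic_coords ::
  "('n :: finite \<Rightarrow> 'f :: field_char_0) \<Rightarrow> ('f, 'p :: prime_type padic) rat_tensor
     \<Rightarrow> 'n \<Rightarrow> 'p padic" where
  "padic_coords w \<alpha> = (THE a. \<alpha> = (\<Sum>i\<in>UNIV. tensor (w i) (a i)))"

text \<open>The basis \<open>V\<^sup>\<dagger>\<close>.\<close>

definition dagger_basis :: "'p :: prime_type itself \<Rightarrow> nat \<Rightarrow> ('n \<Rightarrow> 'f :: field_char_0) \<Rightarrow> 'n \<Rightarrow> 'f" where
  "dagger_basis _ r w = (\<lambda>i. w i / of_nat CARD('p) ^ r)"

definition lattice_coset ::
  "('n :: finite \<Rightarrow> 'f :: field_char_0) \<Rightarrow> nat
     \<Rightarrow> ('f, 'p :: prime_type padic) rat_tensor \<Rightarrow> ('f, 'p padic) rat_tensor set" where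
  "lattice_coset w n \<alpha> = (\<lambda>\<beta>. \<alpha> + \<beta>) ` padic_lattice (\<lambda>i. of_nat CARD('p) ^ n * w i)"

text \<open>
  The topology of \<open>F \<otimes> \<rat>\<^sub>p\<close> as a \<open>\<rat>\<^sub>p\<close>-vector space. It does not depend on the basis \<open>w\<close>.
\<close>

definition padic_topology ::
  "('n :: finite \<Rightarrow> 'f :: field_char_0) \<Rightarrow> ('f, 'p :: prime_type padic) rat_tensor topology" where
  "padic_topology w = topology (\<lambda>U. \<forall>\<alpha>\<in>U. \<exists>n. lattice_coset w n \<alpha> \<subseteq> U)"

lemma padic_lattice_mono:
  "padic_lattice (\<lambda>i. of_nat CARD('p) ^ (n + m) * w i) \<subseteq>
    (padic_lattice (\<lambda>i. of_nat CARD('p) ^ n * w i) :: ('f, 'p :: prime_type padic) rat_tensor set)"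
  for w :: "'n :: finite \<Rightarrow> 'f :: field_char_0" and m n :: nat
proof (unfold padic_lattice_def, safe)
  fix a :: "'n \<Rightarrow> 'p padic_int"
  let ?q = "of_nat CARD('p)"
  have 1: "of_nat k = to_fract (of_nat k :: 'p padic_int)" for k by (induction k) auto
  have 2: "to_fract b ^ m = to_fract (b ^ m)" for b :: "'p padic_int" by (induction m) auto
  have "tensor (of_nat CARD('p) ^ (n + m) * w i) (to_fract (a i)) =
        tensor (of_nat CARD('p) ^ n * w i) (to_fract (?q ^ m * a i))" for i
  proof -
    have "tensor (of_nat CARD('p) ^ (n + m) * w i) (to_fract (a i)) =
          tensor (of_rat (?q ^ m) * (of_nat CARD('p) ^ n * w i)) (to_fract (a i))"
      by (simp add: power_add of_rat_power mult_ac)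
    also have "\<dots> = tensor (of_nat CARD('p) ^ n * w i) (of_rat (?q ^ m) * to_fract (a i))"
      by (rule tensor_balanced)
    also have "of_rat (?q ^ m) = (to_fract (?q ^ m) :: 'p padic)"
      by (simp only: of_rat_power of_rat_of_nat_eq 1 2)
    finally show ?thesis by simp
  qed
  thus "(\<Sum>i\<in>UNIV. tensor (of_nat CARD('p) ^ (n + m) * w i) (to_fract (a i)))
        \<in> range (\<lambda>a :: 'n \<Rightarrow> 'p padic_int. \<Sum>i\<in>UNIV. tensor (of_nat CARD('p) ^ n * w i) (to_fract (a i)))"
    by (intro image_eqI[of _ _ "\<lambda>i. ?q ^ m * a i"]) auto
qed

lemma openin_padic_topology:
  "openin (padic_topology w) U \<longleftrightarrow> (\<forall>\<alpha>\<in>U. \<exists>n. lattice_coset w n \<alpha> \<subseteq> U)"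
  for w :: "'n :: finite \<Rightarrow> 'f :: field_char_0" and U :: "('f, 'p :: prime_type padic) rat_tensor set"
proof -
  have mono: "lattice_coset w (n + m) \<alpha> \<subseteq> lattice_coset w n \<alpha>"
    for n m and \<alpha> :: "('f, 'p padic) rat_tensor"
    unfolding lattice_coset_def by (intro image_mono padic_lattice_mono)
  have "istopology (\<lambda>U :: ('f, 'p padic) rat_tensor set. \<forall>\<alpha>\<in>U. \<exists>n. lattice_coset w n \<alpha> \<subseteq> U)"
    unfolding istopology_def
  proof (intro conjI allI impI ballI)
    fix S T :: "('f, 'p padic) rat_tensor set" and \<alpha>
    assume "\<forall>\<alpha>\<in>S. \<exists>n. lattice_coset w n \<alpha> \<subseteq> S" "\<forall>\<alpha>\<in>T. \<exists>n. lattice_coset w n \<alpha> \<subseteq> T"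
      and "\<alpha> \<in> S \<inter> T"
    then obtain n m where "lattice_coset w n \<alpha> \<subseteq> S" "lattice_coset w m \<alpha> \<subseteq> T" by blast
    hence "lattice_coset w (n + m) \<alpha> \<subseteq> S \<inter> T"
      using mono[of n m \<alpha>] mono[of m n \<alpha>] by (auto simp: add.commute)
    thus "\<exists>n. lattice_coset w n \<alpha> \<subseteq> S \<inter> T" ..
  next
    fix \<U> :: "('f, 'p padic) rat_tensor set set" and \<alpha>
    assume U: "\<forall>U\<in>\<U>. \<forall>\<alpha>\<in>U. \<exists>n. lattice_coset w n \<alpha> \<subseteq> U" and "\<alpha> \<in> \<Union>\<U>"
    then obtain W where W: "W \<in> \<U>" "\<alpha> \<in> W" by blast
    then obtain n where "lattice_coset w n \<alpha> \<subseteq> W" using U by blast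
    thus "\<exists>n. lattice_coset w n \<alpha> \<subseteq> \<Union>\<U>" using W by blast
  qed
  thus ?thesis unfolding padic_topology_def by simp
qed


section \<open>Measures and the Amice transform\<close>

definition compact_opens ::
  "('n :: finite \<Rightarrow> 'f :: field_char_0) \<Rightarrow> ('f, 'p :: prime_type padic) rat_tensor set set" where
  "compact_opens w =
     {U. U \<subseteq> padic_lattice w \<and> openin (padic_topology w) U \<and> compactin (padic_topology w) U}"

text \<open>
  An \<open>R\<close>-valued measure on the profinite group \<open>padic_lattice w\<close> is a finitely additive function
  on its compact open subsets; off these its value is fixed to \<open>undefined\<close>.
\<close>

definition is_padic_measure ::
  "('n :: finite \<Rightarrow> 'f :: field_char_0) \<Rightarrow> 'p :: prime_type padic alg_closure set
     \<Rightarrow> (('f, 'p padic) rat_tensor set \<Rightarrow> 'p padic alg_closure) \<Rightarrow> bool" where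
  "is_padic_measure w R \<mu> \<longleftrightarrow> \<mu> \<in> compact_opens w \<rightarrow>\<^sub>E R
     \<and> (\<forall>U \<in> compact_opens w. \<forall>W \<in> compact_opens w.
          U \<inter> W = {} \<longrightarrow> \<mu> (U \<union> W) = \<mu> U + \<mu> W)"

text \<open>
  \<open>I = \<integral> g d\<mu>\<close>, as the limit in the \<open>p\<close>-adic topology of \<open>R\<close> of the Riemann sums of \<open>g\<close>
  over the cosets of \<open>p\<^sup>n L\<close> in \<open>L = padic_lattice w\<close>, for arbitrary sample points \<open>c\<close>.
\<close>

definition has_padic_integral ::
  "('n :: finite \<Rightarrow> 'f :: field_char_0) \<Rightarrow> 'p :: prime_type padic alg_closure set
     \<Rightarrow> (('f, 'p padic) rat_tensor set \<Rightarrow> 'p padic alg_closure)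
     \<Rightarrow> (('f, 'p padic) rat_tensor \<Rightarrow> 'p padic alg_closure) \<Rightarrow> 'p padic alg_closure \<Rightarrow> bool" where
  "has_padic_integral w R \<mu> g I \<longleftrightarrow>
     (\<forall>j. \<exists>n\<^sub>0. \<forall>n\<ge>n\<^sub>0. \<forall>c. (\<forall>C \<in> lattice_coset w n ` padic_lattice w. c C \<in> C) \<longrightarrow>
        (\<exists>s\<in>R. (\<Sum>C \<in> lattice_coset w n ` padic_lattice w. g (c C) * \<mu> C) - I
           = of_nat CARD('p) ^ j * s))"

text \<open>
  A power series in \<open>K[[t\<^sub>1 - 1, \<dots>, t\<^sub>k - 1]]\<close> is represented by its coefficient function on
  multi-indices \<open>m :: 'n \<Rightarrow> nat\<close>. For univariate \<open>g\<^sub>i \<in> K[[X]]\<close>, \<open>sep_prod g\<close> is the product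
  of the series \<open>g\<^sub>i(t\<^sub>i - 1)\<close>; as these are in distinct variables, its coefficients are the
  products of the coefficients of the \<open>g\<^sub>i\<close>.
\<close>

definition sep_prod :: "('n :: finite \<Rightarrow> 'a :: comm_ring_1 fps) \<Rightarrow> ('n \<Rightarrow> nat) \<Rightarrow> 'a" where
  "sep_prod g m = (\<Prod>i\<in>UNIV. fps_nth (g i) (m i))"

text \<open>\<open>t\<^sub>i ^ \<alpha>'\<^sub>i\<close> as a series in \<open>t\<^sub>i - 1\<close>: the binomial series \<open>(1 + X) ^ \<alpha>'\<^sub>i\<close>.\<close>

definition t_power ::
  "('n :: finite \<Rightarrow> 'f :: field_char_0) \<Rightarrow> ('f, 'p :: prime_type padic) rat_tensor
     \<Rightarrow> 'n \<Rightarrow> 'p padic alg_closure fps" where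
  "t_power w \<alpha> i = fps_binomial (to_ac (padic_coords w \<alpha> i))"

text \<open>The integral of the power series valued function \<open>t\<^sup>\<alpha>\<close> is taken coefficientwise.\<close>

definition has_amice_transform ::
  "('n :: finite \<Rightarrow> 'f :: field_char_0) \<Rightarrow> 'p :: prime_type padic alg_closure set
     \<Rightarrow> (('f, 'p padic) rat_tensor set \<Rightarrow> 'p padic alg_closure)
     \<Rightarrow> (('n \<Rightarrow> nat) \<Rightarrow> 'p padic alg_closure) \<Rightarrow> bool" where
  "has_amice_transform w R \<mu> f \<longleftrightarrow>
     (\<forall>m. has_padic_integral w R \<mu> (\<lambda>\<alpha>. sep_prod (t_power w \<alpha>) m) (f m))"

definition measure_of_series ::
  "('n :: finite \<Rightarrow> 'f :: field_char_0) \<Rightarrow> 'p :: prime_type padic alg_closure set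
     \<Rightarrow> (('n \<Rightarrow> nat) \<Rightarrow> 'p padic alg_closure)
     \<Rightarrow> ('f, 'p padic) rat_tensor set \<Rightarrow> 'p padic alg_closure" where
  "measure_of_series w R f = (THE \<mu>. is_padic_measure w R \<mu> \<and> has_amice_transform w R \<mu> f)"

text \<open>
  Here \<open>\<iota>\<close> is the embedding of \<open>Qbar\<close>. The variables \<open>t\<^sub>i\<close> are those attached to
  \<open>p\<^sup>-\<^sup>r v\<^sub>i\<close>, whence \<open>t\<close> to the power \<open>v\<^sub>i\<close> is \<open>t\<^sub>i\<close> to the power \<open>p\<^sup>r\<close>, a series in \<open>t\<^sub>i - 1\<close> alone.
\<close>

definition f_series ::
  "(complex \<Rightarrow> 'p :: prime_type padic alg_closure) \<Rightarrow> nat \<Rightarrow> ('n :: finite \<Rightarrow> 'f :: field_char_0)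
     \<Rightarrow> 'f \<Rightarrow> 'f set \<Rightarrow> ('n \<Rightarrow> nat) \<Rightarrow> 'p padic alg_closure" where
  "f_series \<iota> r v x I m =
     (\<Sum>\<xi> \<in> quot_characters I - {trivial_character I}.
        \<iota> (\<xi> (residue_mod I x)) *
        sep_prod (\<lambda>i. t_power (dagger_basis TYPE('p) r v) (tensor x 1 :: ('f, 'p padic) rat_tensor) i *
                      inverse (1 - fps_const (\<iota> (\<xi> (residue_mod I (v i))))
                                   * fps_binomial (of_nat (CARD('p) ^ r)))) m)"

definition \<mu>_measure ::
  "(complex \<Rightarrow> 'p :: prime_type padic alg_closure) \<Rightarrow> 'p padic alg_closure set \<Rightarrow> nat
     \<Rightarrow> ('n :: finite \<Rightarrow> 'f :: field_char_0) \<Rightarrow> 'f \<Rightarrow> 'f set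
     \<Rightarrow> ('f, 'p padic) rat_tensor set \<Rightarrow> 'p padic alg_closure" where
  "\<mu>_measure \<iota> R r v x I = measure_of_series (dagger_basis TYPE('p) r v) R (f_series \<iota> r v x I)"

end

theory Submission
  imports Defs "Jordan_Normal_Form.Char_Poly" "HOL-Number_Theory.Cong"
begin

text \<open>
  For a nontrivial character \<open>\<xi>\<close> the series \<open>t\<^sup>x / (\<Prod>i. 1 - \<xi>(v\<^sub>i) t ^ v\<^sub>i)\<close> is a product of series in one
  variable each. With \<open>Y = \<zeta> t ^ p ^ r\<close> and \<open>P = p ^ n\<close>, the identity
  \<open>1 / (1 - Y) = (\<Sum>l < P. Y ^ l) / (1 - Y ^ P)\<close> shows that the measure of \<open>1 / (1 - Y)\<close> gives the coset of \<open>l\<close>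
  modulo \<open>P\<close> the mass \<open>\<zeta> ^ l / (1 - \<zeta> ^ P)\<close>: indeed \<open>t ^ p ^ m\<close> tends to \<open>1\<close> coefficientwise, so these masses have the
  right transform, and a measure is determined by its transform because modulo \<open>p\<^sup>j\<close> the indicator function of
  a coset is a finite integral combination of binomial coefficients (Mahler). Replacing \<open>\<xi>\<close> by
  \<open>\<xi>(\<cdot> / p ^ n)\<close>, the coset of \<open>x + l \<cdot> v\<close> has measure \<open>\<Sum>\<xi>. \<xi>(y) / (\<Prod>i. 1 - \<xi>(v\<^sub>i))\<close> with \<open>y = (x + l \<cdot> v) / p ^ n\<close>.
  Finally \<open>1 / (1 - z) = - (\<Sum>d < N. d z ^ d) / N\<close> for an \<open>N\<close>-th root of unity \<open>z \<noteq> 1\<close>, and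
  orthogonality of characters produces \<open>H_sum\<close>; the trivial character accounts for \<open>((N - 1) / 2)\<^sup>k\<close>.
\<close>

hide_const (open) Ring_Hom.ring_hom

section \<open>Arithmetic of \<open>\<int>\<^sub>p\<close>\<close>

text \<open>The measure is given by a definite description, so existence and uniqueness are both
  proved, and both work with congruences modulo p^j R. Equality is recovered because no nonzero
  element of R is divisible by every power of p; instead of setting up a valuation on the algebraic
  closure, this is deduced from 1/p not being integral over Z_p. That N is prime to p enters twice:
  it makes N a unit of Z_p, so that the inverses of 1 - zeta^(p^e) lie in R, and it allows division
  by p^n modulo N. That each v_i is prime to the ideal keeps zeta^(p^e) different from 1. As the
  quotient is Z/N, x and the v_i are congruent to rational integers a and u_i, and all characters
  become powers of one root of unity omega; from there on the computation concerns integers modulo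
  N. The series is written in the variables of the finer basis p^(-r) v_i. Hence the lattice of V
  sits r levels down: additivity of the explicit masses is established from level r on, and level n
  for V is level n + r in the computation.\<close>

lemma prime_type_gt_1: "1 < CARD('p :: prime_type)"
  using prime_gt_1_nat[OF prime_CARD] .

lemma prime_type_card_pos [simp]: "0 < CARD('p :: prime_type)"
  using prime_type_gt_1[where 'p = 'p] by simp

lemma prime_type_card_neq_0 [simp]: "CARD('p :: prime_type) \<noteq> 0"
  using prime_type_gt_1[where 'p = 'p] by simp

lemma prime_type_prime_int: "prime (int CARD('p :: prime_type))"
  using prime_CARD by simp

lemma Rep_padic_int_coherent:
  "m \<le> n \<Longrightarrow> Rep_padic_int a m = Rep_padic_int (a :: 'p :: prime_type padic_int) n mod int CARD('p) ^ m"
  using padic_int_mod_le[of "Rep_padic_int a" "int CARD('p)" m "n - m"] Rep_padic_int[of a]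
  by (metis (mono_tags, lifting) le_add_diff_inverse mem_Collect_eq)

lemma Rep_padic_int_mod [simp]:
  "Rep_padic_int (a :: 'p :: prime_type padic_int) n mod int CARD('p) ^ n = Rep_padic_int a n"
  using Rep_padic_int_coherent[of n n a] by simp

lemma Rep_padic_int_range:
  "0 \<le> Rep_padic_int (a :: 'p :: prime_type padic_int) n" "Rep_padic_int a n < int CARD('p) ^ n"
proof -
  have "int CARD('p) ^ n > 0" using prime_type_gt_1[where 'p = 'p] by simp
  thus "0 \<le> Rep_padic_int a n" "Rep_padic_int a n < int CARD('p) ^ n"
    using Rep_padic_int_mod[of a n] pos_mod_bound pos_mod_sign by metis+
qed

lemma of_nat_power_padic_int_Rep:
  "Rep_padic_int (of_nat CARD('p) ^ n * a :: 'p :: prime_type padic_int) m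
     = int CARD('p) ^ n * Rep_padic_int a m mod int CARD('p) ^ m"
proof -
  have "of_nat CARD('p) ^ n = (of_nat (CARD('p) ^ n) :: 'p padic_int)" by simp
  thus ?thesis by (simp only: times_padic_int.rep_eq of_nat_padic_int) (simp add: mod_simps)
qed

lemma mod_power_add_div: "0 < q \<Longrightarrow> a mod q ^ (n + k) div q ^ n = a div q ^ n mod q ^ k" for a q :: int
  by (simp add: power_add zmod_zmult2_eq)

text \<open>If the n-th residue vanishes, every later residue is divisible by p^n; the sequence of
  quotients, shifted by n indices, is again coherent.\<close>

lemma padic_power_dvd_iff:
  "of_nat CARD('p) ^ n dvd (a :: 'p :: prime_type padic_int) \<longleftrightarrow> Rep_padic_int a n = 0"
proof
  assume "of_nat CARD('p) ^ n dvd a"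
  then obtain b where "a = of_nat CARD('p) ^ n * b" by (auto simp: dvd_def)
  thus "Rep_padic_int a n = 0" by (simp add: of_nat_power_padic_int_Rep)
next
  assume a0: "Rep_padic_int a n = 0"
  let ?q = "int CARD('p)"
  have q: "?q \<noteq> 0" "?q > 0" using prime_type_gt_1[where 'p = 'p] by auto
  define b where "b k = Rep_padic_int a (n + k) div ?q ^ n" for k
  have "b k = b (Suc k) mod ?q ^ k" for k
  proof -
    have "b k = Rep_padic_int a (n + Suc k) mod ?q ^ (n + k) div ?q ^ n"
      unfolding b_def by (subst Rep_padic_int_coherent[of "n + k" "n + Suc k"]) auto
    also have "\<dots> = b (Suc k) mod ?q ^ k"
      unfolding b_def using q(2) by (rule mod_power_add_div)
    finally show ?thesis .
  qed
  then obtain b' :: "'p padic_int" where b': "Rep_padic_int b' = b"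
    using Abs_padic_int_inverse[of b] by blast
  have "Rep_padic_int (of_nat CARD('p) ^ n * b') m = Rep_padic_int a m" for m
  proof -
    have "?q ^ n dvd Rep_padic_int a (n + m)"
      using Rep_padic_int_coherent[of n "n + m" a] a0 by (auto simp: dvd_eq_mod_eq_0)
    hence "?q ^ n * b m = Rep_padic_int a (n + m)" by (simp add: b_def)
    thus ?thesis using Rep_padic_int_coherent[of m "n + m" a]
      by (simp add: of_nat_power_padic_int_Rep b')
  qed
  hence "a = of_nat CARD('p) ^ n * b'" by (metis Rep_padic_int_inject ext)
  thus "of_nat CARD('p) ^ n dvd a" by simp
qed

lemma padic_power_dvd_diff_iff:
  "of_nat CARD('p) ^ n dvd (a - b :: 'p :: prime_type padic_int) \<longleftrightarrow> Rep_padic_int a n = Rep_padic_int b n"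
proof -
  have "(Rep_padic_int a n - Rep_padic_int b n) mod int CARD('p) ^ n = 0
      \<longleftrightarrow> Rep_padic_int a n mod int CARD('p) ^ n = Rep_padic_int b n mod int CARD('p) ^ n"
    by (simp only: mod_eq_dvd_iff dvd_eq_mod_eq_0)
  thus ?thesis by (simp add: padic_power_dvd_iff minus_padic_int.rep_eq)
qed

lemma padic_power_dvd_int_iff:
  "of_nat CARD('p) ^ n dvd (of_int k :: 'p :: prime_type padic_int) \<longleftrightarrow> int CARD('p) ^ n dvd k"
proof -
  have int: "Rep_padic_int (of_int k :: 'p padic_int) n = k mod int CARD('p) ^ n"
    by (cases k rule: int_diff_cases)
       (simp add: minus_padic_int.rep_eq of_nat_padic_int mod_simps)
  show ?thesis by (simp add: padic_power_dvd_iff int dvd_eq_mod_eq_0)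
qed

lemma padic_int_approx_nat:
  obtains k where "k < CARD('p) ^ n" "of_nat CARD('p) ^ n dvd (a - of_nat k :: 'p :: prime_type padic_int)"
proof
  have *: "int (nat (Rep_padic_int a n)) = Rep_padic_int a n"
    using Rep_padic_int_range[of a n] by simp
  show "nat (Rep_padic_int a n) < CARD('p) ^ n"
    using Rep_padic_int_range[of a n] by (metis * of_nat_less_iff of_nat_power)
  show "of_nat CARD('p) ^ n dvd (a - of_nat (nat (Rep_padic_int a n)))"
    by (simp only: padic_power_dvd_diff_iff of_nat_padic_int * Rep_padic_int_mod)
qed

lemma padic_int_eq_0I: "(\<And>n. of_nat CARD('p) ^ n dvd a) \<Longrightarrow> a = 0" for a :: "'p :: prime_type padic_int"
  by (metis padic_power_dvd_iff Rep_padic_int_inject ext zero_padic_int.rep_eq)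

text \<open>Every residue is invertible modulo its power of p. The inverse in [0, p^n) is unique, so
  the chosen inverses are automatically coherent.\<close>

lemma not_prime_dvd_padic_unit:
  fixes a :: "'p :: prime_type padic_int"
  assumes "\<not> of_nat CARD('p) dvd a"
  shows "a dvd 1"
proof -
  let ?q = "int CARD('p)"
  have q: "?q > 1" using prime_type_gt_1[where 'p = 'p] by simp
  have a1: "Rep_padic_int a 1 \<noteq> 0" using padic_power_dvd_iff[of 1 a] assms by simp
  have cop: "coprime (Rep_padic_int a n) (?q ^ n)" for n
  proof (cases "n = 0")
    case False
    have "\<not> ?q dvd Rep_padic_int a n"
      using Rep_padic_int_coherent[of 1 n a] a1 False by (auto simp: dvd_eq_mod_eq_0)
    hence "coprime ?q (Rep_padic_int a n)"
      by (intro prime_imp_coprime prime_type_prime_int)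
    thus ?thesis by (simp add: coprime_commute)
  qed simp
  have ex: "\<exists>b. b \<in> {0..<?q ^ n} \<and> (Rep_padic_int a n * b) mod ?q ^ n = 1 mod ?q ^ n" for n
  proof -
    obtain c d where "Rep_padic_int a n * c + ?q ^ n * d = 1"
      using cop[of n] bezout_int[of "Rep_padic_int a n" "?q ^ n"]
      by (metis coprime_iff_gcd_eq_1 mult.commute)
    hence "Rep_padic_int a n * c mod ?q ^ n = 1 mod ?q ^ n"
      by (metis mod_mult_self2)
    thus ?thesis using q by (intro exI[of _ "c mod ?q ^ n"]) (auto simp: mod_simps)
  qed
  have uniq: "b = c" if "b \<in> {0..<?q ^ n}" "c \<in> {0..<?q ^ n}"
    "(Rep_padic_int a n * b) mod ?q ^ n = (Rep_padic_int a n * c) mod ?q ^ n" for b c n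
  proof -
    have "?q ^ n dvd Rep_padic_int a n * (b - c)"
      using that(3) by (simp add: mod_eq_dvd_iff algebra_simps)
    hence "?q ^ n dvd b - c"
      using cop[of n] by (simp add: coprime_commute coprime_dvd_mult_right_iff)
    hence "b mod ?q ^ n = c mod ?q ^ n" by (simp add: mod_eq_dvd_iff)
    thus ?thesis using that by simp
  qed
  obtain b where b: "\<And>n. b n \<in> {0..<?q ^ n}" "\<And>n. (Rep_padic_int a n * b n) mod ?q ^ n = 1 mod ?q ^ n"
    using ex by metis
  have "b n = b (Suc n) mod ?q ^ n" for n
  proof (rule uniq)
    show "b n \<in> {0..<?q ^ n}" "b (Suc n) mod ?q ^ n \<in> {0..<?q ^ n}" using b q by auto
    have "Rep_padic_int a n * (b (Suc n) mod ?q ^ n) mod ?q ^ n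
        = (Rep_padic_int a (Suc n) * b (Suc n)) mod ?q ^ Suc n mod ?q ^ n"
      by (subst Rep_padic_int_coherent[of n "Suc n" a]) (simp_all only: mod_power_Suc_mod mod_simps le_SucI le_refl)
    also have "\<dots> = 1 mod ?q ^ n" by (simp only: b mod_power_Suc_mod)
    finally show "Rep_padic_int a n * b n mod ?q ^ n = Rep_padic_int a n * (b (Suc n) mod ?q ^ n) mod ?q ^ n"
      by (simp add: b)
  qed
  then obtain b' :: "'p padic_int" where b': "Rep_padic_int b' = b"
    using Abs_padic_int_inverse[of b] by blast
  have "a * b' = 1"
    by (simp add: Rep_padic_int_inject[symmetric] fun_eq_iff times_padic_int.rep_eq one_padic_int.rep_eq b' b)
  thus ?thesis by (metis dvd_triv_left)
qed

text \<open>A nonzero p-adic integer is a power of p times a unit. In this form, division by a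
  nonzero element such as m! or a constant coefficient is traded for division by a power of
  p.\<close>

lemma padic_int_dvd_prime_power:
  fixes a :: "'p :: prime_type padic_int"
  assumes "a \<noteq> 0"
  obtains e where "a dvd of_nat CARD('p) ^ e"
proof -
  obtain n where n: "\<not> of_nat CARD('p) ^ n dvd a" using padic_int_eq_0I assms by blast
  define m where "m = (LEAST n. \<not> of_nat CARD('p) ^ n dvd a)"
  have m: "\<not> of_nat CARD('p) ^ m dvd a" unfolding m_def using n by (rule LeastI)
  then obtain e where e: "m = Suc e" by (cases m) auto
  have "of_nat CARD('p) ^ e dvd a" using not_less_Least[of e "\<lambda>n. \<not> of_nat CARD('p) ^ n dvd a"] e
    unfolding m_def by auto
  then obtain b where b: "a = of_nat CARD('p) ^ e * b" by (auto simp: dvd_def)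
  have "\<not> of_nat CARD('p) dvd b"
    using m by (auto simp: b e dvd_def algebra_simps)
  hence "b dvd 1" by (rule not_prime_dvd_padic_unit)
  hence "of_nat CARD('p) ^ e * b dvd of_nat CARD('p) ^ e * 1" by (intro mult_dvd_mono) simp_all
  hence "a dvd of_nat CARD('p) ^ e" by (simp only: b mult_1_right)
  thus ?thesis by (rule that)
qed

section \<open>Integral elements over \<open>\<int>\<^sub>p\<close>\<close>

abbreviation emb :: "'p :: prime_type padic_int \<Rightarrow> 'p padic alg_closure" where
  "emb a \<equiv> to_ac (to_fract a)"

interpretation emb: inj_comm_ring_hom "emb :: 'p :: prime_type padic_int \<Rightarrow> 'p padic alg_closure"
  by unfold_locales auto

interpretation emb_poly: map_poly_inj_comm_ring_hom "emb :: 'p :: prime_type padic_int \<Rightarrow> 'p padic alg_closure" ..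

interpretation zp: Modules.module "\<lambda>(a :: 'p :: prime_type padic_int) z. emb a * z"
  by unfold_locales (auto simp: algebra_simps)

definition integral_over_Zp :: "'p :: prime_type padic alg_closure \<Rightarrow> bool" where
  "integral_over_Zp z \<longleftrightarrow> (\<exists>q. lead_coeff q = 1 \<and> poly (map_poly emb q) z = 0)"

lemma integral_over_Zp_emb: "integral_over_Zp (emb a)"
  unfolding integral_over_Zp_def by (rule exI[of _ "[:-a, 1:]"]) (simp add: map_poly_pCons)

lemma integral_over_Zp_power_eq_1:
  assumes "z ^ n = 1" "n > 0"
  shows "integral_over_Zp (z :: 'p :: prime_type padic alg_closure)"
  unfolding integral_over_Zp_def
proof (intro exI conjI)
  let ?q = "monom 1 n + [:-1:] :: 'p padic_int poly"
  have deg: "degree ?q = n"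
    using assms(2) by (subst degree_add_eq_left) (simp_all add: degree_monom_eq)
  show "lead_coeff ?q = 1"
    unfolding deg using assms(2) by (cases n) auto
  have "map_poly emb ?q = monom 1 n + [:-1:]"
    by (simp only: emb_poly.hom_add map_poly_monom map_poly_pCons)
       simp
  thus "poly (map_poly emb ?q) z = 0"
    by (simp add: poly_monom assms)
qed

text \<open>
  The determinant trick: \<open>z\<close> is an eigenvalue of the matrix of the multiplication by \<open>z\<close> on a
  finite generating set.
\<close>

lemma integral_over_Zp_if_stable:
  assumes B: "finite B" "b \<in> B" "b \<noteq> 0" and stable: "\<And>b. b \<in> B \<Longrightarrow> z * b \<in> zp.span B"
  shows "integral_over_Zp z"
proof -
  obtain bs where bs: "set bs = B" "distinct bs" using finite_distinct_list[OF B(1)] by blast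
  define n where "n = length bs"
  have "\<exists>u. z * b = (\<Sum>c\<in>B. emb (u c) * c)" if "b \<in> B" for b
    using stable[OF that] unfolding zp.span_finite[OF B(1)] by blast
  then obtain u where u: "\<forall>b\<in>B. z * b = (\<Sum>c\<in>B. emb (u b c) * c)"
    using bchoice[of B "\<lambda>b u. z * b = (\<Sum>c\<in>B. emb (u c) * c)"] by blast
  define A where "A = Matrix.mat n n (\<lambda>(i, j). u (bs ! i) (bs ! j))"
  define x where "x = Matrix.vec n (\<lambda>i. bs ! i)"
  have A: "A \<in> carrier_mat n n" by (simp add: A_def)
  obtain i where i: "i < n" "bs ! i = b" using B bs by (metis in_set_conv_nth n_def)
  have "eigenvector (map_mat emb A) x z"
    unfolding eigenvector_def
  proof (intro conjI)
    have "x $ i \<noteq> 0" using i B by (simp add: x_def)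
    thus "x \<noteq> 0\<^sub>v (dim_row (map_mat emb A))" using i A by auto
    show "map_mat emb A *\<^sub>v x = z \<cdot>\<^sub>v x"
    proof (rule eq_vecI)
      fix j assume "j < dim_vec (z \<cdot>\<^sub>v x)"
      hence j: "j < n" by (simp add: x_def)
      have "(map_mat emb A *\<^sub>v x) $ j = (\<Sum>k<n. emb (u (bs ! j) (bs ! k)) * (bs ! k))"
        using j by (auto simp: scalar_prod_def A_def x_def lessThan_atLeast0 intro!: sum.cong)
      also have "\<dots> = (\<Sum>c\<in>B. emb (u (bs ! j) c) * c)"
        using bs unfolding n_def
        by (intro sum.reindex_bij_betw bij_betw_nth) auto
      also have "\<dots> = z * (bs ! j)" using u j bs by (auto simp: n_def)
      finally show "(map_mat emb A *\<^sub>v x) $ j = (z \<cdot>\<^sub>v x) $ j" using j by (simp add: x_def)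
    qed (simp add: A_def x_def)
  qed (simp add: A_def x_def)
  hence "poly (char_poly (map_mat emb A)) z = 0"
    using eigenvalue_root_char_poly[of "map_mat emb A" n z] A by (auto simp: eigenvalue_def)
  thus ?thesis
    unfolding integral_over_Zp_def emb.char_poly_hom[OF A]
    using degree_monic_char_poly[OF A] by (intro exI[of _ "char_poly A"]) auto
qed

text \<open>The generators are the monomials x^i y^j with exponents below the degrees of monic
  equations of x and y; a product that leaves this range is reduced by these equations. The element
  1 is the nonzero generator that the determinant trick asks for.\<close>

lemma integral_over_Zp_common_module:
  assumes "integral_over_Zp x" "integral_over_Zp y"
  obtains B where "finite B" "1 \<in> B"
    "\<And>b. b \<in> zp.span B \<Longrightarrow> x * b \<in> zp.span B" "\<And>b. b \<in> zp.span B \<Longrightarrow> y * b \<in> zp.span B"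
proof -
  have rel: "\<exists>d c. d > 0 \<and> w ^ d = (\<Sum>i<d. emb (c i) * w ^ i)" if w: "integral_over_Zp w"
    for w :: "'a padic alg_closure"
  proof -
    from w obtain q where q: "lead_coeff q = 1" "poly (map_poly emb q) w = 0"
      unfolding integral_over_Zp_def by blast
    have "0 = (\<Sum>i\<le>degree q. emb (coeff q i) * w ^ i)"
      using q(2) by (simp add: poly_altdef)
    also have "\<dots> = (\<Sum>i<degree q. emb (coeff q i) * w ^ i) + w ^ degree q"
      using q(1) by (simp add: lessThan_Suc_atMost[symmetric])
    finally have "w ^ degree q = (\<Sum>i<degree q. emb (- coeff q i) * w ^ i)"
      by (simp add: sum_negf eq_neg_iff_add_eq_0 add.commute)
    moreover have "degree q > 0"
    proof (rule ccontr)
      assume "\<not> degree q > 0"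
      hence "q = 1" using q(1) by (metis degree_0_id gr0I one_pCons)
      thus False using q(2) by simp
    qed
    ultimately show ?thesis
      by (intro exI[of _ "degree q"] exI[of _ "\<lambda>i. - coeff q i"] conjI) auto
  qed
  obtain d c where d: "d > 0" "x ^ d = (\<Sum>i<d. emb (c i) * x ^ i)" using rel[OF assms(1)] by blast
  obtain e c' where e: "e > 0" "y ^ e = (\<Sum>i<e. emb (c' i) * y ^ i)" using rel[OF assms(2)] by blast
  define B where "B = (\<lambda>(i, j). x ^ i * y ^ j) ` ({..<d} \<times> {..<e})"
  have B: "x ^ i * y ^ j \<in> zp.span B" if "i < d" "j < e" for i j
    using that by (intro zp.span_base) (auto simp: B_def)
  have "x * (x ^ i * y ^ j) \<in> zp.span B" if ij: "i < d" "j < e" for i j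
  proof (cases "Suc i < d")
    case True
    thus ?thesis using B[of "Suc i" j] ij by (simp add: mult.assoc)
  next
    case False
    hence "x * (x ^ i * y ^ j) = x ^ d * y ^ j" using ij by (metis Suc_lessI mult.assoc power_Suc)
    also have "\<dots> = (\<Sum>i<d. emb (c i) * (x ^ i * y ^ j))"
      unfolding d(2) by (simp add: sum_distrib_right mult.assoc)
    also have "\<dots> \<in> zp.span B" using ij B by (intro zp.span_sum zp.span_scale) auto
    finally show ?thesis .
  qed
  hence x: "x * b \<in> zp.span B" if "b \<in> B" for b using that by (auto simp: B_def)
  have "y * (x ^ i * y ^ j) \<in> zp.span B" if ij: "i < d" "j < e" for i j
  proof (cases "Suc j < e")
    case True
    thus ?thesis using B[of i "Suc j"] ij by (simp add: mult_ac)
  next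
    case False
    hence "Suc j = e" using ij by simp
    hence "y * (x ^ i * y ^ j) = x ^ i * y ^ e" by (simp flip: \<open>Suc j = e\<close>)
    also have "\<dots> = (\<Sum>j<e. emb (c' j) * (x ^ i * y ^ j))"
      unfolding e(2) by (simp add: sum_distrib_left mult_ac)
    also have "\<dots> \<in> zp.span B" using ij B by (intro zp.span_sum zp.span_scale) auto
    finally show ?thesis .
  qed
  hence y: "y * b \<in> zp.span B" if "b \<in> B" for b using that by (auto simp: B_def)
  have stable: "w * b \<in> zp.span B" if "\<And>b. b \<in> B \<Longrightarrow> w * b \<in> zp.span B" "b \<in> zp.span B"
    for w b :: "'a padic alg_closure"
    using that(2)
  proof (induction rule: zp.span_induct_alt)
    case (step c b' b'')
    have "w * (emb c * b' + b'') = emb c * (w * b') + w * b''" by (simp add: algebra_simps)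
    thus ?case using step that(1) by (metis zp.span_add zp.span_scale)
  qed (use zp.span_zero in simp)
  show ?thesis
  proof (rule that)
    show "finite B" by (simp add: B_def)
    show "1 \<in> B" using d(1) e(1) unfolding B_def by (intro image_eqI[of _ _ "(0, 0)"]) auto
  qed (use stable x y in blast)+
qed

lemma integral_over_Zp_add: "integral_over_Zp x \<Longrightarrow> integral_over_Zp y \<Longrightarrow> integral_over_Zp (x + y)"
  and integral_over_Zp_mult: "integral_over_Zp x \<Longrightarrow> integral_over_Zp y \<Longrightarrow> integral_over_Zp (x * y)"
proof -
  assume xy: "integral_over_Zp x" "integral_over_Zp y"
  then obtain B where B: "finite B" "1 \<in> B"
    "\<And>b. b \<in> zp.span B \<Longrightarrow> x * b \<in> zp.span B" "\<And>b. b \<in> zp.span B \<Longrightarrow> y * b \<in> zp.span B"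
    by (rule integral_over_Zp_common_module) blast
  show "integral_over_Zp (x + y)"
  proof (rule integral_over_Zp_if_stable[OF B(1,2)])
    fix b assume "b \<in> B"
    hence "x * b + y * b \<in> zp.span B" by (intro zp.span_add B(3,4) zp.span_base)
    thus "(x + y) * b \<in> zp.span B" by (simp only: distrib_right)
  qed simp
  show "integral_over_Zp (x * y)"
  proof (rule integral_over_Zp_if_stable[OF B(1,2)])
    fix b assume "b \<in> B"
    thus "x * y * b \<in> zp.span B" unfolding mult.assoc by (intro B(3,4) zp.span_base)
  qed simp
qed

lemma integral_over_Zp_poly: "integral_over_Zp z \<Longrightarrow> integral_over_Zp (poly (map_poly emb q) z)"
proof (induction q)
  case 0
  show ?case using integral_over_Zp_emb[of 0] by simp
next
  case (pCons a q)
  thus ?case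
    by (auto simp: map_poly_pCons intro!: integral_over_Zp_add integral_over_Zp_mult integral_over_Zp_emb)
qed

text \<open>The rational root argument: multiplied by p^d, a monic equation of degree d for 1/p has
  leading term 1, and every other term is divisible by p.\<close>

lemma not_integral_over_Zp_inverse_prime:
  "\<not> integral_over_Zp (1 / of_nat CARD('p) :: 'p :: prime_type padic alg_closure)"
proof
  let ?p = "of_nat CARD('p) :: 'p padic_int" and ?z = "1 / of_nat CARD('p) :: 'p padic alg_closure"
  have emb_p: "of_nat CARD('p) = emb ?p" by (simp only: emb.hom_of_nat)
  have p0: "of_nat CARD('p) \<noteq> (0 :: 'p padic alg_closure)" by (simp del: to_ac_of_nat)
  assume "integral_over_Zp ?z"
  then obtain q where q: "lead_coeff q = 1" "poly (map_poly emb q) ?z = 0"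
    unfolding integral_over_Zp_def by blast
  define d where "d = degree q"
  have "0 = of_nat CARD('p) ^ d * (\<Sum>i\<le>d. emb (coeff q i) * ?z ^ i)"
    using q(2) by (simp add: poly_altdef d_def)
  also have "\<dots> = (\<Sum>i\<le>d. emb (coeff q i * ?p ^ (d - i)))"
    unfolding sum_distrib_left
  proof (intro sum.cong refl)
    fix i assume "i \<in> {..d}"
    hence "of_nat CARD('p) ^ d = (of_nat CARD('p) ^ (d - i) * of_nat CARD('p) ^ i :: 'p padic alg_closure)"
      by (simp flip: power_add)
    moreover have "a * of_nat CARD('p) ^ i * (b * ?z ^ i) = b * a" for a b :: "'p padic alg_closure"
      using p0 by (simp add: power_divide)
    ultimately show "of_nat CARD('p) ^ d * (emb (coeff q i) * ?z ^ i) = emb (coeff q i * ?p ^ (d - i))"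
      by (simp only: emb.hom_mult emb.hom_power emb_p[symmetric])
  qed
  also have "\<dots> = emb (\<Sum>i\<le>d. coeff q i * ?p ^ (d - i))" by (simp only: emb.hom_sum)
  finally have "0 = (\<Sum>i\<le>d. coeff q i * ?p ^ (d - i))" by (metis emb.hom_0_iff)
  also have "\<dots> = (\<Sum>i<d. coeff q i * ?p ^ (d - i)) + 1"
    using q(1) by (simp add: lessThan_Suc_atMost[symmetric] d_def)
  finally have "1 = - (\<Sum>i<d. coeff q i * ?p ^ (d - i))" by (simp add: eq_neg_iff_add_eq_0 add.commute)
  moreover have "?p dvd (\<Sum>i<d. coeff q i * ?p ^ (d - i))"
    by (intro dvd_sum dvd_mult dvd_power) auto
  ultimately have "?p ^ 1 dvd 1" by (metis dvd_minus_iff power_one_right)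
  thus False using prime_type_gt_1[where 'p = 'p]
    by (simp only: padic_power_dvd_iff one_padic_int.rep_eq) simp
qed

text \<open>Stands in for a valuation. Let a be the constant coefficient of a nonzero polynomial
  over Z_p of least degree with root z, and let a b = p^e. Then a = z w with w integral, and z =
  p^(e+1) s with s integral would make 1/p = s w b integral.\<close>

lemma integral_over_Zp_separated:
  fixes z :: "'p :: prime_type padic alg_closure"
  assumes "\<And>j. \<exists>s. integral_over_Zp s \<and> z = of_nat CARD('p) ^ j * s"
  shows "z = 0"
proof (rule ccontr)
  let ?p = "of_nat CARD('p) :: 'p padic alg_closure"
  have p0: "?p \<noteq> 0" by simp
  assume z: "z \<noteq> 0"
  have int: "integral_over_Zp z" using assms[of 0] by simp
  define P where "P q \<longleftrightarrow> q \<noteq> 0 \<and> poly (map_poly emb q) z = 0" for q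
  obtain q0 where q0: "lead_coeff q0 = 1" "poly (map_poly emb q0) z = 0"
    using int unfolding integral_over_Zp_def by blast
  hence "P q0" unfolding P_def by (metis leading_coeff_0_iff zero_neq_one)
  then obtain q where q: "P q" "\<And>q'. P q' \<Longrightarrow> degree q \<le> degree q'"
    using ex_has_least_nat[of P q0 degree] by blast
  obtain a q' where aq: "q = pCons a q'" by (cases q)
  \<comment> \<open>Otherwise, z being nonzero, a factor X could be cancelled and the degree would
    drop.\<close>
  have "a \<noteq> 0"
  proof
    assume "a = 0"
    hence "P q'" using q(1) z by (auto simp: P_def aq map_poly_pCons)
    moreover have "degree q' < degree q" using \<open>a = 0\<close> q(1) by (auto simp: P_def aq)
    ultimately show False using q(2) by fastforce
  qed
  then obtain e b where e: "of_nat CARD('p) ^ e = a * b" by (metis padic_int_dvd_prime_power dvd_def)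
  define w where "w = - poly (map_poly emb q') z"
  have a: "emb a = z * w" using q(1) \<open>a \<noteq> 0\<close>
    by (simp add: P_def aq w_def map_poly_pCons eq_neg_iff_add_eq_0)
  obtain s where s: "integral_over_Zp s" "z = ?p ^ Suc e * s" using assms by blast
  have "?p ^ e = emb (of_nat CARD('p) ^ e)" by (simp only: emb.hom_of_nat emb.hom_power)
  also have "\<dots> = emb a * emb b" by (simp only: e emb.hom_mult)
  also have "\<dots> = ?p ^ e * (?p * (s * w * emb b))" by (simp add: a s(2))
  finally have "1 / ?p = s * w * emb b" using p0 by (simp add: field_simps)
  moreover have "w = emb (-1) * poly (map_poly emb q') z" by (simp add: w_def)
  ultimately have "integral_over_Zp (1 / ?p)"
    using int s(1) by (simp only:) (intro integral_over_Zp_mult integral_over_Zp_emb integral_over_Zp_poly)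
  thus False using not_integral_over_Zp_inverse_prime by blast
qed

lemma padic_integers_of_eq: "padic_integers_of K = {z \<in> K. integral_over_Zp z}"
  by (simp add: padic_integers_of_def integral_over_Zp_def)

section \<open>Binomial coefficients on \<open>\<int>\<^sub>p\<close>\<close>

lemma dvd_diff_mult:
  "d dvd a - a' \<Longrightarrow> d dvd b - b' \<Longrightarrow> d dvd a * b - a' * (b' :: 'a :: comm_ring_1)"
proof -
  assume "d dvd a - a'" "d dvd b - b'"
  hence "d dvd (a - a') * b + a' * (b - b')" by simp
  thus ?thesis by (simp add: algebra_simps)
qed

text \<open>Multiplied by m!, the binomial coefficient becomes a polynomial with integer
  coefficients, which preserves congruences. As m! divides some p^e, agreement modulo p^(e+j) still
  gives p^j after the division.\<close>

lemma gbinomial_emb_continuous: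
  obtains n where "\<And>z z' :: 'p :: prime_type padic_int. of_nat CARD('p) ^ n dvd z - z' \<Longrightarrow>
    \<exists>s. (emb z gchoose m) - (emb z' gchoose m) = of_nat CARD('p) ^ j * emb s"
proof -
  let ?p = "of_nat CARD('p) :: 'p padic_int"
  have "(fact m :: 'p padic_int) = of_nat (fact m)" by simp
  hence "(fact m :: 'p padic_int) \<noteq> 0" by (simp del: of_nat_fact)
  then obtain e u where e: "?p ^ e = fact m * u" by (metis padic_int_dvd_prime_power dvd_def)
  have "\<exists>s. (emb z gchoose m) - (emb z' gchoose m) = of_nat CARD('p) ^ j * emb s"
    if "?p ^ (e + j) dvd z - z'" for z z'
  proof -
    define P where "P a = (\<Prod>i<m. a - of_nat i)" for a :: "'p padic_int"
    have choose: "fact m * (emb a gchoose m) = emb (P a)" for a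
      by (simp add: P_def gbinomial_prod_rev emb.hom_prod emb.hom_of_nat[symmetric] lessThan_atLeast0
          del: to_ac_of_nat emb.hom_of_nat)
    have "?p ^ (e + j) dvd P z - P z'"
      unfolding P_def using that by (induction m) (auto intro!: dvd_diff_mult)
    then obtain s where s: "P z - P z' = ?p ^ (e + j) * s" by (auto simp: dvd_def)
    have "fact m * ((emb z gchoose m) - (emb z' gchoose m)) = emb (P z - P z')"
      by (simp add: right_diff_distrib choose)
    also have "\<dots> = emb (fact m * u * ?p ^ j * s)" unfolding s power_add e ..
    also have "\<dots> = emb (fact m) * (emb (?p ^ j) * emb (u * s))"
      by (simp only: emb.hom_mult mult_ac)
    also have "emb (fact m) = fact m" by (metis emb.hom_of_nat of_nat_fact)
    also have "emb (?p ^ j) = of_nat CARD('p) ^ j" by (simp only: emb.hom_of_nat emb.hom_power)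
    finally have "(emb z gchoose m) - (emb z' gchoose m) = of_nat CARD('p) ^ j * emb (u * s)"
      by simp
    thus ?thesis by blast
  qed
  thus ?thesis using that by blast
qed

text \<open>Continuity for j = 0: up to an element of Z_p the value is the one at a natural number
  near z, which is an integer.\<close>

lemma gbinomial_emb_in_range:
  "\<exists>s. emb (z :: 'p :: prime_type padic_int) gchoose m = emb s"
proof -
  obtain n where n: "\<And>z z' :: 'p padic_int. of_nat CARD('p) ^ n dvd z - z' \<Longrightarrow>
    \<exists>s. (emb z gchoose m) - (emb z' gchoose m) = of_nat CARD('p) ^ 0 * emb s"
    using gbinomial_emb_continuous by blast
  obtain k where "of_nat CARD('p) ^ n dvd z - of_nat k" by (rule padic_int_approx_nat)
  then obtain s where s: "(emb z gchoose m) - (emb (of_nat k) gchoose m) = emb s" using n by fastforce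
  have "emb (of_nat k) gchoose m = emb (of_nat (k choose m))"
    by (simp only: emb.hom_of_nat binomial_gbinomial)
  hence "emb z gchoose m = emb (s + of_nat (k choose m))"
    using s by (simp add: algebra_simps)
  thus ?thesis by blast
qed

section \<open>Mahler expansions of locally constant functions\<close>

definition fdiff :: "(nat \<Rightarrow> int) \<Rightarrow> nat \<Rightarrow> int" where
  "fdiff f = (\<lambda>x. f (Suc x) - f x)"

lemma newton_expansion: "f x = (\<Sum>m\<le>x. int (x choose m) * (fdiff ^^ m) f 0)"
proof (induction x arbitrary: f)
  case (Suc x)
  have "f (Suc x) = f x + fdiff f x" by (simp add: fdiff_def)
  also have "f x = (\<Sum>m\<le>x. int (x choose m) * (fdiff ^^ m) f 0)" by (rule Suc)
  also have "\<dots> = (\<Sum>m\<le>Suc x. int (x choose m) * (fdiff ^^ m) f 0)" by simp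
  also have "\<dots> = f 0 + (\<Sum>m\<le>x. int (x choose Suc m) * (fdiff ^^ Suc m) f 0)"
    by (subst sum.atMost_Suc_shift) simp
  also have "fdiff f x = (\<Sum>m\<le>x. int (x choose m) * (fdiff ^^ Suc m) f 0)"
    unfolding funpow_Suc_right comp_def by (rule Suc)
  also have "f 0 + (\<Sum>m\<le>x. int (x choose Suc m) * (fdiff ^^ Suc m) f 0) + \<dots>
      = f 0 + (\<Sum>m\<le>x. int (Suc x choose Suc m) * (fdiff ^^ Suc m) f 0)"
    by (simp add: sum.distrib distrib_right)
  also have "\<dots> = (\<Sum>m\<le>Suc x. int (Suc x choose m) * (fdiff ^^ m) f 0)"
    by (subst sum.atMost_Suc_shift) simp
  finally show ?case .
qed simp

lemma fdiff_pow_eq: "(fdiff ^^ m) f x = (\<Sum>i\<le>m. (-1) ^ (m - i) * int (m choose i) * f (x + i))"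
proof (induction m arbitrary: x)
  case (Suc m)
  let ?c = "\<lambda>m i. (-1) ^ (m - i) * int (m choose i)"
  have "(fdiff ^^ Suc m) f x = (\<Sum>i\<le>m. ?c m i * f (x + Suc i)) - (\<Sum>i\<le>m. ?c m i * f (x + i))"
    by (simp add: fdiff_def Suc)
  also have "(\<Sum>i\<le>m. ?c m i * f (x + i)) = (\<Sum>i\<le>Suc m. ?c m i * f (x + i))" by simp
  also have "\<dots> = (-1) ^ m * f x + (\<Sum>i\<le>m. ?c m (Suc i) * f (x + Suc i))"
    by (subst sum.atMost_Suc_shift) simp
  also have "(\<Sum>i\<le>m. ?c m i * f (x + Suc i)) - ((-1) ^ m * f x + (\<Sum>i\<le>m. ?c m (Suc i) * f (x + Suc i)))
      = (-1) ^ Suc m * f x + (\<Sum>i\<le>m. (?c m i - ?c m (Suc i)) * f (x + Suc i))"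
    by (simp add: sum_subtractf algebra_simps)
  also have "(\<Sum>i\<le>m. (?c m i - ?c m (Suc i)) * f (x + Suc i)) = (\<Sum>i\<le>m. ?c (Suc m) (Suc i) * f (x + Suc i))"
  proof (intro sum.cong refl arg_cong2[of _ _ _ _ "(*)"])
    fix i assume "i \<in> {..m}"
    show "?c m i - ?c m (Suc i) = ?c (Suc m) (Suc i)"
    proof (cases "i = m")
      case False
      hence "m - i = Suc (m - Suc i)" using \<open>i \<in> {..m}\<close> by auto
      thus ?thesis by (simp add: algebra_simps)
    qed simp
  qed
  also have "(-1) ^ Suc m * f x + \<dots> = (\<Sum>i\<le>Suc m. ?c (Suc m) i * f (x + i))"
    by (subst sum.atMost_Suc_shift) simp
  finally show ?case .
qed simp

lemma fdiff_pow_periodic: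
  assumes "\<And>x. f (x + n) = f x"
  shows "(fdiff ^^ m) f (x + n) = (fdiff ^^ m) f x"
proof (induction m arbitrary: x)
  case (Suc m)
  show ?case using Suc[of "Suc x"] Suc[of x] by (simp add: fdiff_def)
qed (simp add: assms)

text \<open>From i (P choose i) = P (P - 1 choose i - 1) with P = p^n: if p did not divide the
  binomial coefficient, P would divide i.\<close>

lemma prime_dvd_choose_prime_power:
  fixes p :: nat
  assumes "prime p" "0 < i" "i < p ^ n"
  shows "p dvd (p ^ n choose i)"
proof (rule ccontr)
  assume "\<not> p dvd (p ^ n choose i)"
  hence "coprime (p ^ n) (p ^ n choose i)" using assms(1) by (simp add: prime_imp_coprime)
  moreover have "p ^ n dvd i * (p ^ n choose i)"
    using times_binomial_minus1_eq[OF assms(2), of "p ^ n"] by simp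
  ultimately have "p ^ n dvd i" by (simp add: coprime_dvd_mult_left_iff)
  thus False using assms(2,3) by (auto dest: dvd_imp_le)
qed

text \<open>With E the shift, (E - 1)^(p^n) is congruent to E^(p^n) - 1 modulo p, which kills
  functions of period p^n. When p^n is even the two end terms add up to 2 f x instead of cancelling,
  but then p = 2.\<close>

lemma fdiff_prime_power_dvd:
  assumes p: "prime p" and per: "\<And>x. f (x + p ^ n) = f x"
  shows "int p dvd (fdiff ^^ (p ^ n)) f x"
proof -
  let ?P = "p ^ n" and ?g = "\<lambda>i. (-1) ^ (p ^ n - i) * int (p ^ n choose i) * f (x + i)"
  have pos: "?P > 0" using prime_gt_0_nat[OF p] by simp
  have "(fdiff ^^ ?P) f x = (\<Sum>i\<le>?P. ?g i)" by (rule fdiff_pow_eq)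
  also have "{..?P} = insert 0 (insert ?P {0<..<?P})" using pos by auto
  also have "(\<Sum>i\<in>insert 0 (insert ?P {0<..<?P}). ?g i) = ((-1) ^ ?P + 1) * f x + (\<Sum>i\<in>{0<..<?P}. ?g i)"
    using pos by (simp add: per algebra_simps)
  finally have eq: "(fdiff ^^ ?P) f x = ((-1) ^ ?P + 1) * f x + (\<Sum>i\<in>{0<..<?P}. ?g i)" .
  have "int p dvd (-1) ^ ?P + 1"
  proof (cases "even ?P")
    case True
    hence "even p" by simp
    hence "p = 2" using p primes_dvd_imp_eq[OF two_is_prime_nat p] by simp
    thus ?thesis using True by simp
  qed simp
  moreover have "int p dvd (p ^ n choose i)" if "i \<in> {0<..<?P}" for i
  proof -
    have "p dvd (p ^ n choose i)"
      using p that by (intro prime_dvd_choose_prime_power) auto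
    thus ?thesis by (simp add: int_dvd_int_iff)
  qed
  hence "int p dvd (\<Sum>i\<in>{0<..<?P}. ?g i)" by (intro dvd_sum dvd_mult dvd_mult2) auto
  ultimately show ?thesis unfolding eq by simp
qed

lemma fdiff_pow_dvd: "(\<And>x. d dvd f x) \<Longrightarrow> d dvd (fdiff ^^ m) f x"
  unfolding fdiff_pow_eq by (intro dvd_sum dvd_mult)

lemma fdiff_pow_mult: "(fdiff ^^ m) (\<lambda>x. c * f x) x = c * (fdiff ^^ m) f x"
  unfolding fdiff_pow_eq sum_distrib_left by (intro sum.cong) (auto simp: mult_ac)

text \<open>The p^n-th difference divided by p is again an integer-valued function of period p^n, so
  each further block of p^n differences contributes another factor p.\<close>

lemma fdiff_prime_power_dvd_power:
  assumes p: "prime p" and per: "\<And>x. f (x + p ^ n) = f x" and m: "j * p ^ n \<le> m"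
  shows "int p ^ j dvd (fdiff ^^ m) f x"
proof -
  have *: "int p ^ j dvd (fdiff ^^ (j * p ^ n)) f x" for x
    using per
  proof (induction j arbitrary: f x)
    case (Suc j)
    define g where "g y = (fdiff ^^ (p ^ n)) f y div int p" for y
    have g: "(fdiff ^^ (p ^ n)) f = (\<lambda>y. int p * g y)"
      using fdiff_prime_power_dvd[of p f n, OF p Suc.prems] by (simp add: g_def)
    have "g (y + p ^ n) = g y" for y
      unfolding g_def using fdiff_pow_periodic[of f, OF Suc.prems] by simp
    hence IH: "int p ^ j dvd (fdiff ^^ (j * p ^ n)) g x" by (rule Suc.IH)
    have "(fdiff ^^ (Suc j * p ^ n)) f x = (fdiff ^^ (j * p ^ n)) ((fdiff ^^ (p ^ n)) f) x"
      by (simp add: funpow_add add.commute[of "p ^ n"])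
    also have "\<dots> = int p * (fdiff ^^ (j * p ^ n)) g x" unfolding g by (rule fdiff_pow_mult)
    finally show ?case using IH by simp
  qed simp
  have "(fdiff ^^ m) f = (fdiff ^^ (m - j * p ^ n)) ((fdiff ^^ (j * p ^ n)) f)"
    using m by (metis comp_apply funpow_add le_add_diff_inverse2)
  thus ?thesis using fdiff_pow_dvd[of _ "(fdiff ^^ (j * p ^ n)) f", OF *] by simp
qed

lemma mahler_periodic:
  assumes p: "prime p" and per: "\<And>x. f (x + p ^ n) = f x"
  shows "int p ^ j dvd f x - (\<Sum>m<j * p ^ n. (fdiff ^^ m) f 0 * int (x choose m))"
proof -
  let ?M = "j * p ^ n" and ?g = "\<lambda>m. (fdiff ^^ m) f 0 * int (x choose m)"
  have "f x = (\<Sum>m\<le>x. ?g m)" by (subst newton_expansion) (simp add: mult.commute)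
  \<comment> \<open>The added terms vanish because x choose m = 0 for m > x; the longer range
    contains the cut-off \<open>?M\<close> whatever x is.\<close>
  also have "\<dots> = (\<Sum>m<?M + Suc x. ?g m)"
    by (intro sum.mono_neutral_left) auto
  also have "\<dots> = (\<Sum>m<?M. ?g m) + (\<Sum>m\<in>{?M..<?M + Suc x}. ?g m)"
    by (subst sum.union_disjoint[symmetric]) (auto simp del: sum.lessThan_Suc intro!: sum.cong)
  finally have "f x - (\<Sum>m<?M. ?g m) = (\<Sum>m\<in>{?M..<?M + Suc x}. ?g m)" by simp
  also have "int p ^ j dvd \<dots>"
    by (intro dvd_sum dvd_mult2 fdiff_prime_power_dvd_power[of p f n, OF p per]) auto
  finally show ?thesis .
qed

text \<open>At natural numbers this is the truncated Newton series of a function of period p^n. The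
  indicator and the binomial coefficients are continuous, so the congruence passes to z from a
  natural number close to it.\<close>

lemma mahler_indicator:
  fixes a :: "'p :: prime_type padic_int"
  obtains M c where "\<And>z. \<exists>s. (if of_nat CARD('p) ^ n dvd z - a then 1 else 0)
    - (\<Sum>m<M. of_int (c m) * (emb z gchoose m)) = of_nat CARD('p) ^ j * emb s"
proof -
  let ?p = "of_nat CARD('p) :: 'p padic_int"
  define f where "f x = (if ?p ^ n dvd of_nat x - a then 1 else 0 :: int)" for x
  have "?p ^ n dvd of_nat (x + CARD('p) ^ n) - a \<longleftrightarrow> ?p ^ n dvd of_nat x - a" for x
    using dvd_add_right_iff[of "?p ^ n" "?p ^ n" "of_nat x - a"] by (simp add: algebra_simps)
  hence per: "f (x + CARD('p) ^ n) = f x" for x by (simp add: f_def)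
  define M where "M = j * CARD('p) ^ n"
  define c where "c m = (fdiff ^^ m) f 0" for m
  have "\<exists>k. \<forall>z z' :: 'p padic_int. ?p ^ k dvd z - z' \<longrightarrow>
    (\<exists>s. (emb z gchoose m) - (emb z' gchoose m) = of_nat CARD('p) ^ j * emb s)" for m
    by (rule gbinomial_emb_continuous[of m j]) blast
  then obtain k where k: "\<And>m z z' :: 'p padic_int. ?p ^ k m dvd z - z' \<Longrightarrow>
    (\<exists>s. (emb z gchoose m) - (emb z' gchoose m) = of_nat CARD('p) ^ j * emb s)"
    by metis
  have "\<exists>s. (if ?p ^ n dvd z - a then 1 else 0) - (\<Sum>m<M. of_int (c m) * (emb z gchoose m))
    = of_nat CARD('p) ^ j * emb s" for z
  proof -
    \<comment> \<open>Close enough to preserve the indicator (n) and each of the finitely many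
      binomial coefficients modulo p^j (\<open>k m\<close>); the sum serves as a common upper
      bound.\<close>
    define e where "e = n + (\<Sum>m<M. k m)"
    obtain x where x: "?p ^ e dvd z - of_nat x" by (rule padic_int_approx_nat)
    have "?p ^ k m dvd z - of_nat x" if "m < M" for m
    proof -
      have "k m \<le> (\<Sum>m<M. k m)" using that by (intro member_le_sum) auto
      thus ?thesis using x by (intro power_le_dvd[OF x]) (simp add: e_def)
    qed
    hence "\<forall>m\<in>{..<M}. \<exists>s. (emb z gchoose m) - (emb (of_nat x) gchoose m) = of_nat CARD('p) ^ j * emb s"
      using k by blast
    then obtain s where "\<forall>m\<in>{..<M}. (emb z gchoose m) - (emb (of_nat x) gchoose m) = of_nat CARD('p) ^ j * emb (s m)"
      by (rule bchoice[THEN exE])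
    moreover have "emb (of_nat x) gchoose m = of_nat (x choose m)" for m
      by (simp only: emb.hom_of_nat binomial_gbinomial)
    ultimately have s: "emb z gchoose m = of_nat (x choose m) + of_nat CARD('p) ^ j * emb (s m)" if "m < M" for m
      using that by (simp add: algebra_simps)
    have fx: "(if ?p ^ n dvd z - a then 1 else 0) = (of_int (f x) :: 'p padic alg_closure)"
    proof -
      have "?p ^ n dvd z - of_nat x" using x by (rule power_le_dvd) (simp add: e_def)
      moreover have "z - a = (of_nat x - a) + (z - of_nat x)" by simp
      ultimately have "?p ^ n dvd z - a \<longleftrightarrow> ?p ^ n dvd of_nat x - a"
        by (metis dvd_add_left_iff)
      thus ?thesis by (simp add: f_def)
    qed
    obtain t where t: "f x - (\<Sum>m<M. c m * int (x choose m)) = int CARD('p) ^ j * t"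
      using mahler_periodic[of "CARD('p)" f n j x, OF prime_CARD per] unfolding M_def c_def by (auto simp: dvd_def)
    have "(if ?p ^ n dvd z - a then 1 else 0) - (\<Sum>m<M. of_int (c m) * (emb z gchoose m))
        = of_int (f x) - (\<Sum>m<M. of_int (c m) * (of_nat (x choose m) + of_nat CARD('p) ^ j * emb (s m)))"
      unfolding fx using s by simp
    also have "\<dots> = of_int (f x - (\<Sum>m<M. c m * int (x choose m)))
       - of_nat CARD('p) ^ j * (\<Sum>m<M. of_int (c m) * emb (s m))"
      by (simp add: distrib_left sum.distrib sum_distrib_left mult_ac)
    also have "\<dots> = of_nat CARD('p) ^ j * (of_int t - (\<Sum>m<M. of_int (c m) * emb (s m)))"
      unfolding t by (simp add: right_diff_distrib)
    also have "of_int t - (\<Sum>m<M. of_int (c m) * emb (s m)) = emb (of_int t - (\<Sum>m<M. of_int (c m) * s m))"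
      by (simp only: emb.hom_minus emb.hom_sum emb.hom_mult emb.hom_of_int)
    finally show ?thesis by blast
  qed
  thus ?thesis using that by blast
qed

section \<open>Coordinates on \<open>F \<otimes> \<rat>\<^sub>p\<close>\<close>

text \<open>The universal property of the tensor product, for maps to the additive group of a ring.
  In a group given by generators and relations, elements are told apart by maps out of it, and this
  lemma supplies them.\<close>

lemma rat_tensor_functional:
  fixes h :: "'a :: field_char_0 \<Rightarrow> 'b :: field_char_0 \<Rightarrow> 'c :: comm_ring_1"
  assumes left: "\<And>a a' b. h (a + a') b = h a b + h a' b"
    and right: "\<And>a b b'. h a (b + b') = h a b + h a b'"
    and balanced: "\<And>q a b. h (of_rat q * a) b = h a (of_rat q * b)"
  obtains T where "\<And>\<alpha> \<beta>. T (\<alpha> + \<beta>) = T \<alpha> + T \<beta>" "\<And>a b. T (tensor a b) = h a b"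
proof -
  define H where "H u = (\<Sum>x\<in>Poly_Mapping.keys u. of_int (Poly_Mapping.lookup u x) * h (fst x) (snd x))"
    for u :: "('a \<times> 'b) \<Rightarrow>\<^sub>0 int"
  have H: "H u = (\<Sum>x\<in>A. of_int (Poly_Mapping.lookup u x) * h (fst x) (snd x))"
    if "finite A" "Poly_Mapping.keys u \<subseteq> A" for u A
    unfolding H_def using that by (intro sum.mono_neutral_left) (auto simp: in_keys_iff)
  have add: "H (u + w) = H u + H w" for u w
    using keys_add[of u w]
    by (simp add: H[of "Poly_Mapping.keys u \<union> Poly_Mapping.keys w"] lookup_add distrib_right sum.distrib)
  have diff: "H (u - w) = H u - H w" for u w
    using add[of "u - w" w] by simp
  have single: "H (frag_of (a, b)) = h a b" for a b
    by (simp add: H_def)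
  have null: "H u = 0" if "u \<in> tensor_null" for u
    using that
    by induction (simp_all add: diff single left right balanced, simp add: H_def)
  define T where "T \<alpha> = H (rep_rat_tensor \<alpha>)" for \<alpha>
  have T: "T (abs_rat_tensor u) = H u" for u
  proof -
    have "rep_rat_tensor (abs_rat_tensor u) - u \<in> tensor_null"
      using Quotient_rep_abs[OF Quotient_rat_tensor, of u] tensor_null_0 by simp
    thus ?thesis using null diff by (fastforce simp: T_def)
  qed
  show ?thesis
  proof (rule that)
    show "T (\<alpha> + \<beta>) = T \<alpha> + T \<beta>" for \<alpha> \<beta>
      by (induction \<alpha>, induction \<beta>) (simp add: plus_rat_tensor.abs_eq T add)
    show "T (tensor a b) = h a b" for a b
      by (simp add: tensor.abs_eq T single)
  qed
qed

lemma tensor_0_right [simp]: "tensor a 0 = 0"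
  using tensor_add_right[of a 0 0] by simp

lemma tensor_add_left: "tensor (a + a') b = tensor a b + tensor a' b"
  by transfer (simp add: diff_diff_eq[symmetric] tensor_null_left)

lemma tensor_0_left [simp]: "tensor 0 b = 0"
  using tensor_add_left[of 0 0 b] by simp

lemma tensor_sum_left: "tensor (\<Sum>i\<in>A. f i) b = (\<Sum>i\<in>A. tensor (f i) b)"
  by (induction A rule: infinite_finite_induct) (simp_all add: tensor_add_left)

interpretation rat: vector_space "rat_scale :: rat \<Rightarrow> 'f :: field_char_0 \<Rightarrow> 'f"
  by unfold_locales (auto simp: algebra_simps of_rat_add of_rat_mult)

text \<open>The functional that takes the i-th rational coordinate in the left factor reads off the
  coefficient \<open>c i\<close>.\<close>

lemma tensor_basis_inject:
  fixes w :: "'n :: finite \<Rightarrow> 'f :: field_char_0" and c c' :: "'n \<Rightarrow> 'b :: field_char_0"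
  assumes w: "rat_basis w" and eq: "(\<Sum>i\<in>UNIV. tensor (w i) (c i)) = (\<Sum>i\<in>UNIV. tensor (w i) (c' i))"
  shows "c = c'"
proof
  fix i
  have indep: "rat.independent (range w)" and span: "rat.span (range w) = UNIV" and inj: "inj w"
    using w by (auto simp: rat_basis_def)
  define \<phi> where "\<phi> y = rat.representation (range w) y (w i)" for y
  have lin: "\<phi> (y + y') = \<phi> y + \<phi> y'" "\<phi> (of_rat q * y) = q * \<phi> y" for y y' q
    using rat.representation_add[OF indep, of y' y] rat.representation_scale[OF indep, of y q]
    by (simp_all add: \<phi>_def span)
  obtain T :: "('f, 'b) rat_tensor \<Rightarrow> 'b" where T: "\<And>\<alpha> \<beta>. T (\<alpha> + \<beta>) = T \<alpha> + T \<beta>"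
    "\<And>a b. T (tensor a b) = of_rat (\<phi> a) * b"
  proof (rule rat_tensor_functional[of "\<lambda>a b. of_rat (\<phi> a) * b :: 'b"])
    show "of_rat (\<phi> (a + a')) * b = of_rat (\<phi> a) * b + of_rat (\<phi> a') * b" for a a' and b :: 'b
      by (simp add: lin of_rat_add distrib_right)
    show "of_rat (\<phi> (of_rat q * a)) * b = of_rat (\<phi> a) * (of_rat q * b)" for a q and b :: 'b
      by (simp only: lin of_rat_mult mult.assoc mult.left_commute)
  qed (rule distrib_left, rule that)
  have \<phi>: "\<phi> (w j) = (if j = i then 1 else 0)" for j
    using rat.representation_basis[OF indep, of "w j"] inj by (auto simp: \<phi>_def inj_eq)
  have "T 0 = 0" using T(1)[of 0 0] by simp
  hence sum: "T (\<Sum>j\<in>A. f j) = (\<Sum>j\<in>A. T (f j))" for f and A :: "'n set"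
    by (induction A rule: infinite_finite_induct) (simp_all add: T(1))
  have "T (\<Sum>j\<in>UNIV. tensor (w j) (c j)) = c i" for c
  proof -
    have "T (\<Sum>j\<in>UNIV. tensor (w j) (c j)) = (\<Sum>j\<in>UNIV. if j = i then c j else 0)"
      unfolding sum T \<phi> by (intro sum.cong) auto
    thus ?thesis by simp
  qed
  thus "c i = c' i" using eq by metis
qed

lemma padic_coords_sum:
  "rat_basis w \<Longrightarrow> padic_coords w (\<Sum>i\<in>UNIV. tensor (w i) (c i)) = c"
  unfolding padic_coords_def by (intro the_equality) (auto dest: tensor_basis_inject)

text \<open>Parametrizes \<open>padic_lattice w\<close> by tuples over Z_p. It is injective for a
  basis w, so that subsets of the lattice can be handled as sets of tuples.\<close>

definition lattice_point ::
  "('n :: finite \<Rightarrow> 'f :: field_char_0) \<Rightarrow> ('n \<Rightarrow> 'p :: prime_type padic_int) \<Rightarrow> ('f, 'p padic) rat_tensor" where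
  "lattice_point w a = (\<Sum>i\<in>UNIV. tensor (w i) (to_fract (a i)))"

lemma inj_lattice_point: "rat_basis w \<Longrightarrow> inj (lattice_point w)"
proof (rule injI)
  fix a b assume "rat_basis w" "lattice_point w a = lattice_point w b"
  hence "(\<lambda>i. to_fract (a i)) = (\<lambda>i. to_fract (b i))"
    unfolding lattice_point_def by (rule tensor_basis_inject)
  thus "a = b" by (metis ext to_fract_eq_iff)
qed

lemma padic_coords_lattice_point: "rat_basis w \<Longrightarrow> padic_coords w (lattice_point w a) = (\<lambda>i. to_fract (a i))"
  unfolding lattice_point_def by (rule padic_coords_sum)

lemma padic_lattice_eq: "padic_lattice w = range (lattice_point w)"
  unfolding padic_lattice_def lattice_point_def ..

lemma lattice_point_add: "lattice_point w (\<lambda>i. a i + b i) = lattice_point w a + lattice_point w b"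
  by (simp add: lattice_point_def tensor_add_right sum.distrib)

lemma tensor_prime_power_left:
  "tensor (of_nat CARD('p) ^ n * y) (to_fract (a :: 'p :: prime_type padic_int)) =
    tensor y (to_fract (of_nat CARD('p) ^ n * a))"
proof -
  have 1: "of_nat k = to_fract (of_nat k :: 'p padic_int)" for k by (induction k) auto
  have 2: "to_fract b ^ m = to_fract (b ^ m)" for b :: "'p padic_int" and m by (induction m) auto
  have "tensor (of_rat (of_nat CARD('p) ^ n) * y) (to_fract a) =
      tensor y (of_rat (of_nat CARD('p) ^ n) * to_fract a)"
    by (rule tensor_balanced)
  also have "of_rat (of_nat CARD('p) ^ n) = (to_fract (of_nat CARD('p) ^ n) :: 'p padic)"
    by (simp only: of_rat_power of_rat_of_nat_eq 1 2)
  finally show ?thesis by (simp add: of_rat_power)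
qed

lemma lattice_point_prime_power:
  "lattice_point (\<lambda>i. of_nat CARD('p) ^ n * w i) a =
    lattice_point w (\<lambda>i. of_nat CARD('p) ^ n * a i :: 'p :: prime_type padic_int)"
  by (simp add: lattice_point_def tensor_prime_power_left)

text \<open>The coset a + p^n Z_p^k in terms of residues.\<close>

definition cylinder :: "nat \<Rightarrow> ('n \<Rightarrow> 'p :: prime_type padic_int) \<Rightarrow> ('n \<Rightarrow> 'p padic_int) set" where
  "cylinder n a = {b. \<forall>i. Rep_padic_int (b i) n = Rep_padic_int (a i) n}"

lemma in_cylinder_iff_dvd: "b \<in> cylinder n a \<longleftrightarrow> (\<forall>i. of_nat CARD('p) ^ n dvd b i - a i)"
  for a b :: "'n \<Rightarrow> 'p :: prime_type padic_int"
  by (simp add: cylinder_def padic_power_dvd_diff_iff)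

lemma cylinder_self [simp]: "a \<in> cylinder n a"
  by (simp add: cylinder_def)

lemma cylinder_eq: "b \<in> cylinder n a \<Longrightarrow> cylinder n b = cylinder n a"
  by (auto simp: cylinder_def)

lemma cylinder_mono: "m \<le> n \<Longrightarrow> cylinder n a \<subseteq> cylinder m a"
  by (auto simp: cylinder_def Rep_padic_int_coherent[of m n])

lemma lattice_coset_lattice_point:
  "lattice_coset w n (lattice_point w a) = lattice_point w ` cylinder n a"
  for a :: "'n :: finite \<Rightarrow> 'p :: prime_type padic_int"
proof -
  have "lattice_coset w n (lattice_point w a) =
      range (\<lambda>b. lattice_point w (\<lambda>i. a i + of_nat CARD('p) ^ n * b i))"
    by (simp add: lattice_coset_def padic_lattice_eq lattice_point_prime_power lattice_point_add image_image)
  also have "\<dots> = lattice_point w ` range (\<lambda>b i. a i + of_nat CARD('p) ^ n * b i)"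
    by (simp add: image_image)
  also have "range (\<lambda>b i. a i + of_nat CARD('p) ^ n * b i) = cylinder n a"
  proof (intro equalityI subsetI)
    fix c assume "c \<in> cylinder n a"
    hence "\<forall>i. \<exists>b. c i - a i = of_nat CARD('p) ^ n * b" by (simp add: in_cylinder_iff_dvd dvd_def)
    then obtain b where "\<And>i. c i - a i = of_nat CARD('p) ^ n * b i" by metis
    hence "c = (\<lambda>i. a i + of_nat CARD('p) ^ n * b i)" by (auto simp: fun_eq_iff algebra_simps)
    thus "c \<in> range (\<lambda>b i. a i + of_nat CARD('p) ^ n * b i)" by blast
  qed (auto simp: in_cylinder_iff_dvd)
  finally show ?thesis .
qed

definition residue_reps :: "nat \<Rightarrow> ('n \<Rightarrow> 'p :: prime_type padic_int) set" where
  "residue_reps n = PiE UNIV (\<lambda>_. of_nat ` {..<CARD('p) ^ n})"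

lemma finite_residue_reps [simp]: "finite (residue_reps n :: ('n :: finite \<Rightarrow> 'p :: prime_type padic_int) set)"
  unfolding residue_reps_def by (intro finite_PiE) auto

lemma residue_rep_exists:
  fixes a :: "'n \<Rightarrow> 'p :: prime_type padic_int"
  obtains s where "s \<in> residue_reps n" "s \<in> cylinder n a"
proof -
  have "\<exists>k. k < CARD('p) ^ n \<and> of_nat CARD('p) ^ n dvd a i - of_nat k" for i
    by (rule padic_int_approx_nat) blast
  then obtain k where k: "\<And>i. k i < CARD('p) ^ n" "\<And>i. of_nat CARD('p) ^ n dvd a i - of_nat (k i)" by metis
  have "(\<lambda>i. of_nat (k i) :: 'p padic_int) \<in> residue_reps n" using k by (auto simp: residue_reps_def)
  moreover have "(\<lambda>i. of_nat (k i) :: 'p padic_int) \<in> cylinder n a"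
    using k(2) by (simp add: cylinder_def padic_power_dvd_diff_iff)
  ultimately show ?thesis by (rule that)
qed

lemma residue_rep_unique:
  fixes s :: "'n \<Rightarrow> 'p :: prime_type padic_int"
  assumes "s \<in> residue_reps n" "t \<in> residue_reps n" "s \<in> cylinder n t"
  shows "s = t"
proof
  fix i
  from assms(1,2) obtain k l where kl: "s i = of_nat k" "t i = of_nat l" "k < CARD('p) ^ n" "l < CARD('p) ^ n"
    by (fastforce simp: residue_reps_def PiE_iff)
  have "int k mod int CARD('p) ^ n = int l mod int CARD('p) ^ n"
    using assms(3) kl by (auto simp: cylinder_def of_nat_padic_int dest: spec[of _ i])
  moreover have "int k < int CARD('p) ^ n" "int l < int CARD('p) ^ n"
    using kl by (simp_all flip: of_nat_power)
  ultimately show "s i = t i" using kl by simp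
qed

section \<open>Compact open sets\<close>

lemma openin_padic_topology_lattice_point:
  fixes V :: "('n :: finite \<Rightarrow> 'p :: prime_type padic_int) set"
  assumes w: "rat_basis w"
  shows "openin (padic_topology w) (lattice_point w ` V) \<longleftrightarrow> (\<forall>a\<in>V. \<exists>n. cylinder n a \<subseteq> V)"
  by (simp add: openin_padic_topology lattice_coset_lattice_point inj_image_subset_iff[OF inj_lattice_point[OF w]])

lemma openin_cylinder:
  "rat_basis w \<Longrightarrow> openin (padic_topology w) (lattice_point w ` cylinder n a)"
  by (subst openin_padic_topology_lattice_point) (auto dest: cylinder_eq)

text \<open>A set without a finite subcover contains a nested sequence of such cylinders.\<close>

lemma compactin_lattice_point_image:
  fixes V :: "('n :: finite \<Rightarrow> 'p :: prime_type padic_int) set"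
  assumes w: "rat_basis w" and V: "\<And>a. a \<in> V \<Longrightarrow> cylinder N a \<subseteq> V"
  shows "compactin (padic_topology w) (lattice_point w ` V)"
  unfolding compactin_def
proof (intro conjI allI impI)
  have "openin (padic_topology w) (UNIV :: ('a, 'p padic) rat_tensor set)"
    by (simp add: openin_padic_topology)
  thus "lattice_point w ` V \<subseteq> topspace (padic_topology w)" by (metis openin_subset subset_UNIV subset_trans)
  fix \<U> assume U: "Ball \<U> (openin (padic_topology w)) \<and> lattice_point w ` V \<subseteq> \<Union>\<U>"
  define bad where "bad S \<longleftrightarrow> \<not> (\<exists>\<F>. finite \<F> \<and> \<F> \<subseteq> \<U> \<and> lattice_point w ` (S \<inter> V) \<subseteq> \<Union>\<F>)" for S
  have bad_Un: "bad S \<or> bad T" if bad_ST: "bad (S \<union> T)" for S T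
  proof (rule ccontr)
    assume "\<not> (bad S \<or> bad T)"
    then obtain \<F> \<G> where "finite \<F>" "\<F> \<subseteq> \<U>" "lattice_point w ` (S \<inter> V) \<subseteq> \<Union>\<F>"
      and "finite \<G>" "\<G> \<subseteq> \<U>" "lattice_point w ` (T \<inter> V) \<subseteq> \<Union>\<G>" unfolding bad_def by metis
    hence "finite (\<F> \<union> \<G>) \<and> \<F> \<union> \<G> \<subseteq> \<U> \<and> lattice_point w ` ((S \<union> T) \<inter> V) \<subseteq> \<Union>(\<F> \<union> \<G>)" by blast
    hence "\<exists>\<F>. finite \<F> \<and> \<F> \<subseteq> \<U> \<and> lattice_point w ` ((S \<union> T) \<inter> V) \<subseteq> \<Union>\<F>" by (rule exI)
    thus False using bad_ST by (simp only: bad_def not_True_eq_False simp_thms)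
  qed
  have not_bad_empty: "\<not> bad S" if "S \<inter> V = {}" for S
    unfolding bad_def that by (simp add: exI[of _ "{}"])
  have bad_UN: "\<exists>s\<in>A. bad (T s)" if "finite A" "bad (\<Union>s\<in>A. T s)" for A :: "('n \<Rightarrow> 'p padic_int) set" and T
    using that by (induction A rule: finite_induct) (use bad_Un not_bad_empty in auto)
  have step: "\<exists>b. bad (cylinder (Suc n) b) \<and> b \<in> cylinder n a" if bad_a: "bad (cylinder n a)" for n a
  proof -
    let ?T = "\<lambda>s. cylinder (Suc n) s"
    have "cylinder n a = (\<Union>s\<in>residue_reps (Suc n) \<inter> cylinder n a. ?T s)"
    proof (intro equalityI subsetI)
      fix c assume c: "c \<in> cylinder n a"
      obtain b where b: "b \<in> residue_reps (Suc n)" "b \<in> cylinder (Suc n) c" by (rule residue_rep_exists)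
      have "b \<in> cylinder n c" using b(2) cylinder_mono[of n "Suc n" c] by auto
      hence "b \<in> residue_reps (Suc n) \<inter> cylinder n a" using b c cylinder_eq[of c n a] by auto
      moreover have "c \<in> cylinder (Suc n) b" using cylinder_eq[OF b(2)] by simp
      ultimately show "c \<in> (\<Union>s\<in>residue_reps (Suc n) \<inter> cylinder n a. ?T s)" by blast
    next
      fix c assume "c \<in> (\<Union>s\<in>residue_reps (Suc n) \<inter> cylinder n a. ?T s)"
      then obtain s where s: "s \<in> cylinder n a" "c \<in> cylinder (Suc n) s" by blast
      have "c \<in> cylinder n s" using s(2) cylinder_mono[of n "Suc n" s] by auto
      thus "c \<in> cylinder n a" using cylinder_eq[OF s(1)] by simp
    qed
    hence "bad (\<Union>s\<in>residue_reps (Suc n) \<inter> cylinder n a. ?T s)" using bad_a by simp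
    thus ?thesis using bad_UN[of "residue_reps (Suc n) \<inter> cylinder n a" ?T] by auto
  qed
  have "\<not> bad UNIV"
  proof
    assume "bad UNIV"
    moreover have "cylinder 0 (\<lambda>_. 0) = (UNIV :: ('n \<Rightarrow> 'p padic_int) set)"
      by (auto simp: in_cylinder_iff_dvd)
    ultimately have "bad (cylinder 0 (\<lambda>_. 0))" by simp
    then obtain f where f: "\<And>n. bad (cylinder n (f n))" "\<And>n. f (Suc n) \<in> cylinder n (f n)"
      using dependent_nat_choice[of "\<lambda>n a. bad (cylinder n a)" "\<lambda>n a b. b \<in> cylinder n a"] step by metis
    \<comment> \<open>The common point of the nested cylinders: its n-th residues are those of
      \<open>f n\<close>, and they are coherent because \<open>f (Suc n)\<close> lies in the
      cylinder of \<open>f n\<close>.\<close>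
    have "Rep_padic_int (f n i) n = Rep_padic_int (f (Suc n) i) (Suc n) mod int CARD('p) ^ n" for n i
      using f(2)[of n] Rep_padic_int_coherent[of n "Suc n" "f (Suc n) i"] by (simp add: cylinder_def)
    hence "\<exists>z :: 'p padic_int. Rep_padic_int z = (\<lambda>n. Rep_padic_int (f n i) n)" for i
      using Abs_padic_int_inverse[of "\<lambda>n. Rep_padic_int (f n i) n"] by blast
    then obtain a :: "'n \<Rightarrow> 'p padic_int" where a: "\<And>i. Rep_padic_int (a i) = (\<lambda>n. Rep_padic_int (f n i) n)"
      by metis
    have "a \<in> cylinder n (f n)" for n by (simp add: cylinder_def a)
    hence bad: "bad (cylinder n a)" for n using f(1) cylinder_eq by metis
    show False
    proof (cases "a \<in> V")
      case True
      then obtain W where W: "W \<in> \<U>" "lattice_point w a \<in> W" using U by blast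
      hence "openin (padic_topology w) W" using U by blast
      then obtain n where "lattice_coset w n (lattice_point w a) \<subseteq> W"
        using W(2) openin_padic_topology[of w W] by blast
      hence "lattice_point w ` (cylinder n a \<inter> V) \<subseteq> \<Union>{W}" by (auto simp: lattice_coset_lattice_point)
      hence "finite {W} \<and> {W} \<subseteq> \<U> \<and> lattice_point w ` (cylinder n a \<inter> V) \<subseteq> \<Union>{W}" using W(1) by simp
      hence "\<exists>\<F>. finite \<F> \<and> \<F> \<subseteq> \<U> \<and> lattice_point w ` (cylinder n a \<inter> V) \<subseteq> \<Union>\<F>" by (rule exI)
      thus False using bad[of n] by (simp only: bad_def not_True_eq_False simp_thms)
    next
      \<comment> \<open>Membership in V is constant on cylinders of level N, so the one around a
        misses V and needs no cover at all.\<close>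
      case False
      hence "cylinder N a \<inter> V = {}" using V cylinder_eq by fastforce
      thus False using bad[of N] not_bad_empty by blast
    qed
  qed
  thus "\<exists>\<F>. finite \<F> \<and> \<F> \<subseteq> \<U> \<and> lattice_point w ` V \<subseteq> \<Union>\<F>" by (simp only: bad_def not_not Int_UNIV_left)
qed

text \<open>Openness gives each point of V its own level; compactness leaves finitely many of them,
  and their maximum serves all of V. Finite additivity can thus be tested at a single level.\<close>

lemma compact_opens_iff:
  fixes U :: "('f :: field_char_0, 'p :: prime_type padic) rat_tensor set" and w :: "'n :: finite \<Rightarrow> 'f"
  assumes w: "rat_basis w"
  shows "U \<in> compact_opens w \<longleftrightarrow> (\<exists>n V. U = lattice_point w ` V \<and> (\<forall>a\<in>V. cylinder n a \<subseteq> V))"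
proof
  assume U: "U \<in> compact_opens w"
  define V where "V = {a. lattice_point w a \<in> U}"
  have UV: "U = lattice_point w ` V" using U by (auto simp: compact_opens_def padic_lattice_eq V_def)
  have "\<forall>a\<in>V. \<exists>n. cylinder n a \<subseteq> V"
    using U openin_padic_topology_lattice_point[OF w, of V] by (simp add: compact_opens_def UV)
  then obtain n where n: "\<And>a. a \<in> V \<Longrightarrow> cylinder (n a) a \<subseteq> V" by metis
  have "\<exists>\<F>. finite \<F> \<and> \<F> \<subseteq> (\<lambda>a. lattice_point w ` cylinder (n a) a) ` V \<and> U \<subseteq> \<Union>\<F>"
  proof -
    have "Ball ((\<lambda>a. lattice_point w ` cylinder (n a) a) ` V) (openin (padic_topology w))"
      using openin_cylinder[OF w] by blast
    moreover have "U \<subseteq> \<Union>((\<lambda>a. lattice_point w ` cylinder (n a) a) ` V)"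
      unfolding UV by (force intro: cylinder_self)
    ultimately show ?thesis
      using U unfolding compact_opens_def compactin_def by blast
  qed
  then obtain F where F: "finite F" "F \<subseteq> V" "U \<subseteq> (\<Union>a\<in>F. lattice_point w ` cylinder (n a) a)"
    by (metis (no_types, lifting) finite_subset_image)
  define N where "N = Max (insert 0 (n ` F))"
  have "cylinder N b \<subseteq> V" if "b \<in> V" for b
  proof -
    have "lattice_point w b \<in> (\<Union>a\<in>F. lattice_point w ` cylinder (n a) a)" using F(3) UV that by blast
    then obtain a where a: "a \<in> F" "b \<in> cylinder (n a) a"
      using inj_lattice_point[OF w] by (auto dest: injD)
    have "n a \<le> N" using F(1) a(1) by (simp add: N_def)
    hence "cylinder N b \<subseteq> cylinder (n a) b" by (rule cylinder_mono)
    also have "\<dots> = cylinder (n a) a" by (rule cylinder_eq[OF a(2)])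
    also have "\<dots> \<subseteq> V" using a(1) F(2) n by blast
    finally show ?thesis .
  qed
  thus "\<exists>n V. U = lattice_point w ` V \<and> (\<forall>a\<in>V. cylinder n a \<subseteq> V)" using UV by blast
next
  assume "\<exists>n V. U = lattice_point w ` V \<and> (\<forall>a\<in>V. cylinder n a \<subseteq> V)"
  then obtain n V where V: "U = lattice_point w ` V" "\<And>a. a \<in> V \<Longrightarrow> cylinder n a \<subseteq> V" by blast
  have "openin (padic_topology w) U"
    unfolding V(1) openin_padic_topology_lattice_point[OF w] using V(2) by blast
  moreover have "compactin (padic_topology w) U"
    unfolding V(1) by (rule compactin_lattice_point_image[OF w V(2)])
  ultimately show "U \<in> compact_opens w" by (auto simp: compact_opens_def padic_lattice_eq V(1))
qed

section \<open>Uniqueness of the Amice transform\<close>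

text \<open>The property \<open>separated\<close> says that the p-adic topology of R is Hausdorff:
  an identity may be checked modulo every p^j.\<close>

locale padic_coefficient_ring =
  fixes R :: "'p :: prime_type padic alg_closure set"
  assumes emb_mem: "emb a \<in> R"
    and add_mem: "x \<in> R \<Longrightarrow> y \<in> R \<Longrightarrow> x + y \<in> R"
    and mult_mem: "x \<in> R \<Longrightarrow> y \<in> R \<Longrightarrow> x * y \<in> R"
    and separated: "(\<And>j. \<exists>s\<in>R. z = of_nat CARD('p) ^ j * s) \<Longrightarrow> z = 0"
begin

lemma zero_mem: "0 \<in> R" and one_mem: "1 \<in> R" and of_int_mem: "of_int k \<in> R"
  using emb_mem[of 0] emb_mem[of 1] emb_mem[of "of_int k"] by (simp_all only: emb.hom_zero emb.hom_one emb.hom_of_int)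

lemma uminus_mem: "x \<in> R \<Longrightarrow> - x \<in> R"
  using mult_mem[OF of_int_mem[of "-1"]] by simp

lemma diff_mem: "x \<in> R \<Longrightarrow> y \<in> R \<Longrightarrow> x - y \<in> R"
  using add_mem[OF _ uminus_mem, of x y] by simp

lemma of_nat_mem: "of_nat k \<in> R"
  using of_int_mem[of "int k"] by simp

lemma power_mem: "x \<in> R \<Longrightarrow> x ^ n \<in> R"
  by (induction n) (simp_all add: one_mem mult_mem)

lemma sum_mem: "(\<And>i. i \<in> A \<Longrightarrow> f i \<in> R) \<Longrightarrow> sum f A \<in> R"
  by (induction A rule: infinite_finite_induct) (simp_all add: zero_mem add_mem)

lemma prod_mem: "(\<And>i. i \<in> A \<Longrightarrow> f i \<in> R) \<Longrightarrow> prod f A \<in> R"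
  by (induction A rule: infinite_finite_induct) (simp_all add: one_mem mult_mem)

lemma gbinomial_mem: "emb z gchoose m \<in> R"
  using gbinomial_emb_in_range[of z m] emb_mem by auto

definition pcong :: "nat \<Rightarrow> 'p padic alg_closure \<Rightarrow> 'p padic alg_closure \<Rightarrow> bool" where
  "pcong j x y \<longleftrightarrow> (\<exists>s\<in>R. x - y = of_nat CARD('p) ^ j * s)"

lemma pcongI: "x - y = of_nat CARD('p) ^ j * s \<Longrightarrow> s \<in> R \<Longrightarrow> pcong j x y"
  unfolding pcong_def by blast

lemma pcong_refl [simp]: "pcong j x x"
  by (rule pcongI[of _ _ _ 0]) (simp_all add: zero_mem)

lemma pcong_sym: "pcong j x y \<Longrightarrow> pcong j y x"
proof (unfold pcong_def, elim bexE)
  fix s assume "s \<in> R" "x - y = of_nat CARD('p) ^ j * s"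
  thus "\<exists>s\<in>R. y - x = of_nat CARD('p) ^ j * s"
    by (intro bexI[of _ "- s"]) (auto simp: uminus_mem algebra_simps)
qed

lemma pcong_add: "pcong j x y \<Longrightarrow> pcong j x' y' \<Longrightarrow> pcong j (x + x') (y + y')"
proof (unfold pcong_def, elim bexE)
  fix s s' assume "s \<in> R" "x - y = of_nat CARD('p) ^ j * s" "s' \<in> R" "x' - y' = of_nat CARD('p) ^ j * s'"
  thus "\<exists>s\<in>R. x + x' - (y + y') = of_nat CARD('p) ^ j * s"
    by (intro bexI[of _ "s + s'"]) (auto simp: add_mem algebra_simps)
qed

lemma pcong_trans [trans]: "pcong j x y \<Longrightarrow> pcong j y z \<Longrightarrow> pcong j x z"
proof (unfold pcong_def, elim bexE)
  fix s s' assume "s \<in> R" "x - y = of_nat CARD('p) ^ j * s" "s' \<in> R" "y - z = of_nat CARD('p) ^ j * s'"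
  thus "\<exists>s\<in>R. x - z = of_nat CARD('p) ^ j * s"
    by (intro bexI[of _ "s + s'"]) (auto simp: add_mem algebra_simps)
qed

lemma pcong_mult_left: "pcong j x y \<Longrightarrow> c \<in> R \<Longrightarrow> pcong j (c * x) (c * y)"
proof (unfold pcong_def, elim bexE)
  fix s assume "s \<in> R" "x - y = of_nat CARD('p) ^ j * s" "c \<in> R"
  thus "\<exists>s\<in>R. c * x - c * y = of_nat CARD('p) ^ j * s"
    by (intro bexI[of _ "c * s"]) (simp_all only: mult_mem flip: right_diff_distrib, simp_all add: mult_ac)
qed

lemma pcong_mult:
  assumes "pcong j x y" "pcong j x' y'" "x' \<in> R" "y \<in> R"
  shows "pcong j (x * x') (y * y')"
proof -
  have "pcong j (x' * x) (x' * y)" "pcong j (y * x') (y * y')"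
    using assms by (simp_all add: pcong_mult_left)
  thus ?thesis using pcong_trans by (metis mult.commute)
qed

lemma pcong_sum: "(\<And>i. i \<in> A \<Longrightarrow> pcong j (f i) (g i)) \<Longrightarrow> pcong j (sum f A) (sum g A)"
  by (induction A rule: infinite_finite_induct) (simp_all add: pcong_add)

lemma pcong_prod:
  assumes "\<And>i. i \<in> A \<Longrightarrow> pcong j (f i) (g i)" "\<And>i. i \<in> A \<Longrightarrow> f i \<in> R" "\<And>i. i \<in> A \<Longrightarrow> g i \<in> R"
  shows "pcong j (prod f A) (prod g A)"
  using assms
  by (induction A rule: infinite_finite_induct) (simp_all add: pcong_mult prod_mem)

lemma pcong_all_imp_eq: "(\<And>j. pcong j x y) \<Longrightarrow> x = y"
  using separated[of "x - y"] unfolding pcong_def by simp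

lemma gbinomial_prod_continuous:
  obtains n\<^sub>0 where "\<And>n a b. n \<ge> n\<^sub>0 \<Longrightarrow> b \<in> cylinder n a \<Longrightarrow>
    pcong j (\<Prod>i\<in>UNIV. emb (b i) gchoose m i) (\<Prod>i\<in>(UNIV :: 'n :: finite set). emb (a i) gchoose m i)"
proof -
  have "\<exists>n. \<forall>z z' :: 'p padic_int. of_nat CARD('p) ^ n dvd z - z' \<longrightarrow>
    (\<exists>s. (emb z gchoose k) - (emb z' gchoose k) = of_nat CARD('p) ^ j * emb s)" for k
    by (rule gbinomial_emb_continuous[of k j]) blast
  then obtain e where e: "\<And>k z z' :: 'p padic_int. of_nat CARD('p) ^ e k dvd z - z' \<Longrightarrow>
    (\<exists>s. (emb z gchoose k) - (emb z' gchoose k) = of_nat CARD('p) ^ j * emb s)"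
    by metis
  have "pcong j (\<Prod>i\<in>UNIV. emb (b i) gchoose m i) (\<Prod>i\<in>UNIV. emb (a i) gchoose m i)"
    if n: "n \<ge> (\<Sum>i\<in>UNIV. e (m i))" "b \<in> cylinder n a" for n a b
  proof (intro pcong_prod gbinomial_mem)
    fix i :: 'n
    have "e (m i) \<le> (\<Sum>i\<in>UNIV. e (m i))" by (intro member_le_sum) auto
    hence "e (m i) \<le> n" using n(1) by linarith
    moreover have "of_nat CARD('p) ^ n dvd b i - a i" using n(2) by (simp add: in_cylinder_iff_dvd)
    ultimately have "of_nat CARD('p) ^ e (m i) dvd b i - a i" by (metis power_le_dvd)
    thus "pcong j (emb (b i) gchoose m i) (emb (a i) gchoose m i)"
      using e emb_mem unfolding pcong_def by blast
  qed
  thus ?thesis by (rule that)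
qed

end

lemma sep_prod_t_power_lattice_point:
  "rat_basis w \<Longrightarrow> sep_prod (t_power w (lattice_point w a)) m = (\<Prod>i\<in>UNIV. emb (a i) gchoose m i)"
  by (simp add: sep_prod_def t_power_def padic_coords_lattice_point)

text \<open>Riemann sums run over a set of cosets; this turns them into sums over tuples of natural
  numbers below p^n, where products over the coordinates factor.\<close>

lemma bij_betw_lattice_cosets:
  fixes w :: "'n :: finite \<Rightarrow> 'f :: field_char_0"
  assumes w: "rat_basis w"
  shows "bij_betw (\<lambda>s :: 'n \<Rightarrow> 'p :: prime_type padic_int. lattice_point w ` cylinder n s)
    (residue_reps n) (lattice_coset w n ` padic_lattice w)"
  unfolding bij_betw_def
proof
  show "inj_on (\<lambda>s :: 'n \<Rightarrow> 'p padic_int. lattice_point w ` cylinder n s) (residue_reps n)"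
  proof (rule inj_onI)
    fix s t :: "'n \<Rightarrow> 'p padic_int"
    assume "s \<in> residue_reps n" "t \<in> residue_reps n"
      and "lattice_point w ` cylinder n s = lattice_point w ` cylinder n t"
    moreover from this(3) have "s \<in> cylinder n t"
      using inj_image_eq_iff[OF inj_lattice_point[OF w]] cylinder_self by metis
    ultimately show "s = t" by (intro residue_rep_unique)
  qed
  show "(\<lambda>s :: 'n \<Rightarrow> 'p padic_int. lattice_point w ` cylinder n s) ` residue_reps n
      = lattice_coset w n ` padic_lattice w"
  proof (intro equalityI subsetI)
    fix C :: "('f, 'p padic) rat_tensor set"
    assume "C \<in> lattice_coset w n ` padic_lattice w"
    then obtain a where a: "C = lattice_point w ` cylinder n a"
      by (auto simp: padic_lattice_eq lattice_coset_lattice_point)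
    obtain s where s: "s \<in> residue_reps n" "s \<in> cylinder n a" by (rule residue_rep_exists)
    thus "C \<in> (\<lambda>s. lattice_point w ` cylinder n s) ` residue_reps n"
      unfolding a using cylinder_eq[OF s(2)] by blast
  qed (auto simp: padic_lattice_eq lattice_coset_lattice_point[symmetric])
qed

lemma clopen_eq_Union_cylinders:
  assumes "\<And>a. a \<in> V \<Longrightarrow> cylinder n a \<subseteq> V"
  shows "V = (\<Union>s\<in>residue_reps n \<inter> V. cylinder n s)"
proof (intro equalityI subsetI)
  fix a assume a: "a \<in> V"
  obtain s where s: "s \<in> residue_reps n" "s \<in> cylinder n a" by (rule residue_rep_exists)
  have "s \<in> V" using assms[OF a] s(2) by blast
  moreover have "a \<in> cylinder n s" using cylinder_eq[OF s(2)] by simp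
  ultimately show "a \<in> (\<Union>s\<in>residue_reps n \<inter> V. cylinder n s)" using s(1) by blast
qed (use assms in blast)

lemma measure_eq_sum_cylinders:
  assumes w: "rat_basis w" and \<mu>: "is_padic_measure w R \<mu>" and V: "\<And>a. a \<in> V \<Longrightarrow> cylinder n a \<subseteq> V"
  shows "\<mu> (lattice_point w ` V) = (\<Sum>s\<in>residue_reps n \<inter> V. \<mu> (lattice_point w ` cylinder n s))"
proof -
  have add: "\<mu> (U \<union> W) = \<mu> U + \<mu> W" if "U \<in> compact_opens w" "W \<in> compact_opens w" "U \<inter> W = {}" for U W
    using \<mu> that by (auto simp: is_padic_measure_def)
  have mem: "lattice_point w ` (\<Union>s\<in>A. cylinder n s) \<in> compact_opens w" for A
    unfolding compact_opens_iff[OF w]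
    by (intro exI[of _ n] exI[of _ "\<Union>s\<in>A. cylinder n s"]) (auto dest: cylinder_eq)
  have "\<mu> (lattice_point w ` (\<Union>s\<in>A. cylinder n s)) = (\<Sum>s\<in>A. \<mu> (lattice_point w ` cylinder n s))"
    if "finite A" "A \<subseteq> residue_reps n" for A
    using that
  proof (induction A rule: finite_induct)
    case empty
    thus ?case using add[of "{}" "{}"] mem[of "{}"] by simp
  next
    case (insert s A)
    have "lattice_point w ` cylinder n s \<inter> lattice_point w ` (\<Union>s\<in>A. cylinder n s) = {}"
    proof -
      have "cylinder n s \<inter> cylinder n t = {}" if "t \<in> A" for t
      proof (rule ccontr)
        assume "cylinder n s \<inter> cylinder n t \<noteq> {}"
        then obtain b where "b \<in> cylinder n s" "b \<in> cylinder n t" by blast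
        hence "cylinder n s = cylinder n t" using cylinder_eq by metis
        hence "s \<in> cylinder n t" using cylinder_self by metis
        hence "s = t" using insert.prems that by (intro residue_rep_unique[of s n t]) auto
        thus False using insert.hyps that by simp
      qed
      thus ?thesis using inj_lattice_point[OF w] by (subst image_Int[symmetric]) auto
    qed
    moreover have "lattice_point w ` cylinder n s \<in> compact_opens w" using mem[of "{s}"] by simp
    ultimately show ?case using add mem[of A] insert by (simp add: image_Un)
  qed
  from this[of "residue_reps n \<inter> V"] show ?thesis
    using clopen_eq_Union_cylinders[of V n, OF V] by simp
qed

context padic_coefficient_ring
begin

text \<open>
  The indicator function of a cylinder is modulo \<open>p\<^sup>j\<close> a finite integral combination of products
  of binomial coefficients, whose integrals are the coefficients of the transform.
\<close>

lemma cylinder_measure_mod_prime_power: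
  fixes w :: "'n :: finite \<Rightarrow> 'f :: field_char_0" and a :: "'n \<Rightarrow> 'p padic_int"
  assumes w: "rat_basis w"
  obtains P C where "\<And>\<mu>. is_padic_measure w R \<mu> \<Longrightarrow> has_amice_transform w R \<mu> f \<Longrightarrow>
    pcong j (\<mu> (lattice_point w ` cylinder n\<^sub>0 a)) (\<Sum>m\<in>P. C m * f m)"
proof -
  let ?B = "\<lambda>(z :: 'n \<Rightarrow> 'p padic_int) m. \<Prod>i\<in>UNIV. emb (z i) gchoose m i"
  define Q where "Q i M c \<longleftrightarrow> (\<forall>z. \<exists>s. (if of_nat CARD('p) ^ n\<^sub>0 dvd z - a i then 1 else 0)
      - (\<Sum>m<M. of_int (c m) * (emb z gchoose m)) = of_nat CARD('p) ^ j * emb s)" for i M c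
  have "\<exists>M c. Q i M c" for i
    unfolding Q_def by (rule mahler_indicator[of n\<^sub>0 "a i" j]) blast
  then obtain M c where Mc: "\<And>i. Q i (M i) (c i)" by metis
  \<comment> \<open>P and C come from the Mahler expansions of the indicator alone. They are fixed
    before any measure is chosen, so one combination of coefficients of f approximates every measure
    with transform f.\<close>
  define P where "P = PiE UNIV (\<lambda>i. {..<M i})"
  define C where "C m = (\<Prod>i\<in>UNIV. of_int (c i (m i)) :: 'p padic alg_closure)" for m
  have finP: "finite P" unfolding P_def by (intro finite_PiE) auto
  have CR: "C m \<in> R" for m unfolding C_def by (intro prod_mem of_int_mem)
  have BR: "?B z m \<in> R" for z m by (intro prod_mem gbinomial_mem)
  have ind: "pcong j (if z \<in> cylinder n\<^sub>0 a then 1 else 0) (\<Sum>m\<in>P. C m * ?B z m)" for z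
  proof -
    have "pcong j (\<Prod>i\<in>UNIV. if of_nat CARD('p) ^ n\<^sub>0 dvd z i - a i then 1 else 0)
        (\<Prod>i\<in>UNIV. \<Sum>m<M i. of_int (c i m) * (emb (z i) gchoose m))"
    proof (rule pcong_prod)
      fix i
      show "pcong j (if of_nat CARD('p) ^ n\<^sub>0 dvd z i - a i then 1 else 0)
        (\<Sum>m<M i. of_int (c i m) * (emb (z i) gchoose m))"
        using Mc[of i] emb_mem unfolding Q_def pcong_def by blast
    qed (auto intro!: sum_mem mult_mem of_int_mem gbinomial_mem zero_mem one_mem)
    also have "(\<Prod>i\<in>UNIV. if of_nat CARD('p) ^ n\<^sub>0 dvd z i - a i then 1 else 0)
        = (if z \<in> cylinder n\<^sub>0 a then 1 else 0 :: 'p padic alg_closure)"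
      by (auto simp: in_cylinder_iff_dvd)
    also have "(\<Prod>i\<in>UNIV. \<Sum>m<M i. of_int (c i m) * (emb (z i) gchoose m)) = (\<Sum>m\<in>P. C m * ?B z m)"
      unfolding P_def C_def by (subst prod_sum_PiE) (auto simp: prod.distrib)
    finally show ?thesis .
  qed
  show ?thesis
  proof (rule that)
    fix \<mu> assume \<mu>: "is_padic_measure w R \<mu>" and f: "has_amice_transform w R \<mu> f"
    let ?D = "\<lambda>n s. \<mu> (lattice_point w ` cylinder n s)"
    have DR: "?D n s \<in> R" for n s
    proof -
      have "lattice_point w ` cylinder n s \<in> compact_opens w"
        unfolding compact_opens_iff[OF w] by (intro exI[of _ n] exI[of _ "cylinder n s"]) (auto dest: cylinder_eq)
      thus ?thesis using \<mu> by (auto simp: is_padic_measure_def PiE_iff)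
    qed
    define Q where "Q m k \<longleftrightarrow> (\<forall>n\<ge>k. \<forall>c. (\<forall>C \<in> lattice_coset w n ` padic_lattice w. c C \<in> C) \<longrightarrow>
        pcong j (\<Sum>C \<in> lattice_coset w n ` padic_lattice w. sep_prod (t_power w (c C)) m * \<mu> C) (f m))" for m k
    have "\<exists>k. Q m k" for m
      using f unfolding has_amice_transform_def has_padic_integral_def pcong_def Q_def by blast
    then obtain k where k: "\<And>m. Q m (k m)" by metis
    \<comment> \<open>Fine enough to refine cylinders of level \<open>n\<^sub>0\<close>, and past
      the convergence threshold of each of the finitely many coefficients involved.\<close>
    define n where "n = n\<^sub>0 + (\<Sum>m\<in>P. k m)"
    define c where "c C = (SOME \<alpha>. \<alpha> \<in> C)" for C :: "('f, 'p padic) rat_tensor set"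
    have c: "c (lattice_point w ` cylinder n s) \<in> lattice_point w ` cylinder n s" for s
      unfolding c_def by (rule someI[of _ "lattice_point w s"]) simp
    hence "\<exists>t. t \<in> cylinder n s \<and> c (lattice_point w ` cylinder n s) = lattice_point w t" for s by blast
    then obtain t where t: "\<And>s. t s \<in> cylinder n s" "\<And>s. c (lattice_point w ` cylinder n s) = lattice_point w (t s)"
      by metis
    have int: "pcong j (\<Sum>s\<in>residue_reps n. ?B (t s) m * ?D n s) (f m)" if m: "m \<in> P" for m
    proof -
      have "k m \<le> n" using member_le_sum[OF m _ finP, of k] by (simp add: n_def)
      moreover have "\<forall>C \<in> lattice_coset w n ` padic_lattice w. c C \<in> C"
        using c by (auto simp: padic_lattice_eq lattice_coset_lattice_point)
      ultimately have "pcong j (\<Sum>C \<in> lattice_coset w n ` padic_lattice w. sep_prod (t_power w (c C)) m * \<mu> C) (f m)"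
        using k[of m] unfolding Q_def by blast
      also have "(\<Sum>C \<in> lattice_coset w n ` padic_lattice w. sep_prod (t_power w (c C)) m * \<mu> C)
          = (\<Sum>s\<in>residue_reps n. ?B (t s) m * ?D n s)"
        by (subst sum.reindex_bij_betw[OF bij_betw_lattice_cosets[OF w], symmetric])
           (simp add: t(2) sep_prod_t_power_lattice_point[OF w])
      finally show ?thesis .
    qed
    have "?D n\<^sub>0 a = (\<Sum>s\<in>residue_reps n \<inter> cylinder n\<^sub>0 a. ?D n s)"
    proof (rule measure_eq_sum_cylinders[OF w \<mu>])
      fix b assume "b \<in> cylinder n\<^sub>0 a"
      thus "cylinder n b \<subseteq> cylinder n\<^sub>0 a"
        using cylinder_mono[of n\<^sub>0 n b] cylinder_eq[of b n\<^sub>0 a] by (simp add: n_def)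
    qed
    also have "\<dots> = (\<Sum>s\<in>residue_reps n. (if t s \<in> cylinder n\<^sub>0 a then 1 else 0) * ?D n s)"
    proof -
      have "t s \<in> cylinder n\<^sub>0 a \<longleftrightarrow> s \<in> cylinder n\<^sub>0 a" for s
      proof -
        have "t s \<in> cylinder n\<^sub>0 s" using t(1)[of s] cylinder_mono[of n\<^sub>0 n s] by (auto simp: n_def)
        thus ?thesis by (simp add: cylinder_def)
      qed
      thus ?thesis unfolding sum.inter_restrict[OF finite_residue_reps] by (intro sum.cong) auto
    qed
    also have "pcong j \<dots> (\<Sum>s\<in>residue_reps n. (\<Sum>m\<in>P. C m * ?B (t s) m) * ?D n s)"
      by (intro pcong_sum pcong_mult ind DR sum_mem mult_mem CR BR pcong_refl)
    also have "(\<Sum>s\<in>residue_reps n. (\<Sum>m\<in>P. C m * ?B (t s) m) * ?D n s)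
        = (\<Sum>m\<in>P. C m * (\<Sum>s\<in>residue_reps n. ?B (t s) m * ?D n s))"
      unfolding sum_distrib_left sum_distrib_right by (subst sum.swap) (simp add: mult.assoc)
    also have "pcong j \<dots> (\<Sum>m\<in>P. C m * f m)"
      by (intro pcong_sum pcong_mult_left int CR)
    finally show "pcong j (?D n\<^sub>0 a) (\<Sum>m\<in>P. C m * f m)" .
  qed
qed

text \<open>Cylinders get the same measure modulo every p^j, hence the same measure; the other
  compact open sets are finite unions of cylinders, and elsewhere both functions are
  \<open>undefined\<close>.\<close>

lemma padic_measure_unique:
  fixes w :: "'n :: finite \<Rightarrow> 'f :: field_char_0"
  assumes w: "rat_basis w"
    and \<mu>: "is_padic_measure w R \<mu>" "has_amice_transform w R \<mu> f"
    and \<nu>: "is_padic_measure w R \<nu>" "has_amice_transform w R \<nu> f"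
  shows "\<mu> = \<nu>"
proof
  have cyl: "\<mu> (lattice_point w ` cylinder n a) = \<nu> (lattice_point w ` cylinder n a)" for n a
  proof (rule pcong_all_imp_eq)
    fix j
    obtain P C where "\<And>\<mu>. is_padic_measure w R \<mu> \<Longrightarrow> has_amice_transform w R \<mu> f \<Longrightarrow>
        pcong j (\<mu> (lattice_point w ` cylinder n a)) (\<Sum>m\<in>P. C m * f m)"
      using cylinder_measure_mod_prime_power[OF w] by blast
    thus "pcong j (\<mu> (lattice_point w ` cylinder n a)) (\<nu> (lattice_point w ` cylinder n a))"
      using \<mu> \<nu> pcong_sym pcong_trans by meson
  qed
  fix U
  show "\<mu> U = \<nu> U"
  proof (cases "U \<in> compact_opens w")
    case True
    then obtain n V where V: "U = lattice_point w ` V" "\<And>a. a \<in> V \<Longrightarrow> cylinder n a \<subseteq> V"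
      unfolding compact_opens_iff[OF w] by blast
    show ?thesis
      using measure_eq_sum_cylinders[OF w \<mu>(1), of V n] measure_eq_sum_cylinders[OF w \<nu>(1), of V n] V cyl
      by simp
  next
    case False
    thus ?thesis using \<mu>(1) \<nu>(1) by (auto simp: is_padic_measure_def PiE_def extensional_def)
  qed
qed

end

section \<open>Measures from distributions on cylinders\<close>

definition clopen_at :: "nat \<Rightarrow> ('n \<Rightarrow> 'p :: prime_type padic_int) set \<Rightarrow> bool" where
  "clopen_at n V \<longleftrightarrow> (\<forall>a\<in>V. cylinder n a \<subseteq> V)"

lemma clopen_at_mono: "clopen_at m V \<Longrightarrow> m \<le> n \<Longrightarrow> clopen_at n V"
  unfolding clopen_at_def using cylinder_mono by blast

lemma clopen_at_cylinder: "clopen_at n (cylinder n a)"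
  by (auto simp: clopen_at_def dest: cylinder_eq)

lemma residue_reps_Int_cylinder:
  obtains s where "residue_reps n \<inter> cylinder n a = {s}" "s \<in> cylinder n a"
proof -
  obtain s where s: "s \<in> residue_reps n" "s \<in> cylinder n a" by (rule residue_rep_exists)
  have "t = s" if "t \<in> residue_reps n" "t \<in> cylinder n a" for t
    using that s cylinder_eq[OF s(2)] by (intro residue_rep_unique) auto
  hence "residue_reps n \<inter> cylinder n a = {s}" using s by blast
  thus ?thesis using s(2) by (rule that)
qed

text \<open>Masses of cylinders that are compatible under refinement. Compatibility starts at level
  r, since the masses constructed below involve p^(n-r) with truncated subtraction.\<close>

locale cylinder_distribution = padic_coefficient_ring R for R :: "'p :: prime_type padic alg_closure set" +
  fixes g :: "nat \<Rightarrow> ('n :: finite \<Rightarrow> 'p padic_int) \<Rightarrow> 'p padic alg_closure" and r :: nat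
  assumes g_mem: "g n a \<in> R"
    and g_cong: "b \<in> cylinder n a \<Longrightarrow> g n b = g n a"
    and g_additive: "r \<le> n \<Longrightarrow> g n a = (\<Sum>s\<in>residue_reps (Suc n) \<inter> cylinder n a. g (Suc n) s)"
begin

definition total :: "nat \<Rightarrow> ('n \<Rightarrow> 'p padic_int) set \<Rightarrow> 'p padic alg_closure" where
  "total n V = (\<Sum>s\<in>residue_reps n \<inter> V. g n s)"

lemma total_Suc:
  assumes "r \<le> n" "clopen_at n V"
  shows "total (Suc n) V = total n V"
proof -
  have eq: "residue_reps (Suc n) \<inter> V = (\<Union>s\<in>residue_reps n \<inter> V. residue_reps (Suc n) \<inter> cylinder n s)"
    using clopen_eq_Union_cylinders[of V n] assms(2) unfolding clopen_at_def by blast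
  have "total n V = (\<Sum>s\<in>residue_reps n \<inter> V. \<Sum>t\<in>residue_reps (Suc n) \<inter> cylinder n s. g (Suc n) t)"
    unfolding total_def by (intro sum.cong refl g_additive assms(1))
  also have "\<dots> = total (Suc n) V"
    unfolding total_def eq
  proof (rule sum.UNION_disjoint[symmetric], goal_cases)
    case 3
    show ?case
    proof (intro ballI impI)
      fix s t assume st: "s \<in> residue_reps n \<inter> V" "t \<in> residue_reps n \<inter> V" "s \<noteq> t"
      have "cylinder n s \<inter> cylinder n t = {}"
      proof (rule ccontr)
        assume "cylinder n s \<inter> cylinder n t \<noteq> {}"
        then obtain b where "b \<in> cylinder n s" "b \<in> cylinder n t" by blast
        hence "cylinder n s = cylinder n t" using cylinder_eq by metis
        hence "s \<in> cylinder n t" using cylinder_self by metis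
        thus False using residue_rep_unique[of s n t] st by blast
      qed
      thus "(residue_reps (Suc n) \<inter> cylinder n s) \<inter> (residue_reps (Suc n) \<inter> cylinder n t) = {}" by blast
    qed
  qed auto
  finally show ?thesis ..
qed

lemma total_mono:
  assumes "r \<le> n" "clopen_at n V" "n \<le> m"
  shows "total m V = total n V"
  using assms(3)
proof (induction m rule: dec_induct)
  case (step m)
  thus ?case using assms total_Suc[of m V] clopen_at_mono[of n V m] by simp
qed simp

text \<open>Taking the least level at which V is a union of cylinders makes the value depend on the
  set alone; raising it to r reaches the range where refinement preserves \<open>total\<close>. The
  restriction to \<open>compact_opens w\<close> gives the value \<open>undefined\<close> elsewhere,
  as \<open>is_padic_measure\<close> demands.\<close>

definition extension :: "('n \<Rightarrow> 'f :: field_char_0) \<Rightarrow> ('f, 'p padic) rat_tensor set \<Rightarrow> 'p padic alg_closure" where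
  "extension w = (\<lambda>U\<in>compact_opens w. let V = {a. lattice_point w a \<in> U} in total (max r (LEAST n. clopen_at n V)) V)"

lemma extension_eq_total:
  assumes w: "rat_basis w" and n: "r \<le> n" and V: "clopen_at n V"
  shows "extension w (lattice_point w ` V) = total n V"
proof -
  have V': "{a. lattice_point w a \<in> lattice_point w ` V} = V"
    using inj_lattice_point[OF w] by (auto dest: injD)
  have "lattice_point w ` V \<in> compact_opens w"
    using V unfolding compact_opens_iff[OF w] clopen_at_def by blast
  moreover have "clopen_at (LEAST n. clopen_at n V) V" using V by (rule LeastI)
  moreover have "(LEAST n. clopen_at n V) \<le> n" using V by (rule Least_le)
  ultimately show ?thesis
    using n total_mono[of "max r (LEAST n. clopen_at n V)" V n] clopen_at_mono[of _ V "max r (LEAST n. clopen_at n V)"]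
    by (simp add: extension_def V' Let_def)
qed

lemma extension_cylinder:
  assumes w: "rat_basis w" and n: "r \<le> n"
  shows "extension w (lattice_point w ` cylinder n a) = g n a"
proof -
  obtain s where "residue_reps n \<inter> cylinder n a = {s}" "s \<in> cylinder n a"
    by (rule residue_reps_Int_cylinder)
  thus ?thesis using extension_eq_total[OF w n clopen_at_cylinder, of a] g_cong by (simp add: total_def)
qed

lemma is_padic_measure_extension:
  fixes w :: "'n \<Rightarrow> 'f :: field_char_0"
  assumes w: "rat_basis w"
  shows "is_padic_measure w R (extension w)"
  unfolding is_padic_measure_def
proof (intro conjI ballI impI)
  show "extension w \<in> compact_opens w \<rightarrow>\<^sub>E R"
    by (auto simp: extension_def Let_def total_def intro!: sum_mem g_mem)
  fix U W :: "('f, 'p padic) rat_tensor set"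
  assume "U \<in> compact_opens w" "W \<in> compact_opens w" and disj: "U \<inter> W = {}"
  then obtain n V m V' where V: "U = lattice_point w ` V" "clopen_at n V"
    and V': "W = lattice_point w ` V'" "clopen_at m V'"
    unfolding compact_opens_iff[OF w] clopen_at_def by metis
  define k where "k = max r (max n m)"
  have k: "clopen_at k V" "clopen_at k V'" "r \<le> k"
    using clopen_at_mono[OF V(2), of k] clopen_at_mono[OF V'(2), of k] by (auto simp: k_def)
  hence "clopen_at k (V \<union> V')" by (auto simp: clopen_at_def)
  moreover have "V \<inter> V' = {}" using disj V(1) V'(1) by blast
  hence "total k (V \<union> V') = total k V + total k V'"
    unfolding total_def by (subst sum.union_disjoint[symmetric]) (auto simp: Int_Un_distrib)
  ultimately show "extension w (U \<union> W) = extension w U + extension w W"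
    using extension_eq_total[OF w k(3)] k by (simp add: V(1) V'(1) flip: image_Un)
qed

text \<open>Since binomial coefficients are continuous, the sample points may be taken among the representatives.\<close>

lemma has_amice_transform_extension:
  assumes w: "rat_basis w"
    and lim: "\<And>m j. \<exists>n\<^sub>0. \<forall>n\<ge>n\<^sub>0. pcong j (\<Sum>s\<in>residue_reps n. (\<Prod>i\<in>UNIV. emb (s i) gchoose m i) * g n s) (f m)"
  shows "has_amice_transform w R (extension w) f"
  unfolding has_amice_transform_def has_padic_integral_def
proof (intro allI)
  fix m :: "'n \<Rightarrow> nat" and j
  let ?B = "\<lambda>(z :: 'n \<Rightarrow> 'p padic_int). \<Prod>i\<in>UNIV. emb (z i) gchoose m i"
  obtain n1 where n1: "\<And>n. n \<ge> n1 \<Longrightarrow> pcong j (\<Sum>s\<in>residue_reps n. ?B s * g n s) (f m)"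
    using lim by blast
  obtain n2 where n2: "\<And>n a b. n \<ge> n2 \<Longrightarrow> b \<in> cylinder n a \<Longrightarrow> pcong j (?B b) (?B a)"
    by (rule gbinomial_prod_continuous[of j m]) blast
  \<comment> \<open>The bound has three parts: r for the masses of cylinders to be given by
    \<open>g\<close>, \<open>n1\<close> for the limit over the representatives, \<open>n2\<close>
    for moving the sample points to them.\<close>
  have "pcong j (\<Sum>C\<in>lattice_coset w n ` padic_lattice w. sep_prod (t_power w (c C)) m * extension w C) (f m)"
    if n: "n \<ge> r + n1 + n2" and c: "\<forall>C\<in>lattice_coset w n ` padic_lattice w. c C \<in> C" for n c
  proof -
    have "c (lattice_point w ` cylinder n s) \<in> lattice_point w ` cylinder n s" for s
      using c by (auto simp: padic_lattice_eq lattice_coset_lattice_point)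
    hence "\<exists>t. t \<in> cylinder n s \<and> c (lattice_point w ` cylinder n s) = lattice_point w t" for s by blast
    then obtain t where t: "\<And>s. t s \<in> cylinder n s" "\<And>s. c (lattice_point w ` cylinder n s) = lattice_point w (t s)"
      by metis
    have "(\<Sum>C\<in>lattice_coset w n ` padic_lattice w. sep_prod (t_power w (c C)) m * extension w C)
        = (\<Sum>s\<in>residue_reps n. ?B (t s) * g n s)"
      using n by (subst sum.reindex_bij_betw[OF bij_betw_lattice_cosets[OF w], symmetric])
        (simp add: t(2) sep_prod_t_power_lattice_point[OF w] extension_cylinder[OF w])
    also have "pcong j (?B (t s)) (?B s)" for s using n2[of n "t s" s] n t(1) by simp
    hence "pcong j (\<Sum>s\<in>residue_reps n. ?B (t s) * g n s) (\<Sum>s\<in>residue_reps n. ?B s * g n s)"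
      by (intro pcong_sum pcong_mult pcong_refl g_mem prod_mem gbinomial_mem)
    also have "pcong j \<dots> (f m)" using n by (intro n1) auto
    finally show ?thesis .
  qed
  thus "\<exists>n\<^sub>0. \<forall>n\<ge>n\<^sub>0. \<forall>c. (\<forall>C\<in>lattice_coset w n ` padic_lattice w. c C \<in> C) \<longrightarrow>
      (\<exists>s\<in>R. (\<Sum>C\<in>lattice_coset w n ` padic_lattice w. sep_prod (t_power w (c C)) m * extension w C) - f m
        = of_nat CARD('p) ^ j * s)"
    unfolding pcong_def by blast
qed

text \<open>Evaluates the definite description: \<open>extension w\<close> has the required
  properties, and any other candidate equals it.\<close>

lemma measure_of_series_eq_extension:
  assumes "rat_basis w"
    and "\<And>m j. \<exists>n\<^sub>0. \<forall>n\<ge>n\<^sub>0. pcong j (\<Sum>s\<in>residue_reps n. (\<Prod>i\<in>UNIV. emb (s i) gchoose m i) * g n s) (f m)"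
  shows "measure_of_series w R f = extension w"
  unfolding measure_of_series_def
  using is_padic_measure_extension[OF assms(1)] has_amice_transform_extension[OF assms] padic_measure_unique[OF assms(1)]
  by (intro the_equality) auto

end

section \<open>The measure of a rational function\<close>

definition padic_residue :: "nat \<Rightarrow> 'p :: prime_type padic_int \<Rightarrow> 'p padic_int" where
  "padic_residue n z = of_nat (nat (Rep_padic_int z n))"

lemma Rep_padic_residue [simp]: "Rep_padic_int (padic_residue n z) n = Rep_padic_int z n"
  by (simp only: padic_residue_def of_nat_padic_int nat_0_le[OF Rep_padic_int_range(1)] Rep_padic_int_mod)

text \<open>Each class modulo p^n has exactly one representative below p^n, so a single term
  survives.\<close>

lemma sum_single_residue:
  fixes h :: "'p :: prime_type padic_int \<Rightarrow> 'a :: comm_monoid_add"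
  shows "(\<Sum>t\<in>of_nat ` {..<CARD('p) ^ n}. if of_nat CARD('p) ^ n dvd t - y then h t else 0)
    = h (padic_residue n y)"
proof -
  have mem: "padic_residue n y \<in> of_nat ` {..<CARD('p) ^ n}"
  proof -
    have "int (nat (Rep_padic_int y n)) < int (CARD('p) ^ n)"
      using Rep_padic_int_range[of y n] by simp
    thus ?thesis unfolding padic_residue_def by (intro imageI) (simp only: of_nat_less_iff lessThan_iff)
  qed
  have "of_nat CARD('p) ^ n dvd t - y \<longleftrightarrow> t = padic_residue n y" if "t \<in> of_nat ` {..<CARD('p) ^ n}" for t
  proof -
    obtain k where k: "t = of_nat k" "k < CARD('p) ^ n" using \<open>t \<in> _\<close> by blast
    have "int k < int CARD('p) ^ n" using k(2) by (metis of_nat_less_iff of_nat_power)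
    hence rep: "Rep_padic_int t n = int k" by (simp add: k of_nat_padic_int)
    show ?thesis
      unfolding padic_power_dvd_diff_iff rep
    proof
      assume "int k = Rep_padic_int y n"
      thus "t = padic_residue n y" by (simp add: padic_residue_def k flip: \<open>int k = _\<close>)
    next
      assume "t = padic_residue n y"
      thus "int k = Rep_padic_int y n" using rep by simp
    qed
  qed
  hence "(\<Sum>t\<in>of_nat ` {..<CARD('p) ^ n}. if of_nat CARD('p) ^ n dvd t - y then h t else 0)
      = (\<Sum>t\<in>of_nat ` {..<CARD('p) ^ n}. if t = padic_residue n y then h t else 0)"
    by (intro sum.cong) auto
  also have "\<dots> = h (padic_residue n y)" using mem by simp
  finally show ?thesis .
qed

text \<open>
  The measure of \<open>z + p\<^sup>n\<int>\<^sub>p\<close> for the transform \<open>t\<^sup>x / (1 - \<zeta> t ^ p ^ r)\<close>; the formula comes from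
  \<open>1 / (1 - Y) = (\<Sum>l < P. Y ^ l) / (1 - Y ^ P)\<close> with \<open>Y = \<zeta> t ^ p ^ r\<close> and \<open>P = p ^ (n - r)\<close>.
\<close>

definition geom_dist ::
  "'a :: field \<Rightarrow> 'p :: prime_type padic_int \<Rightarrow> nat \<Rightarrow> nat \<Rightarrow> 'p padic_int \<Rightarrow> 'a" where
  "geom_dist \<zeta> x r n z =
     (\<Sum>l<CARD('p) ^ (n - r). if of_nat CARD('p) ^ n dvd z - (x + of_nat CARD('p) ^ r * of_nat l) then \<zeta> ^ l else 0)
       / (1 - \<zeta> ^ CARD('p) ^ (n - r))"

lemma geom_dist_cong: "Rep_padic_int z n = Rep_padic_int z' n \<Longrightarrow> geom_dist \<zeta> x r n z = geom_dist \<zeta> x r n z'"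
  by (simp add: geom_dist_def padic_power_dvd_diff_iff)

text \<open>Write an exponent below p P as j P + l, where P = p^(n-r). Since p^r P = p^n, the
  congruence modulo p^n depends on l alone, and the geometric sum over j turns the denominator 1 -
  zeta^(p P) into 1 - zeta^P.\<close>

lemma geom_dist_additive:
  fixes x z :: "'p :: prime_type padic_int" and \<zeta> :: "'a :: field"
  assumes "r \<le> n" and \<zeta>: "\<zeta> ^ CARD('p) ^ (n - r) \<noteq> 1" "\<zeta> ^ CARD('p) ^ (Suc n - r) \<noteq> 1"
  shows "(\<Sum>t\<in>{t \<in> of_nat ` {..<CARD('p) ^ Suc n}. Rep_padic_int t n = Rep_padic_int z n}. geom_dist \<zeta> x r (Suc n) t)
    = geom_dist \<zeta> x r n z"
proof -
  let ?p = "of_nat CARD('p) :: 'p padic_int" and ?P = "CARD('p) ^ (n - r)"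
  define y where "y l = x + ?p ^ r * of_nat l" for l
  define \<delta> where "\<delta> l = (if ?p ^ n dvd z - y l then 1 else 0 :: 'a)" for l
  have P: "CARD('p) ^ (Suc n - r) = CARD('p) * ?P" using assms(1) by (simp add: Suc_diff_le)
  have inner: "(\<Sum>t\<in>{t \<in> of_nat ` {..<CARD('p) ^ Suc n}. Rep_padic_int t n = Rep_padic_int z n}.
      if ?p ^ Suc n dvd t - y l then \<zeta> ^ l else 0) = \<delta> l * \<zeta> ^ l" for l
  proof -
    have "(\<Sum>t\<in>{t \<in> of_nat ` {..<CARD('p) ^ Suc n}. Rep_padic_int t n = Rep_padic_int z n}.
        if ?p ^ Suc n dvd t - y l then \<zeta> ^ l else 0)
      = (\<Sum>t\<in>of_nat ` {..<CARD('p) ^ Suc n}. if ?p ^ Suc n dvd t - y l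
          then (if Rep_padic_int t n = Rep_padic_int z n then \<zeta> ^ l else 0) else 0)"
      by (subst sum.inter_filter) (auto intro!: sum.cong)
    also have "\<dots> = (if Rep_padic_int (padic_residue (Suc n) (y l)) n = Rep_padic_int z n then \<zeta> ^ l else 0)"
      by (rule sum_single_residue)
    also have "Rep_padic_int (padic_residue (Suc n) (y l)) n = Rep_padic_int (y l) n"
      using Rep_padic_int_coherent[of n "Suc n" "padic_residue (Suc n) (y l)"]
        Rep_padic_int_coherent[of n "Suc n" "y l"] by simp
    also have "(if Rep_padic_int (y l) n = Rep_padic_int z n then \<zeta> ^ l else 0) = \<delta> l * \<zeta> ^ l"
      by (auto simp: \<delta>_def padic_power_dvd_diff_iff)
    finally show ?thesis .
  qed
  have \<delta>: "\<delta> (j * ?P + l) = \<delta> l" for j l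
  proof -
    have "?p ^ r * of_nat (j * ?P + l) = ?p ^ n * of_nat j + ?p ^ r * of_nat l"
      using assms(1) by (simp add: algebra_simps flip: power_add)
    hence "z - y l = (z - y (j * ?P + l)) + ?p ^ n * of_nat j" by (simp add: y_def)
    hence "?p ^ n dvd z - y l \<longleftrightarrow> ?p ^ n dvd z - y (j * ?P + l)" by (metis dvd_add_left_iff dvd_triv_left)
    thus ?thesis by (simp add: \<delta>_def)
  qed
  have "(\<Sum>l<CARD('p) * ?P. \<delta> l * \<zeta> ^ l) = (\<Sum>j<CARD('p). \<Sum>l\<in>{j * ?P..<j * ?P + ?P}. \<delta> l * \<zeta> ^ l)"
    by (rule sum.nat_group[symmetric])
  also have "\<dots> = (\<Sum>j<CARD('p). \<Sum>l<?P. \<delta> (j * ?P + l) * \<zeta> ^ (j * ?P + l))"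
    by (subst sum.atLeastLessThan_shift_0) (simp add: lessThan_atLeast0)
  also have "\<dots> = (\<Sum>j<CARD('p). (\<zeta> ^ ?P) ^ j) * (\<Sum>l<?P. \<delta> l * \<zeta> ^ l)"
    by (simp only: \<delta> sum_product) (simp add: power_add power_mult[symmetric] mult_ac)
  also have "(\<Sum>j<CARD('p). (\<zeta> ^ ?P) ^ j) = (1 - \<zeta> ^ (CARD('p) * ?P)) / (1 - \<zeta> ^ ?P)"
    using \<zeta>(1) by (subst sum_gp_strict) (auto simp: mult.commute simp flip: power_mult)
  finally have sum: "(\<Sum>l<CARD('p) * ?P. \<delta> l * \<zeta> ^ l)
    = (1 - \<zeta> ^ (CARD('p) * ?P)) / (1 - \<zeta> ^ ?P) * (\<Sum>l<?P. \<delta> l * \<zeta> ^ l)" .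
  have "(\<Sum>t\<in>{t \<in> of_nat ` {..<CARD('p) ^ Suc n}. Rep_padic_int t n = Rep_padic_int z n}. geom_dist \<zeta> x r (Suc n) t)
    = (\<Sum>l<CARD('p) * ?P. \<delta> l * \<zeta> ^ l) / (1 - \<zeta> ^ (CARD('p) * ?P))"
    unfolding geom_dist_def sum_divide_distrib[symmetric] P y_def[symmetric]
    by (subst sum.swap) (simp only: inner)
  also have "\<dots> = (\<Sum>l<?P. \<delta> l * \<zeta> ^ l) / (1 - \<zeta> ^ ?P)"
    unfolding sum using \<zeta> by (simp add: P)
  also have "\<dots> = geom_dist \<zeta> x r n z"
    unfolding geom_dist_def y_def[symmetric] by (intro arg_cong2[of _ _ _ _ "(/)"] sum.cong refl) (simp add: \<delta>_def)
  finally show ?thesis .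
qed

text \<open>The points x + p^r l with l < p^(n-r) are distinct modulo p^n, so the class of z
  contains just one of them.\<close>

lemma geom_dist_at:
  fixes x z :: "'p :: prime_type padic_int"
  assumes "r \<le> n" "l < CARD('p) ^ (n - r)" "of_nat CARD('p) ^ n dvd z - (x + of_nat CARD('p) ^ r * of_nat l)"
  shows "geom_dist \<zeta> x r n z = \<zeta> ^ l / (1 - \<zeta> ^ CARD('p) ^ (n - r))"
proof -
  let ?p = "of_nat CARD('p) :: 'p padic_int"
  have "?p ^ n dvd z - (x + ?p ^ r * of_nat k) \<longleftrightarrow> k = l" if k: "k < CARD('p) ^ (n - r)" for k
  proof
    assume "?p ^ n dvd z - (x + ?p ^ r * of_nat k)"
    hence "?p ^ n dvd (z - (x + ?p ^ r * of_nat k)) - (z - (x + ?p ^ r * of_nat l))"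
      using assms(3) by (rule dvd_diff)
    also have "(z - (x + ?p ^ r * of_nat k)) - (z - (x + ?p ^ r * of_nat l)) = ?p ^ r * of_int (int l - int k)"
      by (simp add: algebra_simps)
    also have "?p ^ n = ?p ^ r * ?p ^ (n - r)" using assms(1) by (simp flip: power_add)
    finally have "?p ^ (n - r) dvd of_int (int l - int k)" by (subst (asm) dvd_mult_cancel_left) simp
    hence "int CARD('p) ^ (n - r) dvd int l - int k" by (simp only: padic_power_dvd_int_iff)
    hence "int l mod int CARD('p) ^ (n - r) = int k mod int CARD('p) ^ (n - r)"
      by (simp add: mod_eq_dvd_iff)
    moreover have "int l < int CARD('p) ^ (n - r)" "int k < int CARD('p) ^ (n - r)"
      using k assms(2) by (metis of_nat_less_iff of_nat_power)+
    ultimately show "k = l" by simp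
  qed (use assms(3) in simp)
  hence "(\<Sum>k<CARD('p) ^ (n - r). if ?p ^ n dvd z - (x + ?p ^ r * of_nat k) then \<zeta> ^ k else 0)
      = (\<Sum>k<CARD('p) ^ (n - r). if k = l then \<zeta> ^ k else 0)" by (intro sum.cong) auto
  also have "\<dots> = \<zeta> ^ l" using assms(2) by simp
  finally show ?thesis by (simp add: geom_dist_def)
qed

lemma geom_dist_eq_0:
  fixes x z :: "'p :: prime_type padic_int"
  assumes "\<And>l. l < CARD('p) ^ (n - r) \<Longrightarrow> \<not> of_nat CARD('p) ^ n dvd z - (x + of_nat CARD('p) ^ r * of_nat l)"
  shows "geom_dist \<zeta> x r n z = 0"
  using assms by (simp add: geom_dist_def)

context padic_coefficient_ring
begin

text \<open>Keeps everything in R: e = 0 concerns the constant coefficient 1 - zeta of the series to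
  be inverted, e = n - r the denominators of the masses at level n.\<close>

definition admissible :: "'p padic alg_closure \<Rightarrow> bool" where
  "admissible \<zeta> \<longleftrightarrow> \<zeta> \<in> R \<and> (\<forall>e. \<zeta> ^ CARD('p) ^ e \<noteq> 1 \<and> 1 / (1 - \<zeta> ^ CARD('p) ^ e) \<in> R)"

lemma geom_dist_mem: "admissible \<zeta> \<Longrightarrow> geom_dist \<zeta> (x :: 'p padic_int) r n z \<in> R"
  unfolding geom_dist_def divide_inverse admissible_def
  by (intro mult_mem sum_mem) (auto intro: power_mem zero_mem simp: inverse_eq_divide)

lemma fps_inverse_mem:
  fixes F :: "'p padic alg_closure fps"
  assumes F: "\<And>n. fps_nth F n \<in> R" and u: "inverse (fps_nth F 0) \<in> R"
  shows "fps_nth (inverse F) n \<in> R"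
proof (cases "fps_nth F 0 = 0")
  case False
  show ?thesis
  proof (induction n rule: less_induct)
    case (less n)
    show ?case
    proof (cases n)
      case 0
      thus ?thesis using u by simp
    next
      case (Suc k)
      have "fps_nth (inverse F) n = - inverse (fps_nth F 0) * (\<Sum>i=1..n. fps_nth F i * fps_nth (inverse F) (n - i))"
        using False Suc by (simp add: fps_inverse_def)
      moreover have "(\<Sum>i=1..n. fps_nth F i * fps_nth (inverse F) (n - i)) \<in> R"
        by (intro sum_mem mult_mem F less) auto
      ultimately show ?thesis using u by (simp add: mult_mem uminus_mem)
    qed
  qed
\<comment> \<open>A series without constant coefficient has inverse 0 by convention.\<close>
qed (simp add: fps_inverse_eq_0 zero_mem)

text \<open>Modulo p^j the Riemann sum is a coefficient of F (1 - Y^P) / (1 - zeta^P), where F is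
  the series in the claim. This differs from F by a multiple of t^(p^n) - 1, whose coefficients of
  index at most m are divisible by p^j once n is large.\<close>

lemma geom_dist_limit:
  assumes \<zeta>: "admissible \<zeta>"
  shows "\<exists>n\<^sub>0. \<forall>n\<ge>n\<^sub>0. pcong j (\<Sum>z\<in>of_nat ` {..<CARD('p) ^ n}. (emb z gchoose m) * geom_dist \<zeta> x r n z)
    (fps_nth (fps_binomial (emb x) * inverse (1 - fps_const \<zeta> * fps_binomial (of_nat (CARD('p) ^ r)))) m)"
proof -
  let ?p = "of_nat CARD('p) :: 'p padic_int"
  define Y where "Y = fps_const \<zeta> * fps_binomial (of_nat (CARD('p) ^ r))"
  define F where "F = fps_binomial (emb x) * inverse (1 - Y)"
  have \<zeta>R: "\<zeta> \<in> R" and \<zeta>1: "\<And>e. \<zeta> ^ CARD('p) ^ e \<noteq> 1" and inv: "\<And>e. 1 / (1 - \<zeta> ^ CARD('p) ^ e) \<in> R"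
    using \<zeta> by (auto simp: admissible_def)
  have nat_mem: "(of_nat k gchoose i) \<in> R" for k i
    using gbinomial_mem[of "of_nat k" i] by (simp only: emb.hom_of_nat)
  have Y_mem: "fps_nth Y i \<in> R" for i
    unfolding Y_def by (simp only: fps_mult_left_const_nth fps_binomial_nth) (intro mult_mem \<zeta>R nat_mem)
  have Y0: "fps_nth (1 - Y) 0 = 1 - \<zeta>" by (simp add: Y_def)
  have "fps_nth (inverse (1 - Y)) i \<in> R" for i
  proof (rule fps_inverse_mem)
    show "fps_nth (1 - Y) k \<in> R" for k
      by (simp only: fps_sub_nth) (intro diff_mem Y_mem, simp add: zero_mem one_mem)
    show "inverse (fps_nth (1 - Y) 0) \<in> R"
      using inv[of 0] unfolding Y0 by (simp add: inverse_eq_divide)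
  qed
  hence F_mem: "fps_nth F i \<in> R" for i
    unfolding F_def fps_mult_nth by (intro sum_mem mult_mem) (auto intro: gbinomial_mem)
  obtain n1 where n1: "\<And>z z' :: 'p padic_int. of_nat CARD('p) ^ n1 dvd z - z' \<Longrightarrow>
    \<exists>s. (emb z gchoose m) - (emb z' gchoose m) = of_nat CARD('p) ^ j * emb s"
    by (rule gbinomial_emb_continuous) blast
  have "\<exists>e. \<forall>z z' :: 'p padic_int. of_nat CARD('p) ^ e dvd z - z' \<longrightarrow>
    (\<exists>s. (emb z gchoose k) - (emb z' gchoose k) = of_nat CARD('p) ^ j * emb s)" for k
    by (rule gbinomial_emb_continuous[of k j]) blast
  then obtain e where e: "\<And>k z z' :: 'p padic_int. of_nat CARD('p) ^ e k dvd z - z' \<Longrightarrow>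
    (\<exists>s. (emb z gchoose k) - (emb z' gchoose k) = of_nat CARD('p) ^ j * emb s)"
    by metis
  \<comment> \<open>The m-th coefficient of a product involves only coefficients of index at most m,
    so finitely many moduli of continuity suffice.\<close>
  define n2 where "n2 = (\<Sum>k\<le>m. e k)"
  have "pcong j (\<Sum>z\<in>of_nat ` {..<CARD('p) ^ n}. (emb z gchoose m) * geom_dist \<zeta> x r n z) (fps_nth F m)"
    if n: "n \<ge> r + n1 + n2" for n
  proof -
    define P where "P = CARD('p) ^ (n - r)"
    define u where "u = 1 / (1 - \<zeta> ^ P)"
    have u: "u \<in> R" "u * (1 - \<zeta> ^ P) = 1" using inv[of "n - r"] \<zeta>1[of "n - r"] by (simp_all add: u_def P_def)
    define y where "y l = x + ?p ^ r * of_nat l" for l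
    have "(\<Sum>z\<in>of_nat ` {..<CARD('p) ^ n}. (emb z gchoose m) * geom_dist \<zeta> x r n z)
        = (\<Sum>z\<in>of_nat ` {..<CARD('p) ^ n}. \<Sum>l<P. if ?p ^ n dvd z - y l then (emb z gchoose m) * (\<zeta> ^ l * u) else 0)"
      unfolding geom_dist_def y_def[symmetric] P_def[symmetric] sum_divide_distrib sum_distrib_left u_def
      by (intro sum.cong) auto
    also have "\<dots> = (\<Sum>l<P. \<Sum>z\<in>of_nat ` {..<CARD('p) ^ n}. if ?p ^ n dvd z - y l then (emb z gchoose m) * (\<zeta> ^ l * u) else 0)"
      by (rule sum.swap)
    also have "\<dots> = (\<Sum>l<P. (emb (padic_residue n (y l)) gchoose m) * (\<zeta> ^ l * u))"
      by (simp only: sum_single_residue)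
    also have "pcong j \<dots> (\<Sum>l<P. (emb (y l) gchoose m) * (\<zeta> ^ l * u))"
    proof (intro pcong_sum pcong_mult pcong_refl mult_mem power_mem \<zeta>R u gbinomial_mem)
      fix l
      have "?p ^ n dvd padic_residue n (y l) - y l" by (simp add: padic_power_dvd_diff_iff)
      moreover have "n1 \<le> n" using n by simp
      ultimately have "?p ^ n1 dvd padic_residue n (y l) - y l" by (metis power_le_dvd)
      thus "pcong j (emb (padic_residue n (y l)) gchoose m) (emb (y l) gchoose m)"
        using n1 emb_mem unfolding pcong_def by blast
    qed
    also have "(\<Sum>l<P. (emb (y l) gchoose m) * (\<zeta> ^ l * u))
        = fps_nth (fps_const u * (fps_binomial (emb x) * (\<Sum>l<P. Y ^ l))) m"
    proof -
      have "fps_const (\<zeta> ^ l) * fps_binomial (emb (y l)) = fps_binomial (emb x) * Y ^ l" for l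
      proof -
        have "emb (y l) = emb x + of_nat l * of_nat (CARD('p) ^ r)"
          by (simp only: y_def emb.hom_add emb.hom_mult emb.hom_power emb.hom_of_nat of_nat_power mult.commute)
        thus ?thesis
          by (simp only: Y_def power_mult_distrib fps_const_power fps_binomial_power fps_binomial_add_mult mult_ac)
      qed
      hence "fps_const u * (fps_binomial (emb x) * (\<Sum>l<P. Y ^ l))
          = (\<Sum>l<P. fps_const (u * \<zeta> ^ l) * fps_binomial (emb (y l)))"
        by (simp only: sum_distrib_left fps_const_mult[symmetric] mult.assoc)
      thus ?thesis by (simp add: fps_sum_nth mult_ac)
    qed
    also have "fps_const u * (fps_binomial (emb x) * (\<Sum>l<P. Y ^ l))
        = F - fps_const (u * \<zeta> ^ P) * (F * (fps_binomial (of_nat (CARD('p) ^ n)) - 1))"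
    proof -
      have inv1: "inverse (1 - Y) * (1 - Y) = 1" using Y0 \<zeta>1[of 0] by (intro inverse_mult_eq_1) simp
      have "inverse (1 - Y) * (1 - Y ^ P) = inverse (1 - Y) * (1 - Y) * (\<Sum>l<P. Y ^ l)"
        by (simp only: one_diff_power_eq mult.assoc)
      hence sum: "(\<Sum>l<P. Y ^ l) = inverse (1 - Y) * (1 - Y ^ P)"
        by (simp only: inv1 mult_1_left)
      have "CARD('p) ^ n = P * CARD('p) ^ r" using n by (simp add: P_def flip: power_add)
      hence "Y ^ P = fps_const (\<zeta> ^ P) * fps_binomial (of_nat (CARD('p) ^ n))"
        by (simp only: Y_def power_mult_distrib fps_const_power fps_binomial_power of_nat_mult)
      \<comment> \<open>As u (1 - zeta^P) = 1, the left side is 1 at T = 1; being affine in T, it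
        deviates from 1 by a multiple of T - 1.\<close>
      moreover have "fps_const u * (1 - fps_const (\<zeta> ^ P) * T) = 1 - fps_const (u * \<zeta> ^ P) * (T - 1)" for T
      proof -
        have "fps_const u - fps_const (u * \<zeta> ^ P) = fps_const 1"
          using u(2) by (simp add: algebra_simps)
        thus ?thesis by (simp add: algebra_simps flip: fps_const_mult)
      qed
      ultimately have "fps_const u * (1 - Y ^ P) = 1 - fps_const (u * \<zeta> ^ P) * (fps_binomial (of_nat (CARD('p) ^ n)) - 1)"
        by simp
      moreover have "fps_const u * (fps_binomial (emb x) * (\<Sum>l<P. Y ^ l)) = F * (fps_const u * (1 - Y ^ P))"
        by (simp add: sum F_def mult_ac)
      ultimately have "fps_const u * (fps_binomial (emb x) * (\<Sum>l<P. Y ^ l))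
          = F * (1 - fps_const (u * \<zeta> ^ P) * (fps_binomial (of_nat (CARD('p) ^ n)) - 1))" by (simp only:)
      thus ?thesis by (simp only: right_diff_distrib[of F] mult_1_right mult.left_commute[of F])
    qed
    also have "fps_nth (F - fps_const (u * \<zeta> ^ P) * (F * (fps_binomial (of_nat (CARD('p) ^ n)) - 1))) m
        = fps_nth F m + (- (u * \<zeta> ^ P)) * (\<Sum>i=0..m. fps_nth F i * fps_nth (fps_binomial (of_nat (CARD('p) ^ n)) - 1) (m - i))"
      by (simp only: fps_sub_nth fps_mult_left_const_nth) (simp add: fps_mult_nth)
    also have "pcong j \<dots> (fps_nth F m + (- (u * \<zeta> ^ P)) * (\<Sum>i=0..m. fps_nth F i * 0))"
    proof (intro pcong_add pcong_refl pcong_mult_left pcong_sum uminus_mem mult_mem power_mem u \<zeta>R F_mem)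
      fix i
      let ?k = "m - i"
      have "e ?k \<le> n2" unfolding n2_def by (intro member_le_sum) auto
      \<comment> \<open>The series t^(p^n) is compared with t^0 = 1: their exponents p^n and 0 are
        p-adically close.\<close>
      hence "?p ^ e ?k dvd ?p ^ n - 0" using n by (simp add: le_imp_power_dvd)
      then obtain s where "(emb (?p ^ n) gchoose ?k) - (emb 0 gchoose ?k) = of_nat CARD('p) ^ j * emb s"
        using e by blast
      moreover have "emb (?p ^ n) = of_nat (CARD('p) ^ n)" by (simp only: emb.hom_of_nat emb.hom_power of_nat_power)
      moreover have "(emb (0 :: 'p padic_int) gchoose ?k) = fps_nth 1 ?k"
        by (cases ?k) simp_all
      ultimately show "pcong j (fps_nth (fps_binomial (of_nat (CARD('p) ^ n)) - 1) ?k) 0"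
        using emb_mem[of s] unfolding pcong_def by auto
    qed
    finally show ?thesis by simp
  qed
  thus ?thesis unfolding F_def Y_def by blast
qed

end

text \<open>In the application Z indexes the nontrivial characters, c is the value of a character at
  the residue of x, \<open>\<zeta> \<xi> i\<close> its value at v_i, and the tuple x holds the
  coordinates of the given element in the basis p^(-r) v_i.\<close>

locale geometric_measure = padic_coefficient_ring R for R :: "'p :: prime_type padic alg_closure set" +
  fixes Z :: "'z set" and c :: "'z \<Rightarrow> 'p padic alg_closure"
    and \<zeta> :: "'z \<Rightarrow> 'n :: finite \<Rightarrow> 'p padic alg_closure"
    and x :: "'n \<Rightarrow> 'p padic_int" and r :: nat
  assumes c_mem: "\<xi> \<in> Z \<Longrightarrow> c \<xi> \<in> R"
    and admissible: "\<xi> \<in> Z \<Longrightarrow> admissible (\<zeta> \<xi> i)"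
begin

definition distribution :: "nat \<Rightarrow> ('n \<Rightarrow> 'p padic_int) \<Rightarrow> 'p padic alg_closure" where
  "distribution n a = (\<Sum>\<xi>\<in>Z. c \<xi> * (\<Prod>i\<in>UNIV. geom_dist (\<zeta> \<xi> i) (x i) r n (a i)))"

definition series :: "('n \<Rightarrow> nat) \<Rightarrow> 'p padic alg_closure" where
  "series m = (\<Sum>\<xi>\<in>Z. c \<xi> * sep_prod (\<lambda>i. fps_binomial (emb (x i)) *
     inverse (1 - fps_const (\<zeta> \<xi> i) * fps_binomial (of_nat (CARD('p) ^ r)))) m)"

text \<open>The representatives of level n + 1 inside a cylinder of level n form a product set.
  Summing a product over it gives the product of the sums, so additivity in one variable is
  enough.\<close>

sublocale cylinder_distribution R distribution r
proof
  show "distribution n a \<in> R" for n a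
    unfolding distribution_def by (intro sum_mem mult_mem c_mem prod_mem geom_dist_mem admissible)
  show "distribution n b = distribution n a" if "b \<in> cylinder n a" for n a b
  proof -
    have "geom_dist \<eta> (x i) r n (b i) = geom_dist \<eta> (x i) r n (a i)" for \<eta> :: "'p padic alg_closure" and i
      using that by (intro geom_dist_cong) (simp add: cylinder_def)
    thus ?thesis by (simp add: distribution_def)
  qed
  show "distribution n a = (\<Sum>s\<in>residue_reps (Suc n) \<inter> cylinder n a. distribution (Suc n) s)" if n: "r \<le> n" for n a
  proof -
    let ?T = "\<lambda>i. {t \<in> of_nat ` {..<CARD('p) ^ Suc n}. Rep_padic_int t n = Rep_padic_int (a i) n}"
    have "residue_reps (Suc n) \<inter> cylinder n a = PiE UNIV ?T"
      by (auto simp: residue_reps_def cylinder_def PiE_iff)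
    hence "(\<Sum>s\<in>residue_reps (Suc n) \<inter> cylinder n a. distribution (Suc n) s)
        = (\<Sum>\<xi>\<in>Z. c \<xi> * (\<Sum>s\<in>PiE UNIV ?T. \<Prod>i\<in>UNIV. geom_dist (\<zeta> \<xi> i) (x i) r (Suc n) (s i)))"
      unfolding distribution_def by (simp add: sum.swap[of _ Z] sum_distrib_left)
    also have "\<dots> = (\<Sum>\<xi>\<in>Z. c \<xi> * (\<Prod>i\<in>UNIV. \<Sum>t\<in>?T i. geom_dist (\<zeta> \<xi> i) (x i) r (Suc n) t))"
      by (subst prod_sum_PiE) auto
    also have "\<dots> = distribution n a"
      unfolding distribution_def
    proof (intro sum.cong refl arg_cong2[of _ _ _ _ "(*)"] prod.cong)
      fix \<xi> i assume "\<xi> \<in> Z"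
      thus "(\<Sum>t\<in>?T i. geom_dist (\<zeta> \<xi> i) (x i) r (Suc n) t) = geom_dist (\<zeta> \<xi> i) (x i) r n (a i)"
        using n admissible[of \<xi> i] by (intro geom_dist_additive) (auto simp: admissible_def)
    qed
    finally show ?thesis ..
  qed
qed

lemma measure_of_series_eq:
  assumes w: "rat_basis w"
  shows "measure_of_series w R series = extension w"
proof (rule measure_of_series_eq_extension[OF w])
  fix m :: "'n \<Rightarrow> nat" and j
  let ?F = "\<lambda>\<xi> i. fps_binomial (emb (x i)) * inverse (1 - fps_const (\<zeta> \<xi> i) * fps_binomial (of_nat (CARD('p) ^ r)))"
  let ?S = "\<lambda>\<xi> i n. \<Sum>z\<in>of_nat ` {..<CARD('p) ^ n}. (emb z gchoose m i) * geom_dist (\<zeta> \<xi> i) (x i) r n z"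
  show "\<exists>n\<^sub>0. \<forall>n\<ge>n\<^sub>0. pcong j (\<Sum>s\<in>residue_reps n. (\<Prod>i\<in>UNIV. emb (s i) gchoose m i) * distribution n s) (series m)"
  proof (cases "finite Z")
    case True
    define Q where "Q \<xi> i k \<longleftrightarrow> (\<forall>n\<ge>k. pcong j (?S \<xi> i n) (fps_nth (?F \<xi> i) (m i)))" for \<xi> i k
    have "\<exists>k. Q \<xi> i k" if "\<xi> \<in> Z" for \<xi> i
      unfolding Q_def by (rule geom_dist_limit[OF admissible[OF that]])
    then obtain k where k: "\<And>\<xi> i. \<xi> \<in> Z \<Longrightarrow> Q \<xi> i (k \<xi> i)" by metis
    have "pcong j (\<Sum>s\<in>residue_reps n. (\<Prod>i\<in>UNIV. emb (s i) gchoose m i) * distribution n s) (series m)"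
      if n: "n \<ge> (\<Sum>\<xi>\<in>Z. \<Sum>i\<in>UNIV. k \<xi> i)" for n
    proof -
      have lim: "pcong j (?S \<xi> i n) (fps_nth (?F \<xi> i) (m i))" if \<xi>: "\<xi> \<in> Z" for \<xi> i
      proof -
        have "k \<xi> i \<le> (\<Sum>i\<in>UNIV. k \<xi> i)" by (intro member_le_sum) auto
        also have "\<dots> \<le> (\<Sum>\<xi>\<in>Z. \<Sum>i\<in>UNIV. k \<xi> i)" using \<xi> True by (intro member_le_sum) auto
        also have "\<dots> \<le> n" by (rule n)
        finally show ?thesis using k[OF \<xi>, of i] unfolding Q_def by blast
      qed
      have S_mem: "?S \<xi> i n' \<in> R" if "\<xi> \<in> Z" for \<xi> i n'
        by (intro sum_mem mult_mem gbinomial_mem geom_dist_mem admissible that)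
      \<comment> \<open>Membership in R is read off from the limit: the coefficient differs from a
        Riemann sum in R by an element of R.\<close>
      have F_mem: "fps_nth (?F \<xi> i) (m i) \<in> R" if "\<xi> \<in> Z" for \<xi> i
      proof -
        have "?S \<xi> i n - fps_nth (?F \<xi> i) (m i) \<in> R"
          using lim[OF that, of i] unfolding pcong_def by (auto simp del: of_nat_power intro!: mult_mem power_mem of_nat_mem)
        thus ?thesis using diff_mem[OF S_mem[OF that, of i n]] by fastforce
      qed
      have "(\<Sum>s\<in>residue_reps n. (\<Prod>i\<in>UNIV. emb (s i) gchoose m i) * distribution n s)
          = (\<Sum>\<xi>\<in>Z. c \<xi> * (\<Sum>s\<in>residue_reps n. \<Prod>i\<in>UNIV. (emb (s i) gchoose m i) * geom_dist (\<zeta> \<xi> i) (x i) r n (s i)))"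
        unfolding distribution_def sum_distrib_left
        by (subst sum.swap) (simp add: prod.distrib mult_ac)
      also have "\<dots> = (\<Sum>\<xi>\<in>Z. c \<xi> * (\<Prod>i\<in>UNIV. ?S \<xi> i n))"
        unfolding residue_reps_def by (subst prod_sum_PiE) auto
      also have "pcong j \<dots> (\<Sum>\<xi>\<in>Z. c \<xi> * (\<Prod>i\<in>UNIV. fps_nth (?F \<xi> i) (m i)))"
        by (intro pcong_sum pcong_mult_left pcong_prod lim S_mem F_mem c_mem)
      finally show ?thesis by (simp add: series_def sep_prod_def)
    qed
    thus ?thesis by blast
  \<comment> \<open>Sums over an infinite Z are 0 by convention, so masses and series both
    vanish.\<close>
  qed (simp add: distribution_def series_def)
qed

lemma distribution_at:
  assumes "r \<le> n" "\<And>i. l i < CARD('p) ^ (n - r)"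
    "a \<in> cylinder n (\<lambda>i. x i + of_nat CARD('p) ^ r * of_nat (l i))"
  shows "distribution n a = (\<Sum>\<xi>\<in>Z. c \<xi> * (\<Prod>i\<in>UNIV. \<zeta> \<xi> i ^ l i / (1 - \<zeta> \<xi> i ^ CARD('p) ^ (n - r))))"
  unfolding distribution_def using assms
  by (intro sum.cong prod.cong refl arg_cong2[of _ _ _ _ "(*)"] geom_dist_at) (auto simp: in_cylinder_iff_dvd)

text \<open>The measure is supported on the points x + p^r l: a coordinate that misses all of them
  modulo p^n makes its factor vanish for every character at once.\<close>

lemma distribution_cases:
  assumes "r \<le> n"
  obtains "distribution n a = 0"
  | l where "\<And>i. l i < CARD('p) ^ (n - r)" "a \<in> cylinder n (\<lambda>i. x i + of_nat CARD('p) ^ r * of_nat (l i))"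
proof (cases "\<forall>i. \<exists>l < CARD('p) ^ (n - r). of_nat CARD('p) ^ n dvd a i - (x i + of_nat CARD('p) ^ r * of_nat l)")
  case True
  then obtain l where l: "\<And>i. l i < CARD('p) ^ (n - r)"
    "\<And>i. of_nat CARD('p) ^ n dvd a i - (x i + of_nat CARD('p) ^ r * of_nat (l i))" by metis
  show ?thesis
  proof (rule that(2))
    show "l i < CARD('p) ^ (n - r)" for i by (rule l(1))
    show "a \<in> cylinder n (\<lambda>i. x i + of_nat CARD('p) ^ r * of_nat (l i))" by (simp add: in_cylinder_iff_dvd l(2))
  qed
next
  case False
  then obtain i where "geom_dist (\<zeta> \<xi> i) (x i) r n (a i) = 0" for \<xi>
    using geom_dist_eq_0 by metis
  hence "(\<Prod>i\<in>UNIV. geom_dist (\<zeta> \<xi> i) (x i) r n (a i)) = 0" for \<xi> by (auto intro: prod_zero)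
  hence "distribution n a = 0" by (simp only: distribution_def mult_zero_right sum.neutral_const)
  thus ?thesis by (rule that(1))
qed

lemma extension_compact_open:
  assumes w: "rat_basis w" and "U \<in> compact_opens w"
  obtains n A where "r \<le> n" "extension w U = (\<Sum>s\<in>A. distribution n s)"
proof -
  obtain n V where "U = lattice_point w ` V" "clopen_at n V"
    using assms unfolding compact_opens_iff[OF w] clopen_at_def by blast
  hence "extension w U = total (max r n) V"
    using extension_eq_total[OF w, of "max r n" V] clopen_at_mono[of n V "max r n"] by simp
  thus ?thesis using that[of "max r n" "residue_reps (max r n) \<inter> V"] by (simp add: total_def)
qed

end

section \<open>Sums over roots of unity\<close>

text \<open>Multiplying the sum of d z^d by 1 - z leaves the full geometric sum, which is 0, minus
  N. The term d = 0 drops out, whence the range 1 <= d < N in \<open>H_sum\<close>.\<close>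

lemma root_of_unity_inverse:
  fixes z :: "'a :: field_char_0"
  assumes "z ^ N = 1" "z \<noteq> 1" "N > 0"
  shows "1 / (1 - z) = - (\<Sum>d\<in>{1..<N}. of_nat d * z ^ d) / of_nat N"
proof -
  have ind: "(1 - z) * (\<Sum>d<n. of_nat d * z ^ d) = (\<Sum>d<n. z ^ d) - 1 - (of_nat n - 1) * z ^ n" if "n > 0" for n
    using that
  proof (induction n rule: nat_induct_non_zero)
    case (Suc n)
    have "(1 - z) * (\<Sum>d<Suc n. of_nat d * z ^ d) = (1 - z) * (\<Sum>d<n. of_nat d * z ^ d) + (1 - z) * (of_nat n * z ^ n)"
      by (simp add: distrib_left)
    thus ?case unfolding Suc.IH by (simp add: algebra_simps)
  qed simp
  have "(\<Sum>d<N. z ^ d) = 0" using assms by (simp add: sum_gp_strict)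
  hence "(1 - z) * (\<Sum>d<N. of_nat d * z ^ d) = - of_nat N"
    using ind[OF assms(3)] assms(1) by simp
  moreover have "(\<Sum>d<N. of_nat d * z ^ d) = (\<Sum>d\<in>{1..<N}. of_nat d * z ^ d)"
    by (intro sum.mono_neutral_right) auto
  moreover have "1 - z \<noteq> 0" using assms(2) by simp
  ultimately show ?thesis using assms(3) by (simp add: field_simps)
qed

locale primitive_root_of_unity =
  fixes \<omega> :: "'a :: field_char_0" and N :: nat
  assumes N_gt_1: "1 < N" and power_eq_1_iff: "\<omega> ^ m = 1 \<longleftrightarrow> N dvd m"
begin

lemma power_mod: "\<omega> ^ (m mod N) = \<omega> ^ m"
proof -
  have "\<omega> ^ m = (\<omega> ^ N) ^ (m div N) * \<omega> ^ (m mod N)"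
    by (simp flip: power_mult power_add)
  thus ?thesis using power_eq_1_iff[of N] by simp
qed

lemma power_cong: "m mod N = m' mod N \<Longrightarrow> \<omega> ^ m = \<omega> ^ m'"
  by (metis power_mod)

lemma power_inj: "\<omega> ^ m = \<omega> ^ m' \<Longrightarrow> m < N \<Longrightarrow> m' < N \<Longrightarrow> m = m'"
proof (induction m m' rule: linorder_wlog)
  case (le m m')
  have "\<omega> \<noteq> 0" using power_eq_1_iff[of N] N_gt_1 by (auto simp: power_0_left)
  moreover have "\<omega> ^ m' = \<omega> ^ m * \<omega> ^ (m' - m)"
    using le(1) by (metis le_add_diff_inverse power_add)
  ultimately have "\<omega> ^ (m' - m) = 1" using le by simp
  hence "N dvd m' - m" by (simp add: power_eq_1_iff)
  thus ?case using le by (auto dest: dvd_imp_le)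
qed auto

text \<open>X^N - 1 has at most N roots, and the powers of omega already account for N of
  them.\<close>

lemma root_of_unity_eq_power:
  assumes "z ^ N = 1"
  obtains k where "k < N" "z = \<omega> ^ k"
proof -
  define q :: "'a poly" where "q = monom 1 N - 1"
  have q0: "q \<noteq> 0"
  proof
    assume "q = 0"
    hence "coeff q N = 0" by simp
    thus False using N_gt_1 by (simp add: q_def)
  qed
  have "degree q \<le> N" unfolding q_def by (intro degree_diff_le) (auto simp: degree_monom_le)
  hence le: "card {z. poly q z = 0} \<le> N" using card_poly_roots_bound[OF q0] by linarith
  have fin: "finite {z. poly q z = 0}" using q0 by (rule poly_roots_finite)
  have sub: "(\<lambda>k. \<omega> ^ k) ` {..<N} \<subseteq> {z. poly q z = 0}"
    using power_eq_1_iff by (auto simp: q_def poly_monom mult.commute simp flip: power_mult)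
  have "card ((\<lambda>k. \<omega> ^ k) ` {..<N}) = N"
    by (subst card_image) (auto intro: inj_onI power_inj)
  hence "(\<lambda>k. \<omega> ^ k) ` {..<N} = {z. poly q z = 0}"
    using le by (intro card_subset_eq[OF fin sub]) (use card_mono[OF fin sub] in simp)
  moreover have "z \<in> {z. poly q z = 0}" using assms by (simp add: q_def poly_monom)
  ultimately show ?thesis using that by blast
qed

text \<open>Orthogonality of characters; the -1 is the missing term k = 0, that of the trivial
  character.\<close>

lemma sum_powers: "(\<Sum>k\<in>{1..<N}. \<omega> ^ (k * m)) = (if N dvd m then of_nat N else 0) - 1"
proof -
  have "(\<Sum>k<N. (\<omega> ^ m) ^ k) = (if N dvd m then of_nat N else 0)"
  proof (cases "N dvd m")
    case True
    hence "\<omega> ^ m = 1" by (simp add: power_eq_1_iff)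
    thus ?thesis using True by simp
  next
    case False
    hence "\<omega> ^ m \<noteq> 1" by (simp add: power_eq_1_iff)
    moreover have "(\<omega> ^ m) ^ N = 1" by (simp add: power_eq_1_iff flip: power_mult)
    ultimately show ?thesis using False by (simp add: sum_gp_strict)
  qed
  moreover have "{..<N} = insert 0 {1..<N}" using N_gt_1 by auto
  ultimately have "1 + (\<Sum>k\<in>{1..<N}. \<omega> ^ (k * m)) = (if N dvd m then of_nat N else 0)"
    by (simp add: mult.commute flip: power_mult)
  thus ?thesis by (metis add_diff_cancel_left')
qed

lemma power_unit_neq_1:
  assumes "k \<in> {1..<N}" "coprime u N"
  shows "\<omega> ^ (k * u) \<noteq> 1"
  using assms by (auto simp: power_eq_1_iff coprime_dvd_mult_left_iff coprime_commute dest: dvd_imp_le)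

context
  fixes u :: "'n :: finite \<Rightarrow> nat"
  assumes u: "\<And>i. coprime (u i) N"
begin

text \<open>Up to the factor 1/N this is a Fourier-Dedekind sum.\<close>

definition Dedekind_sum :: "nat \<Rightarrow> 'a" where
  "Dedekind_sum s = (\<Sum>k\<in>{1..<N}. \<omega> ^ (k * s) * (\<Prod>i\<in>UNIV. 1 / (1 - \<omega> ^ (k * u i))))"

text \<open>The k-th term on the left is the term of index k P in the Dedekind sum, and
  multiplication by P permutes the nonzero residues modulo N. The argument s is the quotient of a +
  sum u_i l_i by P modulo N.\<close>

lemma Dedekind_sum_rescale:
  assumes P: "coprime P N" and s: "P * s mod N = (a + (\<Sum>i\<in>UNIV. u i * l i)) mod N"
  shows "(\<Sum>k\<in>{1..<N}. \<omega> ^ (k * a) * (\<Prod>i\<in>UNIV. (\<omega> ^ (k * u i)) ^ l i / (1 - (\<omega> ^ (k * u i)) ^ P)))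
    = Dedekind_sum s"
proof -
  define F where "F k = \<omega> ^ (k * s) * (\<Prod>i\<in>UNIV. 1 / (1 - \<omega> ^ (k * u i)))" for k
  have pow: "\<omega> ^ (k mod N * m) = \<omega> ^ (k * m)" for k m
    by (rule power_cong) (simp add: mod_mult_left_eq)
  have F_mod: "F (k mod N) = F k" for k
    by (simp only: F_def pow)
  have bij: "bij_betw (\<lambda>k. k * P mod N) {1..<N} {1..<N}"
  proof (rule bij_betwI')
    fix k k' assume k: "k \<in> {1..<N}" "k' \<in> {1..<N}"
    show "k * P mod N = k' * P mod N \<longleftrightarrow> k = k'"
    proof
      assume "k * P mod N = k' * P mod N"
      hence "k mod N = k' mod N" using P by (metis cong_def cong_mult_rcancel_nat)
      thus "k = k'" using k by simp
    qed simp
  next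
    fix k assume k: "k \<in> {1..<N}"
    have "\<not> N dvd k * P" using k P by (auto simp: coprime_dvd_mult_left_iff coprime_commute dest: dvd_imp_le)
    thus "k * P mod N \<in> {1..<N}" using N_gt_1 by (simp add: Suc_le_eq mod_greater_zero_iff_not_dvd)
  next
    fix k assume k: "k \<in> {1..<N}"
    obtain Q where "[P * Q = Suc 0] (mod N)" using cong_solve_coprime_nat[OF P] by blast
    hence Q: "P * Q mod N = 1" using N_gt_1 by (simp add: cong_def)
    show "\<exists>k'\<in>{1..<N}. k = k' * P mod N"
    proof (rule bexI[of _ "k * Q mod N"])
      have "k * Q mod N * P mod N = k * Q * P mod N" by (rule mod_mult_left_eq)
      also have "k * Q * P = k * (P * Q)" by (simp only: mult_ac)
      also have "k * (P * Q) mod N = k * (P * Q mod N) mod N" by (rule mod_mult_right_eq[symmetric])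
      also have "\<dots> = k" using k by (simp add: Q)
      finally show eq: "k = k * Q mod N * P mod N" ..
      have "k * Q mod N \<noteq> 0"
      proof
        assume "k * Q mod N = 0"
        hence "k = 0" using eq by simp
        thus False using k by simp
      qed
      thus "k * Q mod N \<in> {1..<N}" using N_gt_1 by (simp add: Suc_le_eq)
    qed
  qed
  have "\<omega> ^ (k * a) * (\<Prod>i\<in>UNIV. (\<omega> ^ (k * u i)) ^ l i / (1 - (\<omega> ^ (k * u i)) ^ P)) = F (k * P mod N)" for k
  proof -
    have "\<omega> ^ (k * a) * (\<Prod>i\<in>UNIV. (\<omega> ^ (k * u i)) ^ l i) = \<omega> ^ (k * (a + (\<Sum>i\<in>UNIV. u i * l i)))"
      by (simp add: power_sum sum_distrib_left distrib_left power_add mult.assoc flip: power_mult)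
    also have "\<dots> = \<omega> ^ (k * P * s)"
      by (rule power_cong) (metis s mod_mult_right_eq mult.assoc)
    finally have num: "\<omega> ^ (k * a) * (\<Prod>i\<in>UNIV. (\<omega> ^ (k * u i)) ^ l i) = \<omega> ^ (k * P * s)" .
    have "\<omega> ^ (k * a) * (\<Prod>i\<in>UNIV. (\<omega> ^ (k * u i)) ^ l i / (1 - (\<omega> ^ (k * u i)) ^ P))
        = \<omega> ^ (k * a) * (\<Prod>i\<in>UNIV. (\<omega> ^ (k * u i)) ^ l i) * (\<Prod>i\<in>UNIV. 1 / (1 - (\<omega> ^ (k * u i)) ^ P))"
      by (simp add: mult.assoc flip: prod.distrib)
    also have "\<dots> = F (k * P)"
      unfolding num F_def by (simp add: mult_ac flip: power_mult)
    finally show ?thesis by (simp only: F_mod)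
  qed
  hence "(\<Sum>k\<in>{1..<N}. \<omega> ^ (k * a) * (\<Prod>i\<in>UNIV. (\<omega> ^ (k * u i)) ^ l i / (1 - (\<omega> ^ (k * u i)) ^ P)))
      = (\<Sum>k\<in>{1..<N}. F (k * P mod N))" by simp
  also have "\<dots> = (\<Sum>k\<in>{1..<N}. F k)" by (rule sum.reindex_bij_betw[OF bij])
  finally show ?thesis by (simp add: Dedekind_sum_def F_def)
qed

text \<open>Let c be the number of variables. Expanding the factors gives (-1/N)^c times a sum over
  d of the product of the d_i times a character sum. The value N of the latter on the congruence
  leaves 1/N^(c-1); its -1 leaves the sum over all d, which is (N (N-1) / 2)^c and whose N^c
  cancels.\<close>

lemma Dedekind_sum_eq:
  "Dedekind_sum s = (-1) ^ CARD('n) *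
     (1 / of_nat N ^ (CARD('n) - 1)
        * of_nat (\<Sum>d | (\<forall>i. 1 \<le> d i \<and> d i < N) \<and> N dvd s + (\<Sum>i\<in>UNIV. d i * u i). \<Prod>i\<in>UNIV. d i)
      - ((of_nat N - 1) / 2) ^ CARD('n))"
proof -
  let ?c = "CARD('n)" and ?D = "PiE (UNIV :: 'n set) (\<lambda>_. {1..<N})"
  define \<pi> where "\<pi> d = (of_nat (\<Prod>i\<in>UNIV. d i) :: 'a)" for d :: "'n \<Rightarrow> nat"
  have fin: "finite ?D" by (intro finite_PiE) auto
  have inv: "1 / (1 - \<omega> ^ (k * u i)) = (- 1 / of_nat N) * (\<Sum>d\<in>{1..<N}. of_nat d * \<omega> ^ (k * u i * d))"
    if "k \<in> {1..<N}" for k i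
  proof -
    have "(\<omega> ^ (k * u i)) ^ N = 1" by (simp add: power_eq_1_iff flip: power_mult)
    from root_of_unity_inverse[OF this power_unit_neq_1[OF that u]]
    show ?thesis using N_gt_1 by (simp flip: power_mult)
  qed
  have "Dedekind_sum s = (\<Sum>k\<in>{1..<N}. \<omega> ^ (k * s) *
      (\<Prod>i\<in>UNIV. (- 1 / of_nat N) * (\<Sum>d\<in>{1..<N}. of_nat d * \<omega> ^ (k * u i * d))))"
    unfolding Dedekind_sum_def by (intro sum.cong refl arg_cong2[of _ _ _ _ "(*)"] prod.cong inv)
  also have "\<dots> = (\<Sum>k\<in>{1..<N}. (- 1 / of_nat N) ^ ?c * (\<Sum>d\<in>?D. \<pi> d * \<omega> ^ (k * (s + (\<Sum>i\<in>UNIV. d i * u i)))))"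
  proof (intro sum.cong refl)
    fix k
    have "\<omega> ^ (k * s) * (\<Prod>i\<in>UNIV. (- 1 / of_nat N) * (\<Sum>d\<in>{1..<N}. of_nat d * \<omega> ^ (k * u i * d)))
        = (- 1 / of_nat N) ^ ?c * (\<omega> ^ (k * s) * (\<Sum>d\<in>?D. \<Prod>i\<in>UNIV. of_nat (d i) * \<omega> ^ (k * u i * d i)))"
    proof -
      have "(\<Prod>i\<in>(UNIV :: 'n set). q * S i) = q ^ ?c * (\<Prod>i\<in>UNIV. S i)" for q and S :: "'n \<Rightarrow> 'a"
        by (simp add: prod.distrib)
      thus ?thesis by (simp only: prod_sum_PiE[OF finite finite_atLeastLessThan] mult.left_commute)
    qed
    also have "\<omega> ^ (k * s) * (\<Sum>d\<in>?D. \<Prod>i\<in>UNIV. of_nat (d i) * \<omega> ^ (k * u i * d i))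
        = (\<Sum>d\<in>?D. \<pi> d * \<omega> ^ (k * (s + (\<Sum>i\<in>UNIV. d i * u i))))"
      unfolding sum_distrib_left
      by (intro sum.cong refl)
         (simp add: \<pi>_def prod.distrib power_add distrib_left power_sum sum_distrib_left mult_ac)
    finally show "\<omega> ^ (k * s) * (\<Prod>i\<in>UNIV. (- 1 / of_nat N) * (\<Sum>d\<in>{1..<N}. of_nat d * \<omega> ^ (k * u i * d)))
        = (- 1 / of_nat N) ^ ?c * (\<Sum>d\<in>?D. \<pi> d * \<omega> ^ (k * (s + (\<Sum>i\<in>UNIV. d i * u i))))" .
  qed
  also have "\<dots> = (- 1 / of_nat N) ^ ?c * (\<Sum>d\<in>?D. \<pi> d * (\<Sum>k\<in>{1..<N}. \<omega> ^ (k * (s + (\<Sum>i\<in>UNIV. d i * u i)))))"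
    unfolding sum_distrib_left by (rule sum.swap)
  also have "(\<Sum>d\<in>?D. \<pi> d * (\<Sum>k\<in>{1..<N}. \<omega> ^ (k * (s + (\<Sum>i\<in>UNIV. d i * u i)))))
      = (\<Sum>d\<in>?D. if N dvd s + (\<Sum>i\<in>UNIV. d i * u i) then \<pi> d * of_nat N else 0) - (\<Sum>d\<in>?D. \<pi> d)"
    unfolding sum_powers sum_subtractf[symmetric] by (intro sum.cong refl) (simp add: right_diff_distrib)
  also have "(\<Sum>d\<in>?D. if N dvd s + (\<Sum>i\<in>UNIV. d i * u i) then \<pi> d * of_nat N else 0)
      = of_nat N * of_nat (\<Sum>d | (\<forall>i. 1 \<le> d i \<and> d i < N) \<and> N dvd s + (\<Sum>i\<in>UNIV. d i * u i). \<Prod>i\<in>UNIV. d i)"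
  proof -
    have "(\<Sum>d\<in>?D. if N dvd s + (\<Sum>i\<in>UNIV. d i * u i) then \<pi> d * of_nat N else 0)
        = (\<Sum>d\<in>{d\<in>?D. N dvd s + (\<Sum>i\<in>UNIV. d i * u i)}. \<pi> d * of_nat N)"
      by (rule sum.inter_filter[OF fin, symmetric])
    also have "{d\<in>?D. N dvd s + (\<Sum>i\<in>UNIV. d i * u i)}
        = {d. (\<forall>i. 1 \<le> d i \<and> d i < N) \<and> N dvd s + (\<Sum>i\<in>UNIV. d i * u i)}"
      by (auto simp: PiE_iff)
    finally show ?thesis unfolding \<pi>_def of_nat_sum by (simp add: sum_distrib_left mult.commute)
  qed
  also have "(\<Sum>d\<in>?D. \<pi> d) = (of_nat N * ((of_nat N - 1) / 2)) ^ ?c"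
  proof -
    have "(\<Sum>d\<in>?D. \<pi> d) = (\<Prod>i\<in>(UNIV :: 'n set). \<Sum>d\<in>{1..<N}. of_nat d)"
      by (subst prod_sum_PiE) (simp_all add: \<pi>_def)
    also have "(\<Sum>d\<in>{1..<N}. of_nat d :: 'a) = of_nat N * ((of_nat N - 1) / 2)"
    proof -
      have "(\<Sum>d\<in>{1..<n}. of_nat d :: 'a) = of_nat n * ((of_nat n - 1) / 2)" if "n \<ge> 1" for n
        using that by (induction n rule: nat_induct_at_least) (simp_all add: field_simps)
      thus ?thesis using N_gt_1 by simp
    qed
    finally show ?thesis by simp
  qed
  finally have eq: "Dedekind_sum s = (- 1 / of_nat N) ^ ?c *
     (of_nat N * of_nat (\<Sum>d | (\<forall>i. 1 \<le> d i \<and> d i < N) \<and> N dvd s + (\<Sum>i\<in>UNIV. d i * u i). \<Prod>i\<in>UNIV. d i)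
      - (of_nat N * ((of_nat N - 1) / 2)) ^ ?c)" .
  have alg: "(- 1 / n) ^ ?c * (n * h - (n * e) ^ ?c) = (-1) ^ ?c * (1 / n ^ (?c - 1) * h - e ^ ?c)"
    if "n \<noteq> 0" for n h e :: 'a
  proof -
    \<comment> \<open>Positivity makes the truncated exponent c - 1 genuine, so that N^c = N
      N^(c-1).\<close>
    have "0 < ?c" by simp
    then obtain c where c: "?c = Suc c" using gr0_implies_Suc by blast
    have "A / (n * m) * (n * h - n * m * e') = A * (1 / m * h - e')" if "m \<noteq> 0" for A m e' :: 'a
      using that \<open>n \<noteq> 0\<close> by (simp add: right_diff_distrib)
    from this[of "n ^ c" "(-1) ^ Suc c" "e ^ Suc c"] show ?thesis
      unfolding c power_divide power_mult_distrib power_Suc[of n] diff_Suc_1 using that power_not_zero by blast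
  qed
  show ?thesis unfolding eq by (rule alg) (use N_gt_1 in simp)
qed

end

end

section \<open>Residues modulo an ideal with cyclic quotient\<close>

lemma ring_of_integers_simps [simp]:
  "carrier (\<O> :: 'f :: field_char_0 ring) = {y. algebraic_int y}"
  "x \<otimes>\<^bsub>\<O>\<^esub> y = x * y" "x \<oplus>\<^bsub>\<O>\<^esub> y = x + y" "\<one>\<^bsub>\<O>\<^esub> = (1 :: 'f)" "\<zero>\<^bsub>\<O>\<^esub> = (0 :: 'f)"
  by (simp_all add: ring_of_integers_def ring_of_type_algebra_def)

locale cyclic_quotient =
  fixes I :: "'f :: field_char_0 set" and N :: nat
  assumes ideal: "ideal I \<O>" and nonzero: "I \<noteq> {0}" and proper: "I \<noteq> carrier \<O>"
    and card_quotient: "N = card (carrier (\<O> Quot I))"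
    and iso: "\<O> Quot I \<simeq> ZFact (int N)"
begin

sublocale ideal I \<O> by (rule ideal)

lemma algebraic_int_add: "algebraic_int x \<Longrightarrow> algebraic_int y \<Longrightarrow> algebraic_int (x + y :: 'f)"
  using add.m_closed[of x y] by simp

lemma algebraic_int_mult: "algebraic_int x \<Longrightarrow> algebraic_int y \<Longrightarrow> algebraic_int (x * y :: 'f)"
  using m_closed[of x y] by simp

lemma algebraic_int_diff: "algebraic_int x \<Longrightarrow> algebraic_int y \<Longrightarrow> algebraic_int (x - y :: 'f)"
  using algebraic_int_add[of x "- y"] by (simp add: algebraic_int_minus)

lemma mem_algebraic_int: "a \<in> I \<Longrightarrow> algebraic_int a"
  using a_subset by auto

lemma mem_add: "a \<in> I \<Longrightarrow> b \<in> I \<Longrightarrow> a + b \<in> I"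
  using additive_subgroup.a_closed[OF additive_subgroup_axioms, of a b] by simp

lemma mem_mult: "a \<in> I \<Longrightarrow> algebraic_int x \<Longrightarrow> a * x \<in> I"
  using I_r_closed by simp

lemma mem_uminus: "a \<in> I \<Longrightarrow> - a \<in> I"
  using mem_mult[of a "-1"] by (simp add: algebraic_int_minus)

lemma mem_diff: "a \<in> I \<Longrightarrow> b \<in> I \<Longrightarrow> a - b \<in> I"
  using mem_add[OF _ mem_uminus, of a b] by simp

lemma mem_0: "0 \<in> I"
  using additive_subgroup.zero_closed[OF additive_subgroup_axioms] by simp

lemma coset_eq: "I +>\<^bsub>\<O>\<^esub> a = {c. c - a \<in> I}"
  by (force simp: a_r_coset_def')

lemma coset_eq_iff: "I +>\<^bsub>\<O>\<^esub> a = I +>\<^bsub>\<O>\<^esub> b \<longleftrightarrow> a - b \<in> I"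
proof
  assume "I +>\<^bsub>\<O>\<^esub> a = I +>\<^bsub>\<O>\<^esub> b"
  moreover have "a \<in> I +>\<^bsub>\<O>\<^esub> a" by (simp add: coset_eq mem_0)
  ultimately show "a - b \<in> I" by (simp add: coset_eq)
next
  assume ab: "a - b \<in> I"
  have "c - a \<in> I \<longleftrightarrow> c - b \<in> I" for c
    using mem_add[OF _ ab, of "c - a"] mem_diff[OF _ ab, of "c - b"] by auto
  thus "I +>\<^bsub>\<O>\<^esub> a = I +>\<^bsub>\<O>\<^esub> b" by (simp add: coset_eq)
qed

lemma carrier_quotient: "carrier (\<O> Quot I) = (\<lambda>a. I +>\<^bsub>\<O>\<^esub> a) ` {a. algebraic_int a}"
  by (auto simp: FactRing_def A_RCOSETS_def')

lemma quotient_add: "algebraic_int a \<Longrightarrow> algebraic_int b \<Longrightarrow>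
    (I +>\<^bsub>\<O>\<^esub> a) \<oplus>\<^bsub>\<O> Quot I\<^esub> (I +>\<^bsub>\<O>\<^esub> b) = I +>\<^bsub>\<O>\<^esub> (a + b)"
  using a_rcos_sum[of a b] by (simp add: FactRing_def)

text \<open>A ring isomorphism must send the class of an integer \<open>m\<close> to the class of \<open>m\<close>.\<close>

lemma int_classes:
  shows of_int_mem_iff: "of_int m \<in> I \<longleftrightarrow> int N dvd m"
    and ex_int_residue: "algebraic_int a \<Longrightarrow> \<exists>m. a - of_int m \<in> I"
proof -
  obtain h where h: "h \<in> ring_hom (\<O> Quot I) (ZFact (int N))"
    and bij: "bij_betw h (carrier (\<O> Quot I)) (carrier (ZFact (int N)))"
    using iso by (auto simp: is_ring_iso_def ring_iso_def)
  interpret Z: ideal "Idl\<^bsub>\<Z>\<^esub> {int N}" \<Z> by (rule int.genideal_ideal) simp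
  interpret ZF: cring "ZFact (int N)" by (rule ZFact_is_cring)
  define f where "f m = h (I +>\<^bsub>\<O>\<^esub> of_int m)" for m
  have carrier: "I +>\<^bsub>\<O>\<^esub> of_int m \<in> carrier (\<O> Quot I)" for m
    by (auto simp: carrier_quotient)
  have ZMod_add: "ZMod (int N) m \<oplus>\<^bsub>ZFact (int N)\<^esub> ZMod (int N) m' = ZMod (int N) (m + m')" for m m'
    using Z.a_rcos_sum[of m m'] by (simp add: ZFact_def FactRing_def ZMod_def)
  have ZMod_carrier: "ZMod (int N) m \<in> carrier (ZFact (int N))" for m
    by (auto simp: ZFact_def FactRing_def A_RCOSETS_def' ZMod_def)
  have ZF_carrier: "\<exists>m. c = ZMod (int N) m" if "c \<in> carrier (ZFact (int N))" for c
    using that by (auto simp: ZFact_def FactRing_def A_RCOSETS_def' ZMod_def)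
  have f_carrier: "f m \<in> carrier (ZFact (int N))" for m
    unfolding f_def using ring_hom_closed[OF h carrier] .
  have f_add: "f (m + m') = f m \<oplus>\<^bsub>ZFact (int N)\<^esub> f m'" for m m'
    using ring_hom_add[OF h carrier carrier, of m m'] by (simp add: f_def quotient_add)
  have f_1: "f 1 = ZMod (int N) 1"
    using ring_hom_one[OF h] by (simp add: f_def FactRing_def ZFact_def ZMod_def)
  have f_0: "f 0 = ZMod (int N) 0"
  proof -
    have "f 0 \<oplus>\<^bsub>ZFact (int N)\<^esub> f 1 = ZMod (int N) 0 \<oplus>\<^bsub>ZFact (int N)\<^esub> f 1"
      using f_add[of 0 1] by (simp add: f_1 ZMod_add)
    thus ?thesis using ZF.add.r_cancel f_carrier ZMod_carrier by blast
  qed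
  have f_eq: "f m = ZMod (int N) m" for m
  proof (induction m rule: int_induct[where k = 0])
    case base
    show ?case by (rule f_0)
  next
    case (step1 m)
    thus ?case by (simp add: f_add f_1 ZMod_add)
  next
    case (step2 m)
    have "f (m - 1) \<oplus>\<^bsub>ZFact (int N)\<^esub> f 1 = ZMod (int N) (m - 1) \<oplus>\<^bsub>ZFact (int N)\<^esub> f 1"
      using f_add[of "m - 1" 1] step2 by (simp add: f_1 ZMod_add)
    thus ?case using ZF.add.r_cancel f_carrier ZMod_carrier by blast
  qed
  show "of_int m \<in> I \<longleftrightarrow> int N dvd m"
  proof -
    have "of_int m \<in> I \<longleftrightarrow> I +>\<^bsub>\<O>\<^esub> of_int m = I +>\<^bsub>\<O>\<^esub> of_int 0" by (simp add: coset_eq_iff)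
    also have "\<dots> \<longleftrightarrow> f m = f 0"
      unfolding f_def by (rule inj_on_eq_iff[OF bij_betw_imp_inj_on[OF bij] carrier carrier, symmetric])
    also have "\<dots> \<longleftrightarrow> int N dvd m" by (simp add: f_eq ZMod_eq_mod dvd_eq_mod_eq_0)
    finally show ?thesis .
  qed
  assume a: "algebraic_int a"
  hence c: "I +>\<^bsub>\<O>\<^esub> a \<in> carrier (\<O> Quot I)" by (auto simp: carrier_quotient)
  then obtain m where "h (I +>\<^bsub>\<O>\<^esub> a) = ZMod (int N) m" using ZF_carrier ring_hom_closed[OF h] by blast
  hence "h (I +>\<^bsub>\<O>\<^esub> a) = h (I +>\<^bsub>\<O>\<^esub> of_int m)" by (simp add: f_eq flip: f_def)
  hence "I +>\<^bsub>\<O>\<^esub> a = I +>\<^bsub>\<O>\<^esub> of_int m"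
    using inj_on_eq_iff[OF bij_betw_imp_inj_on[OF bij] c carrier] by blast
  thus "\<exists>m. a - of_int m \<in> I" by (auto simp: coset_eq_iff)
qed

text \<open>The constant coefficient of an integral equation of a nonzero element of \<open>I\<close> lies in \<open>I\<close>.\<close>

lemma ex_nonzero_int_mem: "\<exists>m. m \<noteq> 0 \<and> of_int m \<in> I"
proof -
  obtain a where a: "a \<in> I" "a \<noteq> 0" using nonzero mem_0 by blast
  have poly_int: "algebraic_int (poly (map_poly of_int q) a)" for q :: "int poly"
    by (induction q)
       (simp_all add: map_poly_pCons algebraic_int_add algebraic_int_mult mem_algebraic_int[OF a(1)])
  have "\<exists>m. m \<noteq> 0 \<and> of_int m \<in> I" if "q \<noteq> 0" "poly (map_poly of_int q) a = 0" for q :: "int poly"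
    using that
  proof (induction q)
    case (pCons c q)
    have eq: "of_int c = - (a * poly (map_poly of_int q) a)"
      using pCons.prems(2) pCons.hyps by (simp add: map_poly_pCons eq_neg_iff_add_eq_0)
    show ?case
    proof (cases "c = 0")
      case True
      thus ?thesis using pCons a(2) eq by auto
    next
      case False
      have "of_int c \<in> I" unfolding eq by (intro mem_uminus mem_mult a(1) poly_int)
      thus ?thesis using False by blast
    qed
  qed simp
  moreover obtain q where "poly (map_poly of_int q) a = 0" "lead_coeff q = 1"
    using mem_algebraic_int[OF a(1)] by (auto simp: algebraic_int_altdef_ipoly)
  ultimately show ?thesis by (metis leading_coeff_0_iff zero_neq_one)
qed

text \<open>An infinite quotient would have \<open>card\<close> equal to 0, and by
  \<open>of_int_mem_iff\<close> I would then contain no integer but 0.\<close>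

lemma N_gt_1: "1 < N"
proof -
  obtain m where "m \<noteq> 0" "of_int m \<in> I" using ex_nonzero_int_mem by blast
  hence "N \<noteq> 0" by (auto simp: of_int_mem_iff)
  moreover have "N \<noteq> 1"
  proof
    assume "N = 1"
    hence "(1 :: 'f) \<in> I" using of_int_mem_iff[of 1] by simp
    thus False using one_imp_carrier proper by simp
  qed
  ultimately show ?thesis by simp
qed

text \<open>P is the preimage of the ideal generated by q in Z/N. These primes are the ones at which
  \<open>prime_to\<close> and \<open>integral_at\<close> are tested below.\<close>

lemma prime_above:
  assumes q: "prime q" "q dvd int N"
  defines "P \<equiv> {a. \<exists>k. a - of_int (q * k) \<in> I}"
  shows "primeideal P \<O>" and "I \<subseteq> P" and "\<And>m. of_int m \<in> P \<longleftrightarrow> q dvd m"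
    and "\<And>a m. a - of_int m \<in> I \<Longrightarrow> a \<in> P \<longleftrightarrow> q dvd m"
proof -
  have *: "q dvd m" if "a - of_int m \<in> I" "a - of_int (q * k) \<in> I" for a m k
  proof -
    have "of_int (q * k - m) \<in> I" using mem_diff[OF that] by simp
    hence "q dvd q * k - m" using q(2) by (metis of_int_mem_iff dvd_trans)
    thus ?thesis by (simp add: dvd_diff_right_iff)
  qed
  show iff: "a \<in> P \<longleftrightarrow> q dvd m" if "a - of_int m \<in> I" for a m
    unfolding P_def using *[OF that] that by (auto simp: dvd_def)
  show iff': "of_int m \<in> P \<longleftrightarrow> q dvd m" for m
    by (rule iff) (simp add: mem_0)
  show "I \<subseteq> P"
  proof
    fix a assume "a \<in> I"
    hence "a - of_int 0 \<in> I" by simp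
    from iff[OF this] show "a \<in> P" by simp
  qed
  have P_int: "algebraic_int a" if "a \<in> P" for a
  proof -
    from that obtain k where "a - of_int (q * k) \<in> I" by (auto simp: P_def)
    from algebraic_int_add[OF mem_algebraic_int[OF this] algebraic_int_of_int[of "q * k"]] show ?thesis
      by (simp only: diff_add_cancel)
  qed
  have mult: "x * a \<in> P" if a: "a \<in> P" and x: "algebraic_int x" for a x
  proof -
    from a obtain k where k: "a - of_int (q * k) \<in> I" by (auto simp: P_def)
    obtain m where m: "x - of_int m \<in> I" using ex_int_residue[OF x] by blast
    have "(a - of_int (q * k)) * x + (x - of_int m) * of_int (q * k) \<in> I"
      using x k m by (intro mem_add mem_mult algebraic_int_of_int)
    hence "x * a - of_int (q * (m * k)) \<in> I" by (simp add: algebra_simps)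
    thus ?thesis unfolding P_def by blast
  qed
  have minus: "\<ominus>\<^bsub>\<O>\<^esub> a = - a" if "algebraic_int a" for a :: 'f
    by (rule add.inv_equality) (use that in \<open>auto simp: algebraic_int_minus\<close>)
  have sub: "additive_subgroup P \<O>"
  proof (intro additive_subgroup.intro subgroup.intro, goal_cases)
    case 1
    show ?case using P_int by auto
  next
    case (2 a b)
    then obtain k l where "a - of_int (q * k) \<in> I" "b - of_int (q * l) \<in> I" by (auto simp: P_def)
    from mem_add[OF this] have "a + b - of_int (q * (k + l)) \<in> I" by (simp add: algebra_simps)
    hence "a + b \<in> P" unfolding P_def by blast
    thus ?case by simp
  next
    case 3
    show ?case using iff'[of 0] by simp
  next
    case (4 a)
    hence "- a \<in> P" using mult[of a "-1"] by (simp add: algebraic_int_minus)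
    hence "\<ominus>\<^bsub>\<O>\<^esub> a \<in> P" using minus[OF P_int[OF 4]] by (simp only:)
    thus ?case by (simp only: a_inv_def)
  qed
  show "primeideal P \<O>"
  proof (rule primeidealI2[OF sub])
    show "cring (\<O> :: 'f ring)"
      by (intro cring.intro ring_axioms comm_monoid.intro comm_monoid_axioms.intro monoid_axioms)
         (simp add: mult.commute)
    show "x \<otimes>\<^bsub>\<O>\<^esub> a \<in> P" "a \<otimes>\<^bsub>\<O>\<^esub> x \<in> P" if "a \<in> P" "x \<in> carrier \<O>" for a x
      using mult that by (simp_all add: mult.commute[of a])
    have "1 \<notin> P" using iff'[of 1] q(1) prime_gt_1_int[OF q(1)] by simp
    thus "carrier \<O> \<noteq> P" by auto
    show "a \<in> P \<or> b \<in> P" if ab: "a \<in> carrier \<O>" "b \<in> carrier \<O>" "a \<otimes>\<^bsub>\<O>\<^esub> b \<in> P" for a b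
    proof -
      obtain m where m: "a - of_int m \<in> I" using ex_int_residue[of a] ab(1) by auto
      obtain l where l: "b - of_int l \<in> I" using ex_int_residue[of b] ab(2) by auto
      have "(a - of_int m) * b + (b - of_int l) * of_int m \<in> I"
        using ab m l by (intro mem_add mem_mult) auto
      hence "a * b - of_int (m * l) \<in> I" by (simp add: algebra_simps)
      from iff[OF this] have "q dvd m * l" using ab(3) by simp
      thus ?thesis using q(1) iff[OF m] iff[OF l] by (simp add: prime_dvd_mult_iff)
    qed
  qed
qed

end

section \<open>Roots of unity as algebraic numbers\<close>

lemma Qbar_simps:
  "carrier Qbar = {z. algebraic z}" "x \<otimes>\<^bsub>Qbar\<^esub> y = x * y" "x \<oplus>\<^bsub>Qbar\<^esub> y = x + y" "\<one>\<^bsub>Qbar\<^esub> = 1"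
  by (simp_all add: Qbar_def ring_of_type_algebra_def)

text \<open>1 - z is a root of (1 - X)^n - 1, which is not the zero polynomial because its value at
  1 is -1.\<close>

lemma algebraic_one_minus_root_of_unity:
  fixes z :: "'a :: field_char_0"
  assumes "z ^ n = 1" "n > 0"
  shows "algebraic (1 - z)"
proof (rule algebraicI)
  let ?q = "[:1, -1:] ^ n - 1 :: int poly"
  show "coeff (map_poly of_int ?q) i \<in> \<int>" for i :: nat by (simp add: coeff_map_poly)
  show "poly (map_poly of_int ?q) (1 - z) = 0"
    using assms(1) by (simp add: of_int_poly_hom.hom_minus of_int_poly_hom.hom_power map_poly_pCons)
  have "poly (map_poly of_int ?q) (1 :: 'a) = -1"
    using assms(2) by (simp add: of_int_poly_hom.hom_minus of_int_poly_hom.hom_power map_poly_pCons power_0_left)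
  thus "map_poly of_int ?q \<noteq> (0 :: 'a poly)" by (metis neg_equal_0_iff_equal poly_0 zero_neq_one)
qed

lemma algebraic_root_of_unity:
  fixes z :: "'a :: field_char_0"
  assumes "z ^ n = 1" "n > 0"
  shows "algebraic z"
proof (rule algebraicI)
  let ?q = "[:0, 1:] ^ n - 1 :: int poly"
  show "coeff (map_poly of_int ?q) i \<in> \<int>" for i :: nat by (simp add: coeff_map_poly)
  show "poly (map_poly of_int ?q) z = 0"
    using assms(1) by (simp add: of_int_poly_hom.hom_minus of_int_poly_hom.hom_power map_poly_pCons)
  have "poly (map_poly of_int ?q) (0 :: 'a) = -1"
    using assms(2) by (simp add: of_int_poly_hom.hom_minus of_int_poly_hom.hom_power map_poly_pCons power_0_left)
  thus "map_poly of_int ?q \<noteq> (0 :: 'a poly)" by (metis neg_equal_0_iff_equal poly_0 zero_neq_one)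
qed

section \<open>Residues of elements that are integral at the primes containing I\<close>

context cyclic_quotient
begin

lemma prime_to_1: "prime_to I 1"
  unfolding prime_to_def
proof (intro allI impI notI)
  fix P assume P: "primeideal P \<O> \<and> I \<subseteq> P" "1 \<in> P"
  then interpret P: primeideal P \<O> by blast
  show False using P.one_imp_carrier P(2) P.I_notcarr by simp
qed

lemma prime_to_mult:
  assumes "prime_to I b" "prime_to I b'" "algebraic_int b" "algebraic_int b'"
  shows "prime_to I (b * b')"
  unfolding prime_to_def
proof (intro allI impI notI)
  fix P assume P: "primeideal P \<O> \<and> I \<subseteq> P" "b * b' \<in> P"
  then interpret P: primeideal P \<O> by blast
  have "b \<in> P \<or> b' \<in> P" using P.I_prime[of b b'] P(2) assms(3,4) by simp
  thus False using assms(1,2) P(1) by (auto simp: prime_to_def)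
qed

lemma prime_to_power: "prime_to I b \<Longrightarrow> algebraic_int b \<Longrightarrow> algebraic_int (b ^ n) \<and> prime_to I (b ^ n)"
  by (induction n) (auto simp: prime_to_1 prime_to_mult algebraic_int_mult)

text \<open>A common prime factor q of m and N would put b into the prime ideal of
  \<open>prime_above\<close> belonging to q.\<close>

lemma prime_to_imp_coprime:
  assumes "prime_to I b" "b - of_int m \<in> I"
  shows "coprime m (int N)"
proof (rule ccontr)
  assume "\<not> coprime m (int N)"
  hence "\<not> is_unit (gcd m (int N))" by (simp add: coprime_iff_gcd_eq_1)
  moreover have "gcd m (int N) \<noteq> 0" using N_gt_1 by simp
  ultimately obtain q where q: "prime q" "q dvd gcd m (int N)"
    by (meson prime_divisorE)
  have dvd: "q dvd int N" "q dvd m" using q(2) by auto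
  show False
    using assms prime_above(1,2)[OF q(1) dvd(1)] prime_above(4)[OF q(1) dvd(1) assms(2)] dvd(2)
    unfolding prime_to_def by blast
qed

lemma prime_to_nonzero: "prime_to I b \<Longrightarrow> b \<noteq> 0"
  using prime_to_imp_coprime[of b 0] N_gt_1 by (auto simp: mem_0)

text \<open>The ideal generated by I in the semi-localization at the primes containing I. Equality
  of the residues in \<open>residue_mod\<close> becomes membership of a difference here.\<close>

definition local_ideal :: "'f set" where
  "local_ideal = {a / b | a b. a \<in> I \<and> algebraic_int b \<and> prime_to I b}"

lemma local_idealI: "a \<in> I \<Longrightarrow> algebraic_int b \<Longrightarrow> prime_to I b \<Longrightarrow> a / b \<in> local_ideal"
  by (auto simp: local_ideal_def)

lemma mem_imp_local_ideal: "a \<in> I \<Longrightarrow> a \<in> local_ideal"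
  using local_idealI[of a 1] prime_to_1 by simp

lemma local_ideal_add:
  assumes "y \<in> local_ideal" "y' \<in> local_ideal"
  shows "y + y' \<in> local_ideal"
proof -
  obtain a b a' b' where ab: "y = a / b" "a \<in> I" "algebraic_int b" "prime_to I b"
    "y' = a' / b'" "a' \<in> I" "algebraic_int b'" "prime_to I b'"
    using assms unfolding local_ideal_def by blast
  have "(a * b' + a' * b) / (b * b') \<in> local_ideal"
    using ab by (intro local_idealI mem_add mem_mult algebraic_int_mult prime_to_mult)
  thus ?thesis using prime_to_nonzero ab by (simp add: add_frac_eq)
qed

lemma local_ideal_mult: "y \<in> local_ideal \<Longrightarrow> algebraic_int x \<Longrightarrow> y * x \<in> local_ideal"
  unfolding local_ideal_def by clarify (metis mem_mult times_divide_eq_left)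

lemma local_ideal_uminus: "y \<in> local_ideal \<Longrightarrow> - y \<in> local_ideal"
  using local_ideal_mult[of y "-1"] by (simp add: algebraic_int_minus)

lemma local_ideal_diff: "y \<in> local_ideal \<Longrightarrow> y' \<in> local_ideal \<Longrightarrow> y - y' \<in> local_ideal"
  using local_ideal_add[OF _ local_ideal_uminus, of y y'] by simp

lemma local_ideal_sum: "(\<And>i. i \<in> A \<Longrightarrow> f i \<in> local_ideal) \<Longrightarrow> sum f A \<in> local_ideal"
  by (induction A rule: infinite_finite_induct) (auto simp: mem_imp_local_ideal mem_0 intro: local_ideal_add)

lemma local_ideal_divide:
  assumes "y \<in> local_ideal" "algebraic_int b" "prime_to I b"
  shows "y / b \<in> local_ideal"
proof -
  obtain a b' where ab: "y = a / b'" "a \<in> I" "algebraic_int b'" "prime_to I b'"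
    using assms(1) unfolding local_ideal_def by blast
  have "a / (b' * b) \<in> local_ideal" using ab assms by (intro local_idealI algebraic_int_mult prime_to_mult)
  thus ?thesis by (simp add: ab(1))
qed

text \<open>Contracting the local ideal gives back I. With b c = a in I and b congruent to m, a
  relation k m + l N = 1 writes c as c (k m + l N), which lies in I because N does.\<close>

lemma local_ideal_algebraic_int:
  assumes "c \<in> local_ideal" "algebraic_int c"
  shows "c \<in> I"
proof -
  obtain a b where ab: "c = a / b" "a \<in> I" "algebraic_int b" "prime_to I b"
    using assms unfolding local_ideal_def by blast
  obtain m where m: "b - of_int m \<in> I" using ex_int_residue[OF ab(3)] by blast
  have "coprime m (int N)" by (rule prime_to_imp_coprime[OF ab(4) m])
  then obtain k l where kl: "k * m + l * int N = 1"
    using bezout_int[of m "int N"] by (auto simp: coprime_iff_gcd_eq_1)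
  have NI: "(of_int (int N) :: 'f) \<in> I" by (simp add: of_int_mem_iff del: of_int_of_nat_eq)
  have c: "algebraic_int (c * of_int i)" for i by (rule algebraic_int_mult[OF assms(2) algebraic_int_of_int])
  have "a * of_int k + (of_int (int N) * (c * of_int l) - (b - of_int m) * (c * of_int k)) \<in> I"
    by (rule mem_add[OF mem_mult[OF ab(2) algebraic_int_of_int] mem_diff[OF mem_mult[OF NI c] mem_mult[OF m c]]])
  also have "a * of_int k + (of_int (int N) * (c * of_int l) - (b - of_int m) * (c * of_int k))
      = a * of_int k - b * c * of_int k + c * of_int (k * m + l * int N)"
    by (simp add: algebra_simps)
  also have "b * c = a" using ab(1) prime_to_nonzero[OF ab(4)] by simp
  finally show ?thesis by (simp add: kl)
qed

lemma residue_mod_eq: "residue_mod I y = {c. algebraic_int c \<and> y - c \<in> local_ideal}"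
  unfolding residue_mod_def local_ideal_def by auto

lemma residue_mod_eq_coset:
  assumes "y - of_int m \<in> local_ideal"
  shows "residue_mod I y = I +>\<^bsub>\<O>\<^esub> of_int m"
  unfolding residue_mod_eq coset_eq
proof (intro Collect_cong iffI)
  fix c assume c: "algebraic_int c \<and> y - c \<in> local_ideal"
  have "(y - of_int m) - (y - c) \<in> local_ideal" by (rule local_ideal_diff[OF assms conjunct2[OF c]])
  hence "c - of_int m \<in> local_ideal" by simp
  moreover have "algebraic_int (c - of_int m)" by (rule algebraic_int_diff[OF conjunct1[OF c] algebraic_int_of_int])
  ultimately show "c - of_int m \<in> I" by (rule local_ideal_algebraic_int)
next
  fix c assume c: "c - of_int m \<in> I"
  have "(y - of_int m) - (c - of_int m) \<in> local_ideal"
    by (intro local_ideal_diff assms mem_imp_local_ideal c)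
  moreover have "algebraic_int (c - of_int m + of_int m)"
    by (rule algebraic_int_add[OF mem_algebraic_int[OF c] algebraic_int_of_int])
  ultimately show "algebraic_int c \<and> y - c \<in> local_ideal" by simp
qed

lemma residue_mod_eq_iff:
  assumes "y - of_int m \<in> local_ideal" "y' - of_int m' \<in> local_ideal"
  shows "residue_mod I y = residue_mod I y' \<longleftrightarrow> int N dvd m - m'"
  unfolding residue_mod_eq_coset[OF assms(1)] residue_mod_eq_coset[OF assms(2)] coset_eq_iff
  using of_int_mem_iff[of "m - m'"] by simp

lemma local_ideal_int_cong:
  assumes "y - of_int m \<in> local_ideal" "int N dvd m - m'"
  shows "y - of_int m' \<in> local_ideal"
proof -
  have "of_int (m - m') \<in> local_ideal" using assms(2) by (intro mem_imp_local_ideal) (simp only: of_int_mem_iff)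
  from local_ideal_add[OF assms(1) this] show ?thesis by simp
qed

text \<open>The denominators of \<open>x\<close> form an ideal that is contained in no prime ideal above \<open>I\<close>.\<close>

lemma integral_imp_residue:
  assumes "\<And>P. primeideal P \<O> \<Longrightarrow> I \<subseteq> P \<Longrightarrow> integral_at P x"
  obtains m where "x - of_int m \<in> local_ideal"
proof -
  \<comment> \<open>The residues of the denominators of x; D is an ideal of Z that contains
    N.\<close>
  define D where "D = {d. \<exists>b. algebraic_int b \<and> algebraic_int (b * x) \<and> b - of_int d \<in> I}"
  have D_lin: "k * d + l * e \<in> D" if "d \<in> D" "e \<in> D" for d e k l
  proof -
    from that obtain b c where b: "algebraic_int b" "algebraic_int (b * x)" "b - of_int d \<in> I"
      and c: "algebraic_int c" "algebraic_int (c * x)" "c - of_int e \<in> I" unfolding D_def by blast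
    have "algebraic_int (b * of_int k + c * of_int l)"
      using b c by (intro algebraic_int_add algebraic_int_mult algebraic_int_of_int)
    moreover have "algebraic_int (b * x * of_int k + c * x * of_int l)"
      by (rule algebraic_int_add[OF algebraic_int_mult[OF b(2) algebraic_int_of_int]
            algebraic_int_mult[OF c(2) algebraic_int_of_int]])
    hence "algebraic_int ((b * of_int k + c * of_int l) * x)" by (simp add: algebra_simps)
    moreover have "(b - of_int d) * of_int k + (c - of_int e) * of_int l \<in> I"
      using b c by (intro mem_add mem_mult algebraic_int_of_int)
    hence "(b * of_int k + c * of_int l) - of_int (k * d + l * e) \<in> I" by (simp add: algebra_simps)
    ultimately show ?thesis unfolding D_def by blast
  qed
  have N_D: "int N \<in> D"
    using of_int_mem_iff[of "- int N"] by (auto simp: D_def intro!: exI[of _ 0])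
  have "\<exists>n. n > 0 \<and> int n \<in> D" using N_D N_gt_1 by (intro exI[of _ N]) simp
  \<comment> \<open>The least positive element of D, hence its generator.\<close>
  then obtain n where n: "n > 0" "int n \<in> D" "\<And>n'. n' > 0 \<Longrightarrow> int n' \<in> D \<Longrightarrow> n \<le> n'"
    using exists_least_iff[of "\<lambda>n. n > 0 \<and> int n \<in> D"] by (metis not_less)
  have dvd: "int n dvd d" if "d \<in> D" for d
  proof (rule ccontr)
    assume "\<not> int n dvd d"
    hence "d mod int n \<noteq> 0" by (simp only: dvd_eq_mod_eq_0 not_False_eq_True)
    moreover have "d mod int n \<ge> 0" using n(1) by simp
    ultimately have pos: "nat (d mod int n) > 0" by linarith
    have "1 * d + (- (d div int n)) * int n \<in> D" by (rule D_lin[OF that n(2)])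
    also have "1 * d + (- (d div int n)) * int n = int (nat (d mod int n))"
      using \<open>d mod int n \<ge> 0\<close> minus_div_mult_eq_mod[of d "int n"] by simp
    finally have "int (nat (d mod int n)) \<in> D" .
    from n(3)[OF pos this] have "int n \<le> d mod int n" using n(1) by simp
    moreover have "d mod int n < int n" using n(1) by (intro pos_mod_bound) simp
    ultimately show False by linarith
  qed
  \<comment> \<open>A prime factor of n divides N, since N lies in D. At the prime above it x has a
    denominator b outside that prime, yet the residue of b lies in D and so is divisible by the
    factor.\<close>
  have "n = 1"
  proof (rule ccontr)
    assume "n \<noteq> 1"
    then obtain q' where "prime q'" "q' dvd n" using prime_factor_nat by blast
    hence q: "prime (int q')" "int q' dvd int n" by auto
    have qN: "int q' dvd int N" using q(2) dvd[OF N_D] by (rule dvd_trans)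
    let ?P = "{a. \<exists>k. a - of_int (int q' * k) \<in> I}"
    have "integral_at ?P x" by (rule assms[OF prime_above(1,2)[OF q(1) qN]])
    then obtain a b where ab: "algebraic_int a" "algebraic_int b" "b \<notin> ?P" "x = a / b"
      unfolding integral_at_def by auto
    have b0: "b \<noteq> 0" using ab(3) prime_above(3)[OF q(1) qN, of 0] by auto
    obtain m where m: "b - of_int m \<in> I" using ex_int_residue[OF ab(2)] by blast
    have "m \<in> D" unfolding D_def using ab m b0 by auto
    hence "int q' dvd m" using dvd q(2) dvd_trans by blast
    thus False using prime_above(4)[OF q(1) qN m] ab(3) by blast
  qed
  \<comment> \<open>A denominator congruent to 1 modulo I; x therefore has the same residue as the
    algebraic integer b x.\<close>
  then obtain b where b: "algebraic_int b" "algebraic_int (b * x)" "b - 1 \<in> I"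
    using n(2) unfolding D_def by auto
  have pb: "prime_to I b"
    unfolding prime_to_def
  proof (intro allI impI notI)
    fix P assume P: "primeideal P \<O> \<and> I \<subseteq> P" "b \<in> P"
    then interpret P: primeideal P \<O> by blast
    have "b - (b - 1) \<in> P"
    proof -
      have "(b - 1) * (-1) \<in> P" using P.I_r_closed[of "b - 1" "-1"] P(1) b(3) by (auto simp: algebraic_int_minus)
      thus ?thesis using additive_subgroup.a_closed[OF P.additive_subgroup_axioms P(2), of "(b - 1) * (-1)"] by simp
    qed
    thus False using P.one_imp_carrier P.I_notcarr by simp
  qed
  obtain m where m: "b * x - of_int m \<in> I" using ex_int_residue[OF b(2)] by blast
  have "(b * x - of_int m) - (b - 1) * of_int m \<in> I"
    by (rule mem_diff[OF m mem_mult[OF b(3) algebraic_int_of_int]])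
  hence "((b * x - of_int m) - (b - 1) * of_int m) / b \<in> local_ideal" by (rule local_idealI[OF _ b(1) pb])
  moreover have "((b * x - of_int m) - (b - 1) * of_int m) / b = x - of_int m"
    using prime_to_nonzero[OF pb] by (simp add: field_simps)
  ultimately show ?thesis using that by simp
qed

section \<open>Characters of the cyclic quotient\<close>

lemma coset_of_nat_eq_iff: "I +>\<^bsub>\<O>\<^esub> of_nat m = I +>\<^bsub>\<O>\<^esub> of_nat m' \<longleftrightarrow> m mod N = m' mod N"
proof -
  have "I +>\<^bsub>\<O>\<^esub> of_nat m = I +>\<^bsub>\<O>\<^esub> of_nat m' \<longleftrightarrow> int N dvd int m - int m'"
    unfolding coset_eq_iff using of_int_mem_iff[of "int m - int m'"] by simp
  also have "\<dots> \<longleftrightarrow> int m mod int N = int m' mod int N" by (simp add: mod_eq_dvd_iff)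
  also have "\<dots> \<longleftrightarrow> m mod N = m' mod N" by (simp flip: zmod_int)
  finally show ?thesis .
qed

lemma carrier_quotient_nat: "carrier (\<O> Quot I) = (\<lambda>m. I +>\<^bsub>\<O>\<^esub> of_nat m) ` {..<N}"
proof (intro equalityI subsetI)
  fix c assume "c \<in> carrier (\<O> Quot I)"
  then obtain a where a: "algebraic_int a" "c = I +>\<^bsub>\<O>\<^esub> a" by (auto simp: carrier_quotient)
  obtain m where m: "a - of_int m \<in> I" using ex_int_residue[OF a(1)] by blast
  define k where "k = nat (m mod int N)"
  have k: "k < N" "int k = m mod int N" using N_gt_1 by (auto simp: k_def nat_less_iff)
  have "of_int (m - int k) \<in> I" unfolding of_int_mem_iff k(2) by (simp add: minus_mod_eq_mult_div)
  from mem_add[OF m this] have "c = I +>\<^bsub>\<O>\<^esub> of_nat k" by (simp add: a(2) coset_eq_iff)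
  thus "c \<in> (\<lambda>m. I +>\<^bsub>\<O>\<^esub> of_nat m) ` {..<N}" using k(1) by blast
qed (auto simp: carrier_quotient)

definition root :: complex where "root = cis (2 * pi / real N)"

lemma root_power_eq_1_iff: "root ^ m = 1 \<longleftrightarrow> N dvd m"
proof
  assume "root ^ m = 1"
  hence "cis (real m * (2 * pi / real N)) = 1" by (simp add: root_def DeMoivre)
  hence "cos (real m * (2 * pi / real N)) = 1" by (simp add: complex_eq_iff)
  then obtain n :: int where "real m * (2 * pi / real N) = of_int n * 2 * pi"
    unfolding cos_one_2pi_int by blast
  hence "real m = real_of_int n * real N" using N_gt_1 by (simp add: field_simps)
  hence "real_of_int (int m) = real_of_int (n * int N)" by simp
  hence "int m = n * int N" by (simp only: of_int_eq_iff)
  thus "N dvd m" by (metis dvd_triv_right int_dvd_int_iff)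
next
  assume "N dvd m"
  moreover have "root ^ N = 1" using N_gt_1 by (simp add: root_def DeMoivre)
  ultimately show "root ^ m = 1" by (auto simp: power_mult)
qed

sublocale complex_root: primitive_root_of_unity root N
  by unfold_locales (rule N_gt_1, rule root_power_eq_1_iff)

text \<open>The character that sends the class of 1 to \<open>root ^ k\<close>. The description
  picks the representative below N; by \<open>character_coset\<close> any other gives the same
  value.\<close>

definition character :: "nat \<Rightarrow> 'f set \<Rightarrow> complex" where
  "character k = (\<lambda>c\<in>carrier (\<O> Quot I). root ^ (k * (THE m. m < N \<and> c = I +>\<^bsub>\<O>\<^esub> of_nat m)))"

lemma character_coset: "character k (I +>\<^bsub>\<O>\<^esub> of_nat m) = root ^ (k * m)"
proof -
  have "(THE m'. m' < N \<and> I +>\<^bsub>\<O>\<^esub> of_nat m = I +>\<^bsub>\<O>\<^esub> of_nat m') = m mod N"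
    using N_gt_1 by (intro the_equality) (auto simp: coset_of_nat_eq_iff)
  moreover have "I +>\<^bsub>\<O>\<^esub> of_nat m \<in> carrier (\<O> Quot I)" by (auto simp: carrier_quotient)
  ultimately show ?thesis
    by (simp add: character_def) (rule complex_root.power_cong, simp add: mod_mult_right_eq)
qed

lemma root_of_unity_Units:
  assumes "z ^ N = 1"
  shows "z \<in> Units Qbar"
proof -
  have "z * z ^ (N - 1) = 1" using assms N_gt_1 by (simp flip: power_Suc)
  moreover have "(z ^ (N - 1)) ^ N = 1" 
    using assms by (simp add: power_mult[symmetric] mult.commute[of _ N] power_mult[of z N])
  ultimately show ?thesis
    using algebraic_root_of_unity[of z N] algebraic_root_of_unity[of "z ^ (N - 1)" N] assms N_gt_1
    unfolding Units_def Qbar_simps by (auto simp: mult.commute intro!: exI[of _ "z ^ (N - 1)"])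
qed

text \<open>The class of 1 generates the quotient, so a character is determined by its value there,
  an N-th root of unity. Index 0 is the trivial character.\<close>

lemma bij_betw_character:
  "bij_betw character {1..<N} (quot_characters I - {trivial_character I})"
proof -
  let ?C = "carrier (\<O> Quot I)" and ?q = "\<lambda>m. I +>\<^bsub>\<O>\<^esub> (of_nat m :: 'f)"
  have q_carrier: "?q m \<in> ?C" for m by (auto simp: carrier_quotient)
  have q_add: "?q m \<oplus>\<^bsub>\<O> Quot I\<^esub> ?q m' = ?q (m + m')" for m m' by (simp add: quotient_add)
  have char_mem: "character k \<in> quot_characters I" for k
    unfolding quot_characters_def
  proof (intro IntI homI)
    fix c c' assume "c \<in> carrier (add_monoid (\<O> Quot I))" "c' \<in> carrier (add_monoid (\<O> Quot I))"
    then obtain m m' where m: "c = ?q m" "c' = ?q m'" by (auto simp: carrier_quotient_nat)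
    have "(root ^ (k * m)) ^ N = 1" by (simp add: root_power_eq_1_iff flip: power_mult)
    thus "character k c \<in> carrier (units_of Qbar)"
      by (simp add: m character_coset units_of_carrier root_of_unity_Units)
    show "character k (c \<otimes>\<^bsub>add_monoid (\<O> Quot I)\<^esub> c') = character k c \<otimes>\<^bsub>units_of Qbar\<^esub> character k c'"
      by (simp add: m q_add character_coset units_of_mult Qbar_simps power_add distrib_left del: of_nat_add)
  qed (simp add: character_def)
  have inj: "inj_on character {..<N}"
  proof (rule inj_onI)
    fix k k' assume k: "k \<in> {..<N}" "k' \<in> {..<N}" "character k = character k'"
    from k(3) have "root ^ k = root ^ k'" using character_coset[of k 1] character_coset[of k' 1] by simp
    thus "k = k'" using k complex_root.power_inj by simp
  qed
  have trivial: "trivial_character I = character 0"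
    by (simp add: trivial_character_def character_def)
  have surj: "\<xi> \<in> character ` {..<N}" if \<xi>: "\<xi> \<in> quot_characters I" for \<xi>
  proof -
    have hom: "\<xi> (c \<oplus>\<^bsub>\<O> Quot I\<^esub> c') = \<xi> c * \<xi> c'" if "c \<in> ?C" "c' \<in> ?C" for c c'
      using \<xi> that by (auto simp: quot_characters_def hom_def units_of_mult Qbar_simps)
    have unit: "\<xi> c \<noteq> 0" if "c \<in> ?C" for c
      using \<xi> that by (auto simp: quot_characters_def hom_def Pi_def units_of_carrier Units_def Qbar_simps)
    have "\<xi> (?q 0) * \<xi> (?q 0) = \<xi> (?q 0)" using hom[OF q_carrier[of 0] q_carrier[of 0]] q_add[of 0 0] by simp
    hence one: "\<xi> (?q 0) = 1" using unit[OF q_carrier[of 0]] by simp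
    have pow: "\<xi> (?q m) = \<xi> (?q 1) ^ m" for m
    proof (induction m)
      case (Suc m)
      have "\<xi> (?q (1 + m)) = \<xi> (?q 1) * \<xi> (?q m)" unfolding q_add[symmetric] by (rule hom) (rule q_carrier)+
      thus ?case using Suc by simp
    qed (use one in simp)
    have "?q N = ?q 0" unfolding coset_of_nat_eq_iff by simp
    hence "\<xi> (?q 1) ^ N = 1" using pow[of N] one by simp
    then obtain k where k: "k < N" "\<xi> (?q 1) = root ^ k" by (rule complex_root.root_of_unity_eq_power)
    have "\<xi> = character k"
    proof (rule extensionalityI)
      show "\<xi> \<in> extensional ?C" using \<xi> by (simp add: quot_characters_def)
      show "character k \<in> extensional ?C" by (simp add: character_def)
      fix c assume "c \<in> ?C"
      then obtain m where m: "c = ?q m" by (auto simp: carrier_quotient_nat)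
      show "\<xi> c = character k c" unfolding m character_coset pow[of m] k(2) by (simp add: power_mult)
    qed
    thus ?thesis using k(1) by blast
  qed
  have "quot_characters I = character ` {..<N}" using char_mem surj by blast
  moreover have "{1..<N} = {..<N} - {0}" by auto
  ultimately show ?thesis
    unfolding bij_betw_def trivial using inj N_gt_1
    by (auto simp: inj_on_image_set_diff[OF inj] intro: inj_on_subset)
qed

text \<open>If \<open>\<iota> z = 1\<close> with \<open>z \<noteq> 1\<close> then \<open>\<iota>\<close> would send the invertible element \<open>1 - z\<close> to \<open>0\<close>.\<close>

lemma primitive_root_image:
  fixes \<iota> :: "complex \<Rightarrow> 'a :: field_char_0"
  assumes \<iota>: "\<iota> \<in> Ring.ring_hom Qbar ring_of_type_algebra"
  shows "primitive_root_of_unity (\<iota> root) N" and "\<iota> (root ^ m) = \<iota> root ^ m"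
proof -
  have mult: "\<iota> (x * y) = \<iota> x * \<iota> y" if "Polynomial.algebraic x" "Polynomial.algebraic y" for x y
    using ring_hom_mult[OF \<iota>, of x y] that by (simp add: Qbar_simps ring_of_type_algebra_def)
  have add: "\<iota> (x + y) = \<iota> x + \<iota> y" if "Polynomial.algebraic x" "Polynomial.algebraic y" for x y
    using ring_hom_add[OF \<iota>, of x y] that by (simp add: Qbar_simps ring_of_type_algebra_def)
  have one: "\<iota> 1 = 1" using ring_hom_one[OF \<iota>] by (simp add: Qbar_simps ring_of_type_algebra_def)
  have alg: "Polynomial.algebraic (root ^ m)" for m
    by (rule algebraic_root_of_unity[of _ N]) (use N_gt_1 in \<open>simp_all add: root_power_eq_1_iff flip: power_mult\<close>)
  show pow: "\<iota> (root ^ m) = \<iota> root ^ m" for m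
  proof (induction m)
    case (Suc m)
    thus ?case using mult[OF alg[of 1] alg[of m]] by simp
  qed (simp add: one)
  have "N dvd m" if "\<iota> root ^ m = 1" for m
  proof (rule ccontr)
    let ?z = "root ^ m"
    assume "\<not> N dvd m"
    hence z: "?z \<noteq> 1" by (simp add: root_power_eq_1_iff)
    have zN: "?z ^ N = 1" by (simp add: root_power_eq_1_iff flip: power_mult)
    have alg1: "Polynomial.algebraic (1 - ?z)" by (rule algebraic_one_minus_root_of_unity[OF zN]) (use N_gt_1 in simp)
    hence "Polynomial.algebraic (inverse (1 - ?z))" by (rule algebraic_inverse)
    hence "\<iota> (1 - ?z) * \<iota> (inverse (1 - ?z)) = 1" using mult[OF alg1] z one by (metis right_inverse right_minus_eq)
    moreover have "\<iota> (1 - ?z) + \<iota> ?z = 1" using add[OF alg1 alg[of m]] one by simp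
    ultimately show False using that by (simp add: pow)
  qed
  moreover have "\<iota> root ^ m = 1" if "N dvd m" for m
    using that pow[of m] one by (simp add: root_power_eq_1_iff[THEN iffD2])
  ultimately show "primitive_root_of_unity (\<iota> root) N"
    by unfold_locales (use N_gt_1 in auto)
qed

end

section \<open>The measure attached to a number field\<close>

lemma rat_basis_scale:
  fixes v :: "'n \<Rightarrow> 'f :: field_char_0"
  assumes v: "rat_basis v" and c: "c \<noteq> 0"
  shows "rat_basis (\<lambda>i. of_rat c * v i)"
proof -
  interpret lin: Vector_Spaces.linear "rat_scale :: rat \<Rightarrow> 'f \<Rightarrow> 'f" rat_scale "\<lambda>y. of_rat c * y"
    by unfold_locales (auto simp: algebra_simps)
  have inj: "inj (\<lambda>y :: 'f. of_rat c * y)" using c by (auto intro: injI)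
  have range: "range (\<lambda>i. of_rat c * v i) = (\<lambda>y. of_rat c * y) ` range v" by auto
  have "rat.span (range (\<lambda>i. of_rat c * v i)) = (\<lambda>y. of_rat c * y) ` UNIV"
    using v unfolding range lin.span_image by (simp add: rat_basis_def)
  also have "\<dots> = UNIV"
  proof (intro equalityI subsetI)
    fix y :: 'f
    have "y = of_rat c * (y / of_rat c)" using c by simp
    thus "y \<in> (\<lambda>y. of_rat c * y) ` UNIV" by blast
  qed simp
  finally have "rat.span (range (\<lambda>i. of_rat c * v i)) = UNIV" .
  moreover have "rat.independent (range (\<lambda>i. of_rat c * v i))"
    unfolding range using v inj
    by (intro lin.independent_injective_image) (auto simp: rat_basis_def intro: inj_on_subset)
  moreover have "inj (\<lambda>i. of_rat c * v i)"
    using v c by (auto simp: rat_basis_def inj_def)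
  ultimately show ?thesis by (simp add: rat_basis_def)
qed

lemma rat_basis_dagger_basis: "rat_basis v \<Longrightarrow> rat_basis (dagger_basis TYPE('p :: prime_type) r v)"
  using rat_basis_scale[of v "1 / of_nat CARD('p) ^ r"]
  by (simp add: dagger_basis_def of_rat_divide of_rat_power)

lemma dagger_basis_prime_power: "of_nat CARD('p) ^ r * dagger_basis TYPE('p :: prime_type) r v i = v i"
  by (simp add: dagger_basis_def)

lemma lattice_coset_dagger_basis:
  "lattice_coset v n \<alpha> = lattice_coset (dagger_basis TYPE('p :: prime_type) r v) (n + r) (\<alpha> :: ('f :: field_char_0, 'p padic) rat_tensor)"
  unfolding lattice_coset_def power_add mult.assoc dagger_basis_prime_power ..

text \<open>v_i is p^r times the i-th vector of the finer basis, and the power of p can be moved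
  across the tensor sign.\<close>

lemma lattice_point_dagger_basis:
  assumes "tensor x 1 = lattice_point (dagger_basis TYPE('p :: prime_type) r v) (x' :: 'n :: finite \<Rightarrow> 'p padic_int)"
  shows "tensor (x + (\<Sum>i\<in>UNIV. of_nat (l i) * v i)) 1
    = lattice_point (dagger_basis TYPE('p) r v) (\<lambda>i. x' i + of_nat CARD('p) ^ r * of_nat (l i))"
proof -
  have nat: "of_nat k = to_fract (of_nat k :: 'p padic_int)" for k by (induction k) auto
  have "tensor (of_nat (l i) * v i) (1 :: 'p padic)
      = tensor (dagger_basis TYPE('p) r v i) (to_fract (of_nat CARD('p) ^ r * of_nat (l i)))" for i
  proof -
    have "tensor (of_nat (l i) * v i) (1 :: 'p padic) = tensor (of_rat (of_nat (l i)) * v i) 1" by simp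
    also have "\<dots> = tensor (v i) (to_fract (of_nat (l i)))"
      by (subst tensor_balanced) (simp add: nat)
    also have "\<dots> = tensor (of_nat CARD('p) ^ r * dagger_basis TYPE('p) r v i) (to_fract (of_nat (l i)))"
      by (simp only: dagger_basis_prime_power)
    also have "\<dots> = tensor (dagger_basis TYPE('p) r v i) (to_fract (of_nat CARD('p) ^ r * of_nat (l i)))"
      by (rule tensor_prime_power_left)
    finally show ?thesis .
  qed
  thus ?thesis
    unfolding lattice_point_add tensor_add_left tensor_sum_left assms by (simp only: lattice_point_def)
qed

lemma padic_coefficient_ring_integers:
  assumes "finite_padic_extension K"
  shows "padic_coefficient_ring (padic_integers_of K)"
proof
  have ring: "subring K ring_of_type_algebra" and ac: "range to_ac \<subseteq> K"
    using assms subfieldE(1) by (auto simp: finite_padic_extension_def)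
  show "emb a \<in> padic_integers_of K" for a
    using ac integral_over_Zp_emb by (auto simp: padic_integers_of_eq)
  show "x + y \<in> padic_integers_of K" if "x \<in> padic_integers_of K" "y \<in> padic_integers_of K" for x y
    using that subringE(7)[OF ring, of x y] integral_over_Zp_add[of x y]
    by (simp add: padic_integers_of_eq ring_of_type_algebra_def)
  show "x * y \<in> padic_integers_of K" if "x \<in> padic_integers_of K" "y \<in> padic_integers_of K" for x y
    using that subringE(6)[OF ring, of x y] integral_over_Zp_mult[of x y]
    by (simp add: padic_integers_of_eq ring_of_type_algebra_def)
  show "z = 0" if "\<And>j. \<exists>s\<in>padic_integers_of K. z = of_nat CARD('a) ^ j * s" for z
    using that by (intro integral_over_Zp_separated) (auto simp: padic_integers_of_eq)
qed

text \<open>An integer prime to p is a unit of Z_p. This is how the denominators N of the inverses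
  of 1 - zeta^(p^e) are absorbed into R.\<close>

lemma inverse_of_nat_emb:
  assumes "coprime CARD('p :: prime_type) N"
  shows "\<exists>b :: 'p padic_int. 1 / of_nat N = emb b"
proof -
  have "\<not> of_nat CARD('p) ^ 1 dvd (of_int (int N) :: 'p padic_int)"
  proof
    assume "of_nat CARD('p) ^ 1 dvd (of_int (int N) :: 'p padic_int)"
    hence "CARD('p) dvd N" unfolding padic_power_dvd_int_iff by simp
    hence "is_unit CARD('p)" using assms by (metis coprime_absorb_left)
    thus False using prime_type_gt_1[where 'p = 'p] by simp
  qed
  hence "(of_nat N :: 'p padic_int) dvd 1" by (intro not_prime_dvd_padic_unit) simp
  then obtain b :: "'p padic_int" where "of_nat N * b = 1" by (metis dvdE)
  hence "emb (of_nat N) * emb b = 1" by (simp only: emb.hom_mult[symmetric] emb.hom_one)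
  hence "of_nat N * emb b = 1" by (simp only: emb.hom_of_nat)
  hence "1 / of_nat N = emb b" by (metis divide_eq_eq mult.commute mult_zero_left zero_neq_one)
  thus ?thesis ..
qed

section \<open>Values in Z[1/N]\<close>

definition denominator_power :: "nat \<Rightarrow> 'a :: field_char_0 set" where
  "denominator_power N = {y. \<exists>(a :: int) (j :: nat). y = of_int a / of_nat N ^ j}"

lemma denominator_power_add:
  assumes "y \<in> denominator_power N" "z \<in> denominator_power N" "N > 0"
  shows "y + z \<in> denominator_power N"
proof -
  obtain a j b k where "y = of_int a / of_nat N ^ j" "z = of_int b / of_nat N ^ k"
    using assms by (auto simp: denominator_power_def)
  hence "y + z = of_int (a * int N ^ k + b * int N ^ j) / of_nat N ^ (j + k)"
    using assms(3) by (simp add: add_frac_eq power_add)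
  thus ?thesis unfolding denominator_power_def by blast
qed

lemma denominator_power_0: "0 \<in> denominator_power N"
  unfolding denominator_power_def by (auto intro!: exI[of _ 0])

lemma denominator_power_sum:
  "N > 0 \<Longrightarrow> (\<And>i. i \<in> A \<Longrightarrow> f i \<in> denominator_power N) \<Longrightarrow> sum f A \<in> denominator_power N"
  by (induction A rule: infinite_finite_induct) (auto simp: denominator_power_0 intro: denominator_power_add)

text \<open>For even N the number (N - 1)/2 is not an integer, but N (N - 1) is always even, so it
  is an integer divided by N.\<close>

lemma half_pred_power_denominator:
  assumes "N > 0"
  shows "(-1) ^ c * (1 / of_nat N ^ (c - 1) * of_nat h - ((of_nat N - 1) / 2) ^ c) \<in> denominator_power N"
proof -
  define b where "b = N * (N - 1) div 2"
  have "even (N * (N - 1))" by (cases N) auto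
  hence "2 * b = N * (N - 1)" unfolding b_def by (rule dvd_mult_div_cancel)
  hence "2 * (of_nat b :: 'a) = of_nat N * (of_nat N - 1)"
    using assms by (metis of_nat_1 of_nat_diff of_nat_mult of_nat_numeral Suc_leI One_nat_def)
  hence half: "(of_nat N - 1) / 2 = (of_nat b / of_nat N :: 'a)"
    using assms by (simp add: field_simps)
  have "(-1) ^ c * (1 / of_nat N ^ (c - 1) * of_nat h) = (of_int ((-1) ^ c * int h) / of_nat N ^ (c - 1) :: 'a)"
    by simp
  hence 1: "(-1) ^ c * (1 / of_nat N ^ (c - 1) * of_nat h) \<in> (denominator_power N :: 'a set)"
    unfolding denominator_power_def by blast
  have "- ((-1) ^ c * ((of_nat N - 1) / 2) ^ c) = (of_int (- ((-1) ^ c * int b ^ c)) / of_nat N ^ c :: 'a)"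
    by (simp add: half power_divide)
  hence 2: "- ((-1) ^ c * ((of_nat N - 1) / 2) ^ c) \<in> (denominator_power N :: 'a set)"
    unfolding denominator_power_def by blast
  from denominator_power_add[OF 1 2 assms] show ?thesis by (simp add: right_diff_distrib)
qed

text \<open>Once x and the v_i are replaced by integer residues a and u_i, the measure is a
  \<open>geometric_measure\<close> whose masses are Dedekind sums. Both claims follow from the same
  evaluation \<open>dist\<close> of these masses.\<close>

lemma (in cyclic_quotient) measure_values:
  fixes v :: "'n :: finite \<Rightarrow> 'f" and \<iota> :: "complex \<Rightarrow> 'p :: prime_type padic alg_closure"
  assumes p: "prime_to I (of_nat CARD('p))"
    and x: "\<And>P. primeideal P \<O> \<Longrightarrow> I \<subseteq> P \<Longrightarrow> integral_at P x"
    and v: "rat_basis v" "\<And>i. algebraic_int (v i)" "\<And>i. prime_to I (v i)"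
    and lattice: "(tensor x 1 :: ('f, 'p padic) rat_tensor) \<in> padic_lattice (dagger_basis TYPE('p) r v)"
    and K: "finite_padic_extension K" "{z. z ^ N = 1} \<subseteq> K"
    and \<iota>: "\<iota> \<in> Ring.ring_hom Qbar ring_of_type_algebra"
  defines "\<mu> \<equiv> \<mu>_measure \<iota> (padic_integers_of K) r v x I"
  shows "U \<in> compact_opens (dagger_basis TYPE('p) r v) \<Longrightarrow> \<mu> U \<in> denominator_power N"
    and "(\<And>i. l i < CARD('p) ^ n) \<Longrightarrow>
      \<mu> (lattice_coset v n (tensor (x + (\<Sum>i\<in>UNIV. of_nat (l i) * v i)) 1)) =
        (-1) ^ CARD('n) * (1 / of_nat N ^ (CARD('n) - 1)
          * of_nat (H_sum I v ((x + (\<Sum>i\<in>UNIV. of_nat (l i) * v i)) / of_nat CARD('p) ^ n))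
          - ((of_nat N - 1) / 2) ^ CARD('n))"
proof -
  define w where "w = dagger_basis TYPE('p) r v"
  define R where "R = padic_integers_of K"
  define \<omega> where "\<omega> = \<iota> root"
  have w: "rat_basis w" unfolding w_def by (rule rat_basis_dagger_basis[OF v(1)])
  interpret R: padic_coefficient_ring R
    unfolding R_def by (rule padic_coefficient_ring_integers[OF K(1)])
  interpret \<omega>: primitive_root_of_unity \<omega> N
    unfolding \<omega>_def by (rule primitive_root_image(1)[OF \<iota>])
  have N: "N > 0" using N_gt_1 by simp
  have pN: "coprime CARD('p) N"
    using prime_to_imp_coprime[OF p, of "int CARD('p)"] by (simp add: mem_0)
  have pnN: "coprime (CARD('p) ^ e) N" for e using pN by simp
  have nat_residue: "\<exists>m :: nat. y - of_nat m \<in> local_ideal" if y: "y - of_int k \<in> local_ideal" for y k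
  proof -
    have "y - of_int (k mod int N) \<in> local_ideal"
      by (rule local_ideal_int_cong[OF y]) (simp add: minus_mod_eq_mult_div)
    moreover have "k mod int N = int (nat (k mod int N))" using N by simp
    ultimately show ?thesis by (metis of_int_of_nat_eq)
  qed
  obtain a where a: "x - of_nat a \<in> local_ideal"
    using integral_imp_residue[OF x] nat_residue by metis
  have "\<exists>m :: nat. v i - of_nat m \<in> local_ideal" for i
    using ex_int_residue[OF v(2)[of i]] mem_imp_local_ideal nat_residue by blast
  then obtain u where u: "\<And>i. v i - of_nat (u i) \<in> local_ideal" by metis
  have u_int: "v i - of_int (int (u i)) \<in> I" for i
  proof (rule local_ideal_algebraic_int)
    show "v i - of_int (int (u i)) \<in> local_ideal" using u by simp
    show "algebraic_int (v i - of_int (int (u i)))" by (rule algebraic_int_diff[OF v(2) algebraic_int_of_int])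
  qed
  have uN: "coprime (u i) N" for i
    using prime_to_imp_coprime[OF v(3) u_int, of i] by simp
  obtain x' :: "'n \<Rightarrow> 'p padic_int" where x': "(tensor x 1 :: ('f, 'p padic) rat_tensor) = lattice_point w x'"
    using lattice unfolding w_def padic_lattice_eq by blast
  have R_power: "\<omega> ^ k \<in> R" for k
  proof -
    have "(\<omega> ^ k) ^ N = 1" by (simp add: \<omega>.power_eq_1_iff flip: power_mult)
    thus ?thesis using K(2) integral_over_Zp_power_eq_1[OF _ N] by (auto simp: R_def padic_integers_of_eq)
  qed
  obtain b :: "'p padic_int" where b: "1 / of_nat N = emb b" using inverse_of_nat_emb[OF pN] by blast
  \<comment> \<open>That v_i is prime to the ideal makes omega^(k u_i p^e) different from 1; that N
    is a unit of Z_p puts the inverse of the difference into R.\<close>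
  have adm: "R.admissible (\<omega> ^ (k * u i))" if k: "k \<in> {1..<N}" for k i
    unfolding R.admissible_def
  proof (intro conjI allI)
    show "\<omega> ^ (k * u i) \<in> R" by (rule R_power)
    fix e
    let ?z = "(\<omega> ^ (k * u i)) ^ CARD('p) ^ e"
    have z: "?z = \<omega> ^ (k * (u i * CARD('p) ^ e))" by (simp only: power_mult[symmetric] mult.assoc)
    show z1: "?z \<noteq> 1" unfolding z by (rule \<omega>.power_unit_neq_1[OF k]) (use uN pN in simp)
    have zN: "?z ^ N = 1" by (simp add: \<omega>.power_eq_1_iff flip: power_mult)
    have "1 / (1 - ?z) = - ((\<Sum>d\<in>{1..<N}. of_nat d * ?z ^ d) * emb b)"
      using root_of_unity_inverse[OF zN z1 N] by (simp flip: b)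
    also have "\<dots> \<in> R"
      unfolding z by (intro R.uminus_mem R.mult_mem R.sum_mem R.of_nat_mem R.power_mem R_power R.emb_mem)
    finally show "1 / (1 - ?z) \<in> R" .
  qed
  interpret G: geometric_measure R "{1..<N}" "\<lambda>k. \<omega> ^ (k * a)" "\<lambda>k i. \<omega> ^ (k * u i)" x' r
    by unfold_locales (simp_all only: R_power adm)
  have res: "\<iota> (character k (residue_mod I y)) = \<omega> ^ (k * m)" if "y - of_nat m \<in> local_ideal" for k y m
    using that residue_mod_eq_coset[of y "int m"]
    by (simp add: character_coset primitive_root_image(2)[OF \<iota>] \<omega>_def)
  have "f_series \<iota> r v x I = G.series"
  proof
    fix m
    have "f_series \<iota> r v x I m = (\<Sum>k\<in>{1..<N}. \<iota> (character k (residue_mod I x)) *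
        sep_prod (\<lambda>i. t_power w (tensor x 1 :: ('f, 'p padic) rat_tensor) i *
          inverse (1 - fps_const (\<iota> (character k (residue_mod I (v i)))) * fps_binomial (of_nat (CARD('p) ^ r)))) m)"
      unfolding f_series_def w_def[symmetric] by (rule sum.reindex_bij_betw[OF bij_betw_character, symmetric])
    also have "\<dots> = G.series m"
      unfolding res[OF a] res[OF u] G.series_def x' t_power_def padic_coords_lattice_point[OF w] ..
    finally show "f_series \<iota> r v x I m = G.series m" .
  qed
  hence \<mu>: "\<mu> = G.extension w"
    unfolding \<mu>_def \<mu>_measure_def using G.measure_of_series_eq[OF w] by (simp add: w_def R_def)
  have dist: "G.distribution n (\<lambda>i. x' i + of_nat CARD('p) ^ r * of_nat (l i))
      = (-1) ^ CARD('n) * (1 / of_nat N ^ (CARD('n) - 1)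
          * of_nat (\<Sum>d | (\<forall>i. 1 \<le> d i \<and> d i < N) \<and> N dvd s + (\<Sum>i\<in>UNIV. d i * u i). \<Prod>i\<in>UNIV. d i)
          - ((of_nat N - 1) / 2) ^ CARD('n))"
    if n: "r \<le> n" and l: "\<And>i. l i < CARD('p) ^ (n - r)"
      and s: "CARD('p) ^ (n - r) * s mod N = (a + (\<Sum>i\<in>UNIV. u i * l i)) mod N" for n l s
    unfolding G.distribution_at[OF n l cylinder_self] \<omega>.Dedekind_sum_rescale[OF uN pnN s]
    by (rule \<omega>.Dedekind_sum_eq[OF uN])
  \<comment> \<open>p^e is invertible modulo N; s is the residue that c / p^e has there.\<close>
  have ex_s: "\<exists>s. CARD('p) ^ e * s mod N = c mod N" for e c
  proof -
    obtain t where "[CARD('p) ^ e * t = Suc 0] (mod N)" using cong_solve_coprime_nat[OF pnN] by blast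
    hence "[CARD('p) ^ e * t * c = Suc 0 * c] (mod N)" by (rule cong_scalar_right)
    thus ?thesis by (auto simp: cong_def mult.assoc)
  qed
  show "\<mu> U \<in> denominator_power N" if U: "U \<in> compact_opens (dagger_basis TYPE('p) r v)"
  proof -
    obtain n A where nA: "r \<le> n" "\<mu> U = (\<Sum>t\<in>A. G.distribution n t)"
      using G.extension_compact_open[OF w] U unfolding \<mu> w_def by metis
    have "G.distribution n t \<in> denominator_power N" for t
    proof (rule G.distribution_cases[OF nA(1), of t])
      assume "G.distribution n t = 0"
      thus ?thesis by (simp add: denominator_power_0)
    next
      fix l assume l: "\<And>i. l i < CARD('p) ^ (n - r)"
        and t: "t \<in> cylinder n (\<lambda>i. x' i + of_nat CARD('p) ^ r * of_nat (l i))"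
      obtain s where "CARD('p) ^ (n - r) * s mod N = (a + (\<Sum>i\<in>UNIV. u i * l i)) mod N" using ex_s by blast
      from dist[OF nA(1) l this] show ?thesis
        using G.g_cong[OF t] by (simp only: half_pred_power_denominator[OF N])
    qed
    thus ?thesis unfolding nA(2) by (intro denominator_power_sum N)
  qed
  assume l: "\<And>i. l i < CARD('p) ^ n"
  define y where "y = (x + (\<Sum>i\<in>UNIV. of_nat (l i) * v i)) / of_nat CARD('p) ^ n"
  obtain s where s: "CARD('p) ^ n * s mod N = (a + (\<Sum>i\<in>UNIV. u i * l i)) mod N" using ex_s by blast
  \<comment> \<open>The numerator of y is congruent to a + sum u_i l_i, hence to p^n s. Division by
    p^n stays in the local ideal because p is prime to I.\<close>
  have y: "y - of_nat s \<in> local_ideal"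
  proof -
    have "(x - of_nat a) + (\<Sum>i\<in>UNIV. (v i - of_nat (u i)) * of_nat (l i)) \<in> local_ideal"
      by (intro local_ideal_add local_ideal_sum local_ideal_mult a u algebraic_int_of_nat)
    also have "(x - of_nat a) + (\<Sum>i\<in>UNIV. (v i - of_nat (u i)) * of_nat (l i))
        = (x + (\<Sum>i\<in>UNIV. of_nat (l i) * v i)) - of_int (int (a + (\<Sum>i\<in>UNIV. u i * l i)))"
      by (simp add: algebra_simps sum_subtractf)
    finally have "(x + (\<Sum>i\<in>UNIV. of_nat (l i) * v i)) - of_int (int (CARD('p) ^ n * s)) \<in> local_ideal"
      by (rule local_ideal_int_cong) (metis mod_eq_dvd_iff of_nat_mod s)
    moreover have "algebraic_int (of_nat CARD('p) ^ n :: 'f) \<and> prime_to I (of_nat CARD('p) ^ n)"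
      using prime_to_power[OF p] by simp
    ultimately have "((x + (\<Sum>i\<in>UNIV. of_nat (l i) * v i)) - of_int (int (CARD('p) ^ n * s))) / of_nat CARD('p) ^ n \<in> local_ideal"
      using local_ideal_divide by blast
    thus ?thesis by (simp add: y_def diff_divide_distrib)
  qed
  \<comment> \<open>A coset of level n for V is one of level n + r for the finer basis, so the
    scaling factor P in the masses is p^n.\<close>
  have "\<mu> (lattice_coset v n (tensor (x + (\<Sum>i\<in>UNIV. of_nat (l i) * v i)) 1))
      = G.distribution (n + r) (\<lambda>i. x' i + of_nat CARD('p) ^ r * of_nat (l i))"
    unfolding lattice_coset_dagger_basis[of v n _ r, where 'p = 'p] lattice_point_dagger_basis[OF x'[unfolded w_def]]
    unfolding w_def[symmetric] lattice_coset_lattice_point \<mu> by (rule G.extension_cylinder[OF w]) simp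
  also have "\<dots> = (-1) ^ CARD('n) * (1 / of_nat N ^ (CARD('n) - 1)
          * of_nat (\<Sum>d | (\<forall>i. 1 \<le> d i \<and> d i < N) \<and> N dvd s + (\<Sum>i\<in>UNIV. d i * u i). \<Prod>i\<in>UNIV. d i)
          - ((of_nat N - 1) / 2) ^ CARD('n))"
    by (rule dist) (use l s in simp_all)
  also have "(\<Sum>d | (\<forall>i. 1 \<le> d i \<and> d i < N) \<and> N dvd s + (\<Sum>i\<in>UNIV. d i * u i). \<Prod>i\<in>UNIV. d i) = H_sum I v y"
  proof -
    have "residue_mod I (\<Sum>i\<in>UNIV. of_nat (d i) * v i) = residue_mod I (- y)
        \<longleftrightarrow> N dvd s + (\<Sum>i\<in>UNIV. d i * u i)" for d
    proof -
      have "(\<Sum>i\<in>UNIV. (v i - of_nat (u i)) * of_nat (d i)) \<in> local_ideal"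
        by (intro local_ideal_sum local_ideal_mult u algebraic_int_of_nat)
      hence 1: "(\<Sum>i\<in>UNIV. of_nat (d i) * v i) - of_int (int (\<Sum>i\<in>UNIV. d i * u i)) \<in> local_ideal"
        by (simp add: algebra_simps sum_subtractf)
      have 2: "- y - of_int (- int s) \<in> local_ideal"
        using local_ideal_uminus[OF y] by simp
      have "int N dvd int (\<Sum>i\<in>UNIV. d i * u i) - (- int s) \<longleftrightarrow> N dvd s + (\<Sum>i\<in>UNIV. d i * u i)"
        by (metis add.commute diff_minus_eq_add int_dvd_int_iff of_nat_add)
      thus ?thesis using residue_mod_eq_iff[OF 1 2] by simp
    qed
    thus ?thesis by (simp add: H_sum_def card_quotient[symmetric])
  qed
  finally show "\<mu> (lattice_coset v n (tensor (x + (\<Sum>i\<in>UNIV. of_nat (l i) * v i)) 1)) =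
        (-1) ^ CARD('n) * (1 / of_nat N ^ (CARD('n) - 1)
          * of_nat (H_sum I v ((x + (\<Sum>i\<in>UNIV. of_nat (l i) * v i)) / of_nat CARD('p) ^ n))
          - ((of_nat N - 1) / 2) ^ CARD('n))"
    unfolding y_def .
qed

theorem theorem3p6:
  fixes \<N> :: "'f :: field_char_0 set"
    and v :: "'n :: finite \<Rightarrow> 'f"
    and x :: 'f
    and N r :: nat
    and K R :: "'p :: prime_type padic alg_closure set"
    and \<iota> :: "complex \<Rightarrow> 'p padic alg_closure"
  assumes "rat_degree TYPE('f) = CARD('n)"
    and "totally_real TYPE('f)"
    and "ideal \<N> \<O>" and "\<N> \<noteq> {0}" and "\<N> \<noteq> carrier \<O>"
    and "prime_to \<N> (of_nat CARD('p))"
    and "N = card (carrier (\<O> Quot \<N>))"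
    and "\<O> Quot \<N> \<simeq> ZFact (int N)"
    and "\<And>P. primeideal P \<O> \<Longrightarrow> \<N> \<subseteq> P \<or> of_nat CARD('p) \<in> P \<Longrightarrow> integral_at P x"
    and "rat_basis v"
    and "\<And>i. v i \<in> carrier \<O>"
    and "\<And>i. totally_positive (v i)"
    and "\<And>i. prime_to \<N> (v i)"
    and "(tensor x 1 :: ('f, 'p padic) rat_tensor) \<in> padic_lattice (dagger_basis TYPE('p) r v)"
    and "finite_padic_extension K" and "{z. z ^ N = 1} \<subseteq> K" and "R = padic_integers_of K"
    and "\<iota> \<in> ring_hom Qbar ring_of_type_algebra"
  shows "(\<forall>U \<in> compact_opens (dagger_basis TYPE('p) r v).
            \<exists>(a :: int) (j :: nat). \<mu>_measure \<iota> R r v x \<N> U = of_int a / of_nat N ^ j)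
       \<and> (\<forall>(n :: nat) (l :: 'n \<Rightarrow> int). (\<forall>i. 0 \<le> l i \<and> l i < int CARD('p) ^ n) \<longrightarrow>
            \<mu>_measure \<iota> R r v x \<N>
              (lattice_coset v n (tensor (x + (\<Sum>i\<in>UNIV. of_int (l i) * v i)) 1)) =
            of_rat ((-1) ^ CARD('n) *
              (1 / of_nat N ^ (CARD('n) - 1)
                 * of_nat (H_sum \<N> v ((x + (\<Sum>i\<in>UNIV. of_int (l i) * v i)) / of_nat CARD('p) ^ n))
               - ((of_nat N - 1) / 2) ^ CARD('n))))"
proof -
  interpret cyclic_quotient \<N> N
    using assms(3,4,5,7,8) by (rule cyclic_quotient.intro)
  have v: "algebraic_int (v i)" for i using assms(11)[of i] by simp
  \<comment> \<open>The placeholder stands for the integrality of x at the primes containing the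
    ideal, which \<open>assms(9)\<close> supplies in each of the two uses.\<close>
  note vals = measure_values[OF assms(6) _ assms(10) v assms(13) assms(14) assms(15) assms(16) assms(18),
      folded assms(17)]
  show ?thesis
  proof (intro conjI ballI allI impI)
    fix U :: "('f, 'p padic) rat_tensor set"
    assume "U \<in> compact_opens (dagger_basis TYPE('p) r v)"
    hence "\<mu>_measure \<iota> R r v x \<N> U \<in> denominator_power N"
      by (rule vals(1)[rotated]) (use assms(9) in blast)
    thus "\<exists>(a :: int) (j :: nat). \<mu>_measure \<iota> R r v x \<N> U = of_int a / of_nat N ^ j"
      by (simp add: denominator_power_def)
  next
    fix n and l :: "'n \<Rightarrow> int"
    assume l: "\<forall>i. 0 \<le> l i \<and> l i < int CARD('p) ^ n"
    define k where "k i = nat (l i)" for i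
    have lk: "of_int (l i) = (of_nat (k i) :: 'f)" for i using l by (simp add: k_def)
    have "k i < CARD('p) ^ n" for i
    proof -
      have "int (k i) < int (CARD('p) ^ n)" using l by (simp add: k_def)
      thus ?thesis by (simp only: of_nat_less_iff)
    qed
    hence "\<mu>_measure \<iota> R r v x \<N> (lattice_coset v n (tensor (x + (\<Sum>i\<in>UNIV. of_nat (k i) * v i)) 1)) =
        (-1) ^ CARD('n) * (1 / of_nat N ^ (CARD('n) - 1)
          * of_nat (H_sum \<N> v ((x + (\<Sum>i\<in>UNIV. of_nat (k i) * v i)) / of_nat CARD('p) ^ n))
          - ((of_nat N - 1) / 2) ^ CARD('n))"
      by (intro vals(2)) (use assms(9) in blast)+
    thus "\<mu>_measure \<iota> R r v x \<N> (lattice_coset v n (tensor (x + (\<Sum>i\<in>UNIV. of_int (l i) * v i)) 1)) =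
        of_rat ((-1) ^ CARD('n) * (1 / of_nat N ^ (CARD('n) - 1)
          * of_nat (H_sum \<N> v ((x + (\<Sum>i\<in>UNIV. of_int (l i) * v i)) / of_nat CARD('p) ^ n))
          - ((of_nat N - 1) / 2) ^ CARD('n)))"
      unfolding lk by (simp add: of_rat_mult of_rat_diff of_rat_divide of_rat_power of_rat_minus)
  qed
qed

end
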